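(* Fix $d\ge2$, let $u=e_1+\dots+e_d=(1,\dots,1)$, let $\mu$ be a probability measure on $\mathcal{P}$ and let $(X_n)_{n\ge 0}$ be the random walk in i.i.d. random environment determined by $\mu$, with annealed law $P$. Suppose that $\mu(\overline{\omega}_o\cdot u\ge0)=1$ and that $\mu(\overline{\omega}_o\cdot u\ge a)=b$ for some $a,b>0$. If $\frac{ab}{1-b}>1$ then $X$ is transient in direction $u$, $P$-almost surely, i.e. $X_n\cdot u\to+\infty$ $P$-almost surely. If $\frac{ab}{1-b}>2$ then $X$ has positive speed in direction $u$, $P$-almost surely, i.e. $\lim_{n\to\infty}n^{-1}X_n\cdot u$ exists and is strictly positive $P$-almost surely. (When $b=1$, $\frac{ab}{1-b}$ is interpreted as $+\infty$.)
   Context: $\mathcal{E}=\{\pm e_i: i=1,\dots,d\}$ is the set of unit vectors in $\mathbb{Z}^d$ and $o$ is the origin. $\mathcal{P}$ is the set of probability measures on $\mathcal{E}$, and $\mu$ is a probability measure on $\mathcal{P}$. $\Omega=\mathcal{P}^{\mathbb{Z}^d}$ carries the product measure $\nu=\mu^{\otimes\mathbb{Z}^d}$; an environment is $\omega=(\omega_x)_{x\in\mathbb{Z}^d}\in\Omega$ (so the $\omega_x$ are i.i.d. with law $\mu$ under $\nu$), and $\omega_x(e)$ means $\omega_x(\{e\})$. Given $\omega$, $\mathbb{P}_\omega$ is the law of the time-homogeneous Markov chain $(X_n)_{n\ge0}$ on $\mathbb{Z}^d$ with $X_0=o$ and transition probability $\omega_x(e)$ from $x$ to $x+e$, $e\in\mathcal{E}$.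 The annealed law is $P(\cdot)=\int \mathbb{P}_\omega(\cdot)\,d\nu(\omega)$. No ellipticity is assumed: $\omega_x(e)$ may vanish. For $x\in\mathbb{Z}^d$, $\overline{\omega}_x\in\mathbb{R}^d$ is the vector with entries $\overline{\omega}_x^{[i]}=\omega_x(e_i)-\omega_x(-e_i)$, $i=1,\dots,d$; thus $\overline{\omega}_x\cdot u=\sum_{e\in\mathcal{E}}(e\cdot u)\,\omega_x(e)$ is the quenched drift at $x$ in direction $u$. Since $\omega_o$ has law $\mu$, probabilities of events concerning $\omega_o$ are written with $\mu$. *)

theory Defs
  imports "HOL-Probability.Probability"
begin

section \<open>The lattice and its unit vectors\<close>

text \<open>The lattice \<open>\<int>\<^sup>d\<close> is the type \<^typ>\<open>int ^ 'd\<close>, with \<open>d = CARD('d)\<close> and origin \<open>0\<close>.\<close>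

definition unit_vectors :: "(int ^ 'd) set" where
  "unit_vectors = (\<Union>i. {axis i 1, - axis i 1})"

definition real_vec :: "int ^ 'd \<Rightarrow> real ^ 'd" where
  "real_vec x = (\<chi> i. real_of_int (x $ i))"

definition diagonal :: "real ^ 'd" where
  "diagonal = (\<Sum>i\<in>UNIV. axis i 1)"


section \<open>Environments\<close>

text \<open>
  The set \<open>\<P>\<close> of probability measures on the unit vectors, with its usual \<open>\<sigma>\<close>-algebra, the one
  generated by the evaluations \<open>p \<mapsto> p A\<close>.
\<close>

definition transition_laws :: "(int ^ 'd) measure measure" where
  "transition_laws = prob_algebra (count_space unit_vectors)"

definition environment_law ::
  "(int ^ 'd) measure measure \<Rightarrow> (int ^ 'd \<Rightarrow> (int ^ 'd) measure) measure" where
  "environment_law \<mu> = PiM UNIV (\<lambda>_. \<mu>)"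

definition drift :: "(int ^ 'd) measure \<Rightarrow> real ^ 'd" where
  "drift p = (\<chi> i. measure p {axis i 1} - measure p {- axis i 1})"


section \<open>The walk\<close>

abbreviation trajectories :: "(nat \<Rightarrow> int ^ 'd) measure" where
  "trajectories \<equiv> PiM UNIV (\<lambda>_. count_space UNIV)"

text \<open>
  The law of the \<open>n\<close>-th position given the history \<open>X 0, \<dots>, X (n - 1)\<close>. A history for time \<open>n\<close>
  is a function on \<open>{0..<n}\<close>, so for \<open>n = 0\<close> it carries no information.
\<close>

primrec walk_step ::
  "(int ^ 'd \<Rightarrow> (int ^ 'd) measure) \<Rightarrow> nat \<Rightarrow> (nat \<Rightarrow> int ^ 'd) \<Rightarrow> (int ^ 'd) measure" where
  "walk_step \<omega> 0 X = return (count_space UNIV) 0"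
| "walk_step \<omega> (Suc n) X = distr (\<omega> (X n)) (count_space UNIV) (\<lambda>e. X n + e)"

text \<open>
  The quenched law is the measure on trajectories that the Ionescu-Tulcea theorem yields for these
  kernels; \<open>emeasure_quenched_law_cylinder\<close> below gives its finite-dimensional distributions, which
  are those of the Markov chain started at the origin.
\<close>

definition quenched_law ::
  "(int ^ 'd \<Rightarrow> (int ^ 'd) measure) \<Rightarrow> (nat \<Rightarrow> int ^ 'd) measure" where
  "quenched_law \<omega> =
     projective_family.lim UNIV (Ionescu_Tulcea.CI (walk_step \<omega>) (\<lambda>_. count_space UNIV))
       (\<lambda>_. count_space UNIV)"

definition annealed_law ::
  "(int ^ 'd) measure measure \<Rightarrow> (nat \<Rightarrow> int ^ 'd) measure" where
  "annealed_law \<mu> = environment_law \<mu> \<bind> quenched_law"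


section \<open>Well-definedness\<close>

lemma transition_laws_iff:
  "p \<in> space transition_laws \<longleftrightarrow> prob_space p \<and> sets p = Pow unit_vectors"
  by (auto simp: transition_laws_def space_prob_algebra)

lemma Ionescu_Tulcea_walk_step:
  fixes \<omega> :: "int ^ 'd \<Rightarrow> (int ^ 'd) measure"
  assumes "\<And>x. \<omega> x \<in> space transition_laws"
  shows "Ionescu_Tulcea (walk_step \<omega>) (\<lambda>_. count_space UNIV)"
proof -
  have prob: "prob_space (walk_step \<omega> n X)" for n X
  proof (cases n)
    case (Suc m)
    have "prob_space (\<omega> (X m))" "sets (\<omega> (X m)) = Pow unit_vectors"
      using assms[of "X m"] by (auto simp: transition_laws_iff)
    then show ?thesis
      unfolding Suc walk_step.simps
      by (intro prob_space.prob_space_distr)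
         (auto simp: measurable_def dest: sets_eq_imp_space_eq[of _ "count_space unit_vectors", simplified])
  qed (simp add: prob_space_return)
  have meas: "walk_step \<omega> n \<in> PiM {0..<n} (\<lambda>_. count_space UNIV) \<rightarrow>\<^sub>M
      subprob_algebra (count_space UNIV)" for n
  proof (cases n)
    case 0
    have "walk_step \<omega> 0 = (\<lambda>_. return (count_space UNIV) 0)"
      by (auto simp: fun_eq_iff)
    then show ?thesis
      unfolding 0 by (auto simp: space_subprob_algebra prob_space_imp_subprob_space prob_space_return)
  next
    case (Suc m)
    have kernel: "(\<lambda>x. distr (\<omega> x) (count_space UNIV) (\<lambda>e. x + e)) \<in>
        count_space UNIV \<rightarrow>\<^sub>M subprob_algebra (count_space UNIV)"
      using prob[of "Suc m" "\<lambda>_. x" for x]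
      by (auto simp: space_subprob_algebra intro!: prob_space_imp_subprob_space)
    have coord: "(\<lambda>X. X m) \<in> PiM {0..<Suc m} (\<lambda>_. count_space UNIV) \<rightarrow>\<^sub>M
        (count_space UNIV :: (int ^ 'd) measure)"
      by (rule measurable_component_singleton) simp
    have "walk_step \<omega> (Suc m) =
        (\<lambda>X. distr (\<omega> (X m)) (count_space UNIV) (\<lambda>e. X m + e))"
      by (auto simp: fun_eq_iff)
    then show ?thesis
      unfolding Suc using measurable_compose[OF coord kernel] by simp
  qed
  show ?thesis
    by (rule Ionescu_Tulcea.intro) (rule meas, rule prob)
qed

lemma sets_quenched_law:
  fixes \<omega> :: "int ^ 'd \<Rightarrow> (int ^ 'd) measure"
  assumes "\<And>x. \<omega> x \<in> space transition_laws"
  shows "sets (quenched_law \<omega>) = sets trajectories"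
proof -
  interpret Ionescu_Tulcea "walk_step \<omega>" "\<lambda>_. count_space UNIV"
    by (rule Ionescu_Tulcea_walk_step) fact
  show ?thesis
    by (simp add: quenched_law_def)
qed

lemma emeasure_quenched_law_cylinder:
  fixes \<omega> :: "int ^ 'd \<Rightarrow> (int ^ 'd) measure" and x :: "nat \<Rightarrow> int ^ 'd"
  assumes \<omega>: "\<And>x. \<omega> x \<in> space transition_laws"
  shows "emeasure (quenched_law \<omega>) {X. \<forall>k\<le>n. X k = x k} =
    (if x 0 = 0 then \<Prod>k<n. emeasure (\<omega> (x k)) {x (Suc k) - x k} else 0)"
proof -
  let ?M = "\<lambda>_::nat. count_space UNIV :: (int ^ 'd) measure"
  interpret Ionescu_Tulcea "walk_step \<omega>" ?M
    by (rule Ionescu_Tulcea_walk_step) fact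
  define r where "r m = restrict x {0..<m}" for m
  have r_space [simp]: "r m \<in> space (PiM {0..<m} ?M)" for m
    by (auto simp: r_def space_PiM)
  have r_sets: "{r m} \<in> sets (PiM {0..<m} ?M)" for m
  proof -
    have "{r m} = (\<Pi>\<^sub>E i\<in>{0..<m}. {x i})"
      by (auto simp: r_def PiE_iff extensional_def fun_eq_iff)
    then show ?thesis by (auto intro!: sets_PiM_I_finite)
  qed
  have step: "emeasure (C 0 (Suc m) (\<lambda>_. undefined)) {r (Suc m)} =
      emeasure (C 0 m (\<lambda>_. undefined)) {r m} * emeasure (walk_step \<omega> m (r m)) {x m}" for m
  proof -
    have eP: "emeasure (eP m y) {r (Suc m)} =
        emeasure (walk_step \<omega> m (r m)) {x m} * indicator {r m} y"
      if y: "y \<in> space (PiM {0..<m} ?M)" for y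
    proof -
      have y': "y i = undefined" if "i \<ge> m" for i
        using y that by (auto simp: space_PiM PiE_iff extensional_def)
      have "(\<lambda>z. y(m := z)) -` {r (Suc m)} \<inter> space (?M m) = (if y = r m then {x m} else {})"
      proof (cases "y = r m")
        case True
        have "y(m := z) = r (Suc m) \<longleftrightarrow> z = x m" for z
        proof
          assume "y(m := z) = r (Suc m)"
          then show "z = x m"
            by (metis (no_types) fun_upd_same r_def restrict_apply atLeastLessThan_iff lessI zero_le)
        next
          assume "z = x m"
          then show "y(m := z) = r (Suc m)"
            unfolding True by (auto simp: r_def fun_eq_iff less_Suc_eq)
        qed
        with True show ?thesis by auto
      next
        case False
        have "y(m := z) \<noteq> r (Suc m)" for z
        proof
          assume eq: "y(m := z) = r (Suc m)"
          have "y i = r m i" for i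
            using fun_cong[OF eq, of i] y'[of i]
            by (cases "i < m") (auto simp: r_def split: if_splits)
          with False show False by auto
        qed
        with False show ?thesis by auto
      qed
      then show ?thesis
        using emeasure_eP[OF y r_sets] by (auto simp: indicator_def)
    qed
    have [simp]: "(\<lambda>_. undefined) \<in> space (PiM {0..<0} ?M)"
      by (simp add: space_PiM)
    have ne: "space (C 0 m (\<lambda>_. undefined)) \<noteq> {}"
      using r_space[of m] space_C[of "\<lambda>_. undefined" 0 m] by auto
    have sets_C': "sets (C 0 m (\<lambda>_. undefined)) = sets (PiM {0..<m} ?M)"
      using sets_C[of "\<lambda>_. undefined" 0 m] by simp
    have "emeasure (C 0 (Suc m) (\<lambda>_. undefined)) {r (Suc m)} =
        (\<integral>\<^sup>+y. emeasure (eP m y) {r (Suc m)} \<partial>C 0 m (\<lambda>_. undefined))"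
      using emeasure_bind[OF ne, of "eP m" "PiM {0..<Suc m} ?M" "{r (Suc m)}"]
        r_sets[of "Suc m"] measurable_eP[of m]
      by (simp add: measurable_cong_sets[OF sets_C' refl])
    also have "\<dots> = (\<integral>\<^sup>+y. emeasure (walk_step \<omega> m (r m)) {x m} * indicator {r m} y
        \<partial>C 0 m (\<lambda>_. undefined))"
      using space_C[of "\<lambda>_. undefined" 0 m] by (intro nn_integral_cong eP) auto
    also have "\<dots> = emeasure (walk_step \<omega> m (r m)) {x m} * emeasure (C 0 m (\<lambda>_. undefined)) {r m}"
      using r_sets[of m] sets_C' by (intro nn_integral_cmult_indicator) auto
    finally show ?thesis by (simp add: mult.commute)
  qed
  have first: "emeasure (walk_step \<omega> 0 (r 0)) {x 0} = (if x 0 = 0 then 1 else 0)"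
    by (auto simp: indicator_def)
  have next_step: "emeasure (walk_step \<omega> (Suc m) (r (Suc m))) {x (Suc m)} =
      emeasure (\<omega> (x m)) {x (Suc m) - x m}" for m
  proof -
    have sp: "sets (\<omega> (x m)) = Pow unit_vectors"
      using \<omega>[of "x m"] by (auto simp: transition_laws_iff)
    then have sp': "space (\<omega> (x m)) = unit_vectors"
      using sets_eq_imp_space_eq[of "\<omega> (x m)" "count_space unit_vectors"] by simp
    have shift: "x m + e = y \<longleftrightarrow> e = y - x m" for e y
      by (auto simp: algebra_simps)
    have rm: "r (Suc m) m = x m" by (simp add: r_def)
    have "emeasure (walk_step \<omega> (Suc m) (r (Suc m))) {x (Suc m)} =
        emeasure (\<omega> (x m)) ((\<lambda>e. x m + e) -` {x (Suc m)} \<inter> space (\<omega> (x m)))"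
      unfolding walk_step.simps rm using sp sp'
      by (intro emeasure_distr) (auto simp: measurable_def)
    also have "(\<lambda>e. x m + e) -` {x (Suc m)} \<inter> space (\<omega> (x m)) =
        (if x (Suc m) - x m \<in> unit_vectors then {x (Suc m) - x m} else {})"
      unfolding sp' vimage_def shift singleton_iff by auto
    also have "emeasure (\<omega> (x m)) \<dots> = emeasure (\<omega> (x m)) {x (Suc m) - x m}"
      using sp by (auto simp: emeasure_notin_sets)
    finally show ?thesis .
  qed
  have C: "emeasure (C 0 (Suc m) (\<lambda>_. undefined)) {r (Suc m)} =
      (if x 0 = 0 then \<Prod>k<m. emeasure (\<omega> (x k)) {x (Suc k) - x k} else 0)" for m
  proof (induction m)
    case 0
    have "r 0 = (\<lambda>_. undefined)" by (simp add: r_def restrict_def)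
    then have "emeasure (C 0 0 (\<lambda>_. undefined)) {r 0} = 1"
      using r_sets[of 0] by (simp add: emeasure_return)
    with step[of 0] first show ?case by simp
  next
    case (Suc m)
    show ?case
      unfolding step[of "Suc m"] Suc next_step by (simp add: mult.commute)
  qed
  have cyl: "{X. \<forall>k\<le>n. X k = x k} = prod_emb UNIV ?M {0..<Suc n} {r (Suc n)}"
  proof -
    have "restrict X {0..<Suc n} = r (Suc n) \<longleftrightarrow> (\<forall>k\<le>n. X k = x k)" for X
      by (auto simp: r_def fun_eq_iff restrict_def less_Suc_eq_le)
    then show ?thesis by (auto simp: prod_emb_def space_PiM)
  qed
  have "emeasure (quenched_law \<omega>) {X. \<forall>k\<le>n. X k = x k} = emeasure (CI {0..<Suc n}) {r (Suc n)}"
    unfolding cyl quenched_law_def by (rule lim) (use r_sets in auto)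
  also have "\<dots> = emeasure (C 0 (Suc n) (\<lambda>_. undefined))
      (prod_emb {0..<Suc n} ?M {0..<Suc n} {r (Suc n)})"
    by (rule emeasure_CI) (use r_sets in auto)
  also have "prod_emb {0..<Suc n} ?M {0..<Suc n} {r (Suc n)} = {r (Suc n)}"
    using sets.sets_into_space[OF r_sets[of "Suc n"]] by (simp add: space_PiM prod_emb_id)
  finally show ?thesis
    by (simp only: C)
qed

lemma prob_space_quenched_law:
  fixes \<omega> :: "int ^ 'd \<Rightarrow> (int ^ 'd) measure"
  assumes "\<And>x. \<omega> x \<in> space transition_laws"
  shows "prob_space (quenched_law \<omega>)"
proof
  interpret Ionescu_Tulcea "walk_step \<omega>" "\<lambda>_. count_space UNIV"
    by (rule Ionescu_Tulcea_walk_step) fact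
  have "space (quenched_law \<omega>) = prod_emb UNIV (\<lambda>_. count_space UNIV) {} {\<lambda>_. undefined}"
    by (auto simp: quenched_law_def prod_emb_def space_PiM)
  then have "emeasure (quenched_law \<omega>) (space (quenched_law \<omega>)) = emeasure (CI {}) {\<lambda>_. undefined}"
    unfolding quenched_law_def by (simp add: lim PiM_empty)
  also have "\<dots> = 1"
    using prob_space.emeasure_space_1[OF PF.prob_space_P[of "{}"]] by (simp add: PF.space_P PiM_empty)
  finally show "emeasure (quenched_law \<omega>) (space (quenched_law \<omega>)) = 1" .
qed

lemma measurable_quenched_law:
  "quenched_law \<in> PiM UNIV (\<lambda>_. transition_laws) \<rightarrow>\<^sub>M
    prob_algebra (trajectories :: (nat \<Rightarrow> int ^ 'd) measure)"
proof -
  define cyl where "cyl n x = {X :: nat \<Rightarrow> int ^ 'd. \<forall>k\<le>n. X k = x k}" for n x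
  define G where "G = insert {} (range (\<lambda>(n, x). cyl n x))"
  have G_cases: "A = {} \<or> (\<exists>n x. A = cyl n x)" if "A \<in> G" for A
    using that by (auto simp: G_def)
  have laws: "\<omega> x \<in> space transition_laws"
    if "\<omega> \<in> space (PiM UNIV (\<lambda>_. transition_laws))" for \<omega> :: "int ^ 'd \<Rightarrow> (int ^ 'd) measure" and x
    using that by (auto simp: space_PiM)
  have comp: "(\<lambda>\<omega>. emeasure (\<omega> x) {e}) \<in>
      borel_measurable (PiM UNIV (\<lambda>_. transition_laws))" for x e :: "int ^ 'd"
  proof (cases "e \<in> unit_vectors")
    case True
    have "(\<lambda>p. emeasure p {e}) \<in> borel_measurable transition_laws"
      unfolding transition_laws_def prob_algebra_def using True
      by (intro measurable_restrict_space1 measurable_emeasure_subprob_algebra) auto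
    then show ?thesis
      by (rule measurable_compose[rotated]) (rule measurable_component_singleton, simp)
  next
    case False
    have "emeasure (\<omega> x) {e} = 0" if "\<omega> \<in> space (PiM UNIV (\<lambda>_. transition_laws))" for \<omega>
      using laws[OF that, of x] False by (auto simp: transition_laws_iff emeasure_notin_sets)
    then show ?thesis
      by (subst measurable_cong[where g = "\<lambda>_. 0"]) auto
  qed
  show ?thesis
  proof (rule measurable_prob_algebra_generated[where \<Omega> = UNIV and G = G])
    show "Int_stable G"
    proof (rule Int_stableI)
      fix A B assume AB: "A \<in> G" "B \<in> G"
      have "cyl n x \<inter> cyl m y \<in> G" for n m x y
      proof (cases "cyl n x \<inter> cyl m y = {}")
        case False
        then obtain z where "z \<in> cyl n x" "z \<in> cyl m y" by auto
        then have "cyl n x \<inter> cyl m y = cyl (max n m) z"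
          by (auto simp: cyl_def le_max_iff_disj)
        then show ?thesis by (auto simp: G_def)
      qed (simp add: G_def)
      moreover have "{} \<in> G" by (simp add: G_def)
      ultimately show "A \<inter> B \<in> G"
        using G_cases[OF AB(1)] G_cases[OF AB(2)] by (elim disjE exE) simp_all
    qed
    show "sets (trajectories :: (nat \<Rightarrow> int ^ 'd) measure) = sigma_sets UNIV G"
    proof
      have "cyl n x \<in> sets trajectories" for n x
      proof -
        have "cyl n x = prod_emb UNIV (\<lambda>_. count_space UNIV) {..n} (\<Pi>\<^sub>E k\<in>{..n}. {x k})"
          by (auto simp: cyl_def prod_emb_def PiE_iff)
        then show ?thesis
          using sets_PiM_I[of "{..n}" UNIV "\<lambda>k. {x k}" "\<lambda>_. count_space UNIV"] by simp
      qed
      then have "G \<subseteq> sets trajectories" by (auto simp: G_def)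
      then show "sigma_sets UNIV G \<subseteq> sets (trajectories :: (nat \<Rightarrow> int ^ 'd) measure)"
        using sets.sigma_sets_subset[of G "trajectories :: (nat \<Rightarrow> int ^ 'd) measure"]
        by (simp add: space_PiM)
      interpret S: sigma_algebra UNIV "sigma_sets UNIV G"
        by (rule sigma_algebra_sigma_sets) simp
      have single: "{X. X k \<in> A} \<in> sigma_sets UNIV G" for k and A :: "(int ^ 'd) set"
      proof -
        define L where "L = {xs :: (int ^ 'd) list. length xs = Suc k \<and> xs ! k \<in> A}"
        have "{X. X k \<in> A} = (\<Union>xs\<in>L. cyl k (\<lambda>i. xs ! i))"
        proof (intro set_eqI iffI)
          fix X :: "nat \<Rightarrow> int ^ 'd" assume "X \<in> {X. X k \<in> A}"
          then have "map X [0..<Suc k] \<in> L" "X \<in> cyl k (\<lambda>i. map X [0..<Suc k] ! i)"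
            by (auto simp: L_def cyl_def nth_append simp del: upt_Suc)
          then show "X \<in> (\<Union>xs\<in>L. cyl k (\<lambda>i. xs ! i))" by blast
        qed (auto simp: L_def cyl_def)
        also have "\<dots> \<in> sigma_sets UNIV G"
          by (intro S.countable_UN'') (auto simp: G_def)
        finally show ?thesis .
      qed
      show "sets (trajectories :: (nat \<Rightarrow> int ^ 'd) measure) \<subseteq> sigma_sets UNIV G"
        unfolding sets_PiM_single space_count_space PiE_UNIV_domain Pi_UNIV
        by (rule sigma_sets_mono) (auto simp: single)
    qed
    fix A assume "A \<in> G"
    then consider "A = {}" | n x where "A = cyl n x" using G_cases by blast
    then show "(\<lambda>\<omega>. emeasure (quenched_law \<omega>) A) \<in>
        borel_measurable (PiM UNIV (\<lambda>_. transition_laws))"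
    proof cases
      case 2
      have "(\<lambda>\<omega>. if x 0 = 0 then \<Prod>k<n. emeasure (\<omega> (x k)) {x (Suc k) - x k} else 0) \<in>
          borel_measurable (PiM UNIV (\<lambda>_. transition_laws))"
        by (cases "x 0 = 0") (auto intro!: borel_measurable_prod_ennreal comp)
      moreover have "emeasure (quenched_law \<omega>) (cyl n x) =
          (if x 0 = 0 then \<Prod>k<n. emeasure (\<omega> (x k)) {x (Suc k) - x k} else 0)"
        if "\<omega> \<in> space (PiM UNIV (\<lambda>_. transition_laws))" for \<omega>
        unfolding cyl_def using laws[OF that] by (rule emeasure_quenched_law_cylinder)
      ultimately show ?thesis
        unfolding 2 by (subst measurable_cong) assumption
    qed simp
  next
    fix \<omega> :: "int ^ 'd \<Rightarrow> (int ^ 'd) measure"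
    assume "\<omega> \<in> space (PiM UNIV (\<lambda>_. transition_laws))"
    from laws[OF this] show "prob_space (quenched_law \<omega>)"
        "sets (quenched_law \<omega>) = sets trajectories"
      by (rule prob_space_quenched_law, rule sets_quenched_law)
  qed simp
qed

end

(*
  Reveal the environment along the walk: in every level (hyperplane orthogonal to u) let the cells
  number 0, 1, 2, ... carry the transition laws of the sites of that level in the order of their
  discovery, and the randomness of the successive steps from that level. With i.i.d. cells the walk
  obtained in this way has the annealed law, and the columns of cells of different levels are
  independent.

  As long as the first i cells of a level have drift at least a, so has the site of the visit number
  i, since at most i sites of the level have been discovered by then; later drifts are nonnegative.
  Hence the steps from a level dominate a sequence of coin tosses with bias a up to a geometric
  time and without bias afterwards. Reading levels downwards from k, the numbers of down-crossings
  before level k is reached are dominated by a Markov chain which, from a large state z, has mean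
  increment about 1 - ab/(1-b) and variance about 2z. If ab/(1-b) > 1, the test function z gives a
  positive probability of never going below the starting level; if ab/(1-b) > 2, the test function
  z^2 bounds the mean time needed to climb k levels by a multiple of k.

  Call a level regenerative if the walk never goes below it after reaching it. In terms of the
  columns this is a stationary event, as is the time between consecutive regenerative levels, so the
  ergodic theorem for the shift of the columns yields infinitely many regenerations and the speed.
*)

theory Submission
  imports Defs
begin

text \<open>With laws kept at sites, the environment seen from a new level would depend on where the
  walk enters that level; numbering by discovery makes it a function of the columns alone. Laws and
  steps need separate indices: a site keeps its law, but every visit needs fresh randomness.

  Let delta be \<open>a\<close> times the mean number of cookies; it approximates ab/(1-b). If the
  level above is left downwards \<open>z\<close> times, a level must be left upwards
  \<open>z + 1\<close> times: this is the 1 in the mean increment 1 - delta. So z^2 changes in mean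
  by about 2z(1 - delta) + 2z = (4 - 2 delta)z, and the sign changes at delta = 2.

  Two obstacles shape the rest. Only crossings of levels at least 0 are compared with the chain, so
  the time spent below the origin is never estimated; only the time between regenerations enters.
  And moments are taken with counts capped at \<open>n\<close> tosses, with bounds uniform in
  \<open>n\<close>. That every level is reached has its own proof, from nonnegative drift alone. For
  the speed, gaps are averaged over all levels, so that stationarity of the columns takes the place
  of a renewal argument.\<close>

section \<open>Resampling one coordinate of a product measure\<close>

lemma measurable_PiM_update:
  assumes "i \<in> I"
  shows "(\<lambda>(X, v). X(i := v)) \<in> PiM I M \<Otimes>\<^sub>M M i \<rightarrow>\<^sub>M PiM I M"
proof -
  have "(\<lambda>p. (fst p)(i := snd p)) \<in> PiM I M \<Otimes>\<^sub>M M i \<rightarrow>\<^sub>M PiM I M"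
    using assms by (intro measurable_fun_upd[where J = I]) (auto simp: insert_absorb)
  then show ?thesis by (simp add: case_prod_beta')
qed

text \<open>Redrawing one coordinate from its own law changes nothing. This stands in for
  conditioning later on: cells, seeds and site laws are integrated out one at a time with
  it.\<close>

lemma nn_integral_PiM_resample:
  assumes M: "\<And>j. j \<in> I \<Longrightarrow> prob_space (M j)" and i: "i \<in> I"
    and H [measurable]: "H \<in> borel_measurable (PiM I M)"
  shows "(\<integral>\<^sup>+X. H X \<partial>PiM I M) = (\<integral>\<^sup>+X. (\<integral>\<^sup>+v. H (X(i := v)) \<partial>M i) \<partial>PiM I M)"
proof -
  interpret Mi: prob_space "M i" using M i by blast
  interpret P: prob_space "PiM I M" by (rule prob_space_PiM) (rule M)
  interpret pair_sigma_finite "PiM I M" "M i" ..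
  note [measurable] = measurable_PiM_update[OF i, of M]
  have upd [measurable]: "(\<lambda>(v, X). X(i := v)) \<in> M i \<Otimes>\<^sub>M PiM I M \<rightarrow>\<^sub>M PiM I M"
    using measurable_compose[OF measurable_pair_swap' measurable_PiM_update[OF i, of M]]
    by (simp add: case_prod_beta')
  have "(\<integral>\<^sup>+X. H X \<partial>PiM I M) =
      (\<integral>\<^sup>+X. H X \<partial>distr (M i \<Otimes>\<^sub>M PiM I M) (PiM I M) (\<lambda>(v, X). X(i := v)))"
    using distr_pair_PiM_eq_PiM[of I M i] M i by (simp add: insert_absorb)
  also have "\<dots> = (\<integral>\<^sup>+p. H ((snd p)(i := fst p)) \<partial>(M i \<Otimes>\<^sub>M PiM I M))"
    by (subst nn_integral_distr) (auto simp: case_prod_beta')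
  also have "\<dots> = (\<integral>\<^sup>+p. H ((fst p)(i := snd p)) \<partial>(PiM I M \<Otimes>\<^sub>M M i))"
    by (subst distr_pair_swap, subst nn_integral_distr)
      (use measurable_compose[OF upd H] in \<open>auto simp: case_prod_beta'\<close>)
  also have "\<dots> = (\<integral>\<^sup>+X. (\<integral>\<^sup>+v. H (X(i := v)) \<partial>M i) \<partial>PiM I M)"
    using measurable_compose[OF measurable_PiM_update[OF i, of M] H]
    by (subst Mi.nn_integral_fst[symmetric]) (auto simp: case_prod_beta')
  finally show ?thesis .
qed

section \<open>The ergodic theorem for the shift\<close>

definition lshift :: "nat \<Rightarrow> (nat \<Rightarrow> 'a) \<Rightarrow> nat \<Rightarrow> 'a" where
  "lshift k c = (\<lambda>i. c (i + k))"

lemma lshift_0 [simp]: "lshift 0 c = c"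
  by (simp add: lshift_def)

lemma lshift_lshift [simp]: "lshift k (lshift l c) = lshift (k + l) c"
  by (simp add: lshift_def add.assoc)

lemma lshift_apply: "lshift k c i = c (i + k)"
  by (simp add: lshift_def)

lemma lshift_case_nat [simp]: "lshift (Suc 0) (case_nat x c) = c"
  by (simp add: lshift_def)

lemma lshift_comb_seq [simp]: "lshift n (comb_seq n x y) = y"
  by (auto simp: lshift_def comb_seq_add)

lemma measurable_lshift [measurable]:
  "lshift k \<in> PiM UNIV (\<lambda>_. M) \<rightarrow>\<^sub>M PiM UNIV (\<lambda>_. M)"
  unfolding lshift_def by (rule measurable_PiM_single') (auto simp: space_PiM)

context sequence_space
begin

lemma distr_lshift: "distr S S (lshift k) = S"
  using distr_PiM_reindex[of UNIV "\<lambda>_. M" "\<lambda>i. i + k" UNIV] prob_space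
  by (simp add: lshift_def[abs_def] restrict_UNIV)

lemma AE_lshift: "AE c in S. P c \<Longrightarrow> AE c in S. P (lshift k c)"
  by (rule AE_distrD[of "lshift k" S S P]) (simp_all only: distr_lshift measurable_lshift)

lemma integrable_lshift:
  fixes f :: "_ \<Rightarrow> real"
  assumes "integrable S f"
  shows "integrable S (\<lambda>c. f (lshift k c))"
    and "(\<integral>c. f (lshift k c) \<partial>S) = (\<integral>c. f c \<partial>S)"
proof -
  show "integrable S (\<lambda>c. f (lshift k c))"
    by (rule integrable_distr[of "lshift k" S S f]) (simp_all only: assms distr_lshift measurable_lshift)
  have "f \<in> borel_measurable S" using assms by auto
  then have "(\<integral>c. f c \<partial>distr S S (lshift k)) = (\<integral>c. f (lshift k c) \<partial>S)"
    by (intro integral_distr) auto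
  then show "(\<integral>c. f (lshift k c) \<partial>S) = (\<integral>c. f c \<partial>S)"
    by (simp add: distr_lshift)
qed

text \<open>
  Conditioning on an invariant event does not change the probabilities of cylinders, hence not the
  measure.
\<close>

lemma lshift_invariant_0_1:
  assumes A [measurable]: "A \<in> sets S" and inv: "\<And>c. c \<in> space S \<Longrightarrow> lshift 1 c \<in> A \<longleftrightarrow> c \<in> A"
  shows "measure S A = 0 \<or> measure S A = 1"
proof (rule ccontr)
  assume contra: "\<not> ?thesis"
  then have pos: "emeasure S A \<noteq> 0" by (simp add: P.emeasure_eq_measure)
  have spc: "lshift k c \<in> space S" if "c \<in> space S" for k c
    using that by (auto simp: space_PiM lshift_apply)
  have inv_n: "lshift n c \<in> A \<longleftrightarrow> c \<in> A" if "c \<in> space S" for n c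
  proof (induction n)
    case (Suc n)
    show ?case using inv[OF spc[OF that, of n]] Suc by simp
  qed simp
  have "uniform_measure S A = S"
  proof (rule PiM_eq)
    fix J :: "nat set" and F
    assume J: "finite J" and F: "\<And>j. j \<in> J \<Longrightarrow> F j \<in> sets M"
    let ?X = "prod_emb UNIV (\<lambda>_. M) J (\<Pi>\<^sub>E j\<in>J. F j)"
    obtain n where n: "J \<subseteq> {..<n}" using J finite_nat_iff_bounded by blast
    have X [measurable]: "?X \<in> sets S" using J F by (intro sets_PiM_I) auto
    let ?c = "\<lambda>(x, y). comb_seq n x y"
    have "emeasure S (A \<inter> ?X) = emeasure (distr (S \<Otimes>\<^sub>M S) S ?c) (A \<inter> ?X)"
      by (simp add: PiM_comb_seq)
    also have "\<dots> = emeasure (S \<Otimes>\<^sub>M S) (?c -` (A \<inter> ?X) \<inter> space (S \<Otimes>\<^sub>M S))"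
      by (subst emeasure_distr) (auto intro: measurable_comb_seq)
    \<comment> \<open>The first \<open>n\<close> coordinates come from \<open>x\<close>, the rest
      from \<open>y\<close>. The cylinder \<open>?X\<close> reads only \<open>x\<close>, and by
      invariance \<open>A\<close> reads only \<open>y\<close>, so the two are independent.\<close>
    also have "?c -` (A \<inter> ?X) \<inter> space (S \<Otimes>\<^sub>M S) = ?X \<times> A"
    proof -
      have "comb_seq n x y \<in> A \<longleftrightarrow> y \<in> A" if "x \<in> space S" "y \<in> space S" for x y
      proof -
        have "comb_seq n x y \<in> space S"
          using that by (auto simp: space_PiM comb_seq_def PiE_iff)
        from inv_n[OF this, of n] show ?thesis by simp
      qed
      moreover have "comb_seq n x y \<in> ?X \<longleftrightarrow> x \<in> ?X" if "x \<in> space S" "y \<in> space S" for x y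
      proof -
        have "comb_seq n x y \<in> space S"
          using that by (auto simp: space_PiM comb_seq_def PiE_iff)
        moreover have "comb_seq n x y j = x j" if "j \<in> J" for j
          using that n by (auto simp: comb_seq_less)
        ultimately show ?thesis using that by (auto simp: prod_emb_def space_PiM PiE_iff)
      qed
      moreover have "x \<in> space S" if "x \<in> A \<or> x \<in> ?X" for x
        using A X that by (blast dest: sets.sets_into_space)
      ultimately show ?thesis by (auto simp: space_pair_measure)
    qed
    also have "emeasure (S \<Otimes>\<^sub>M S) (?X \<times> A) = emeasure S ?X * emeasure S A"
      by (rule P.emeasure_pair_measure_Times) auto
    also have "emeasure S ?X = (\<Prod>j\<in>J. emeasure M (F j))"
      using J F by (intro emeasure_PiM_emb) auto
    finally show "emeasure (uniform_measure S A) ?X = (\<Prod>j\<in>J. emeasure M (F j))"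
      using pos by (simp add: ennreal_mult_divide_eq)
  qed simp
  then have "emeasure S (space S - A) = emeasure (uniform_measure S A) (space S - A)" by simp
  also have "\<dots> = 0" by (subst emeasure_uniform_measure) auto
  finally have "measure S (space S - A) = 0" by (simp add: P.emeasure_eq_measure)
  with contra show False by (simp add: P.prob_compl)
qed

text \<open>Garsia's argument. \<open>Mx n\<close> is the running maximum of the partial sums, the
  empty one included. Its limit is infinite on an invariant event. If that event had probability 1,
  then \<open>Mx (Suc n)\<close> minus the shifted \<open>Mx n\<close> would tend to
  \<open>f\<close>, while its integrals are nonnegative by monotonicity and stationarity, against
  the negative mean of \<open>f\<close>.\<close>

lemma ergodic_maximal:
  fixes f :: "_ \<Rightarrow> real"
  assumes f: "integrable S f" and neg: "(\<integral>c. f c \<partial>S) < 0"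
  shows "AE c in S. \<exists>B. \<forall>n. (\<Sum>k<n. f (lshift k c)) \<le> B"
proof -
  have fm [measurable]: "f \<in> borel_measurable S" using f by auto
  define Mx where "Mx = rec_nat (\<lambda>_. 0) (\<lambda>n m c. max 0 (f c + m (lshift 1 c)))"
  have Mx_0: "Mx 0 c = 0" and Mx_Suc: "Mx (Suc n) c = max 0 (f c + Mx n (lshift 1 c))" for n c
    by (simp_all add: Mx_def)
  have nonneg: "0 \<le> Mx n c" for n c
    by (cases n) (simp_all add: Mx_0 Mx_Suc)
  have mono: "Mx n c \<le> Mx (Suc n) c" for n c
  proof (induction n arbitrary: c)
    case (Suc n)
    show ?case using Suc[of "lshift 1 c"] unfolding Mx_Suc[of "Suc n" c] Mx_Suc[of n c] by auto
  qed (simp add: Mx_0 Mx_Suc)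
  have sums: "(\<Sum>k<n. f (lshift k c)) \<le> Mx n c" for n c
  proof (induction n arbitrary: c)
    case (Suc n)
    have "(\<Sum>k<Suc n. f (lshift k c)) = f c + (\<Sum>k<n. f (lshift k (lshift 1 c)))"
      by (subst sum.lessThan_Suc_shift) simp
    also have "\<dots> \<le> Mx (Suc n) c" using Suc[of "lshift 1 c"] by (simp add: Mx_Suc)
    finally show ?case .
  qed (simp add: Mx_0)
  have int: "integrable S (Mx n)" for n
  proof (induction n)
    case (Suc n)
    have "integrable S (\<lambda>c. max 0 (f c + Mx n (lshift 1 c)))"
      using integrable_lshift(1)[OF Suc, of 1] f by simp
    then show ?case by (simp add: Mx_Suc[abs_def])
  qed (simp add: Mx_0[abs_def])
  have meas [measurable]: "Mx n \<in> borel_measurable S" for n using int by blast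
  define A where "A = {c \<in> space S. \<forall>B::nat. \<exists>n. real B < Mx n c}"
  have A [measurable]: "A \<in> sets S" unfolding A_def by measurable
  have "lshift 1 c \<in> A \<longleftrightarrow> c \<in> A" if c: "c \<in> space S" for c
  proof -
    have sp: "lshift 1 c \<in> space S" using c by (auto simp: space_PiM lshift_apply)
    have "(\<forall>B::nat. \<exists>n. real B < Mx n (lshift 1 c)) \<longleftrightarrow> (\<forall>B::nat. \<exists>n. real B < Mx n c)"
    proof safe
      fix B :: nat
      assume *: "\<forall>B::nat. \<exists>n. real B < Mx n (lshift 1 c)"
      obtain B' :: nat where "real B + \<bar>f c\<bar> \<le> real B'" using real_arch_simple by blast
      moreover obtain n where "real B' < Mx n (lshift 1 c)" using * by blast
      ultimately have "real B < Mx (Suc n) c" by (auto simp: Mx_Suc)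
      then show "\<exists>n. real B < Mx n c" by blast
    next
      fix B :: nat
      assume *: "\<forall>B::nat. \<exists>n. real B < Mx n c"
      obtain B' :: nat where B': "real B + \<bar>f c\<bar> \<le> real B'" using real_arch_simple by blast
      moreover obtain n where n: "real B' < Mx n c" using * by blast
      moreover from n obtain l where "n = Suc l" by (cases n) (auto simp: Mx_0)
      ultimately have "real B < Mx l (lshift 1 c)" by (auto simp: Mx_Suc)
      then show "\<exists>n. real B < Mx n (lshift 1 c)" by blast
    qed
    then show ?thesis using c sp by (simp add: A_def)
  qed
  then have "measure S A = 0 \<or> measure S A = 1" by (intro lshift_invariant_0_1 A)
  moreover have "measure S A \<noteq> 1"
  proof
    assume "measure S A = 1"
    then have AE: "AE c in S. c \<in> A" by (simp add: P.AE_in_set_eq_1)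
    define D where "D n c = Mx (Suc n) c - Mx n (lshift 1 c)" for n c
    \<comment> \<open>As \<open>Mx n\<close> is nonnegative, this form also gives the domination of
      \<open>D n\<close> by the absolute value of \<open>f\<close>.\<close>
    have D_eq: "D n c = max (- Mx n (lshift 1 c)) (f c)" for n c
      by (auto simp: D_def Mx_Suc max_def)
    have [measurable]: "D n \<in> borel_measurable S" for n unfolding D_def by measurable
    have lim: "(\<lambda>n. \<integral>c. D n c \<partial>S) \<longlonglongrightarrow> (\<integral>c. f c \<partial>S)"
    proof (rule integral_dominated_convergence[where w = "\<lambda>c. \<bar>f c\<bar>"])
      show "AE c in S. (\<lambda>n. D n c) \<longlonglongrightarrow> f c"
        using AE AE_lshift[OF AE, of 1]
      proof eventually_elim
        case (elim c)
        obtain B :: nat where B: "- f c \<le> real B" using real_arch_simple by blast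
        obtain N where N: "real B < Mx N (lshift 1 c)" using elim(2) by (auto simp: A_def)
        have "D n c = f c" if "n \<ge> N" for n
        proof -
          have "Mx N (lshift 1 c) \<le> Mx n (lshift 1 c)"
            using that by (rule lift_Suc_mono_le[of "\<lambda>n. Mx n (lshift 1 c)", OF mono])
          with B N show ?thesis by (simp add: D_eq)
        qed
        then show ?case by (intro tendsto_eventually) (auto simp: eventually_sequentially)
      qed
      show "AE c in S. norm (D n c) \<le> \<bar>f c\<bar>" for n
        using nonneg by (auto simp: D_eq max_def)
    qed (use f in auto)
    have "0 \<le> (\<integral>c. D n c \<partial>S)" for n
    proof -
      have "(\<integral>c. D n c \<partial>S) = (\<integral>c. Mx (Suc n) c \<partial>S) - (\<integral>c. Mx n c \<partial>S)"
        unfolding D_def using integrable_lshift[OF int[of n], of 1] int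
        by (subst Bochner_Integration.integral_diff) auto
      moreover have "(\<integral>c. Mx n c \<partial>S) \<le> (\<integral>c. Mx (Suc n) c \<partial>S)"
        by (intro integral_mono int mono)
      ultimately show ?thesis by simp
    qed
    then have "0 \<le> (\<integral>c. f c \<partial>S)" using lim by (intro LIMSEQ_le_const) auto
    with neg show False by simp
  qed
  ultimately have "AE c in S. c \<notin> A"
    by (intro AE_not_in) (simp add: null_sets_def P.emeasure_eq_measure)
  moreover have "AE c in S. c \<in> space S" by simp
  ultimately show ?thesis
  proof eventually_elim
    case (elim c)
    then obtain B :: nat where "\<forall>n. Mx n c \<le> real B" by (auto simp: A_def not_less)
    then show ?case using sums order_trans by blast
  qed
qed

text \<open>For every \<open>d > 0\<close> the functions \<open>f - (e + d)\<close> and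
  \<open>(e - d) - f\<close> have mean \<open>-d\<close>, so their partial sums are bounded above.
  After division by \<open>n\<close> the averages are within \<open>d\<close> of \<open>e\<close> in
  the limit.\<close>

theorem ergodic_theorem:
  fixes f :: "_ \<Rightarrow> real"
  assumes f: "integrable S f"
  shows "AE c in S. (\<lambda>n. (\<Sum>k<n. f (lshift k c)) / real n) \<longlonglongrightarrow> (\<integral>c. f c \<partial>S)"
proof -
  define e where "e = (\<integral>c. f c \<partial>S)"
  define d where "d q = 1 / real (Suc q)" for q
  have d: "0 < d q" for q by (simp add: d_def)
  have int1: "integrable S (\<lambda>c. f c - (e + d q))" and int2: "integrable S (\<lambda>c. (e - d q) - f c)" for q
    using f by (intro Bochner_Integration.integrable_diff; simp)+
  have up: "AE c in S. \<forall>q. \<exists>B. \<forall>n. (\<Sum>k<n. f (lshift k c) - (e + d q)) \<le> B"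
    unfolding AE_all_countable
    using f d P.prob_space by (intro allI ergodic_maximal int1) (simp add: e_def)
  have low: "AE c in S. \<forall>q. \<exists>B. \<forall>n. (\<Sum>k<n. (e - d q) - f (lshift k c)) \<le> B"
    unfolding AE_all_countable
    using f d P.prob_space by (intro allI ergodic_maximal int2) (simp add: e_def)
  from up low show ?thesis
  proof eventually_elim
    case (elim c)
    let ?s = "\<lambda>n. \<Sum>k<n. f (lshift k c)"
    show ?case unfolding e_def[symmetric]
    proof (rule LIMSEQ_I)
      fix r :: real assume "0 < r"
      then obtain q where q: "d q < r / 2" unfolding d_def
        using reals_Archimedean[of "r / 2"] by (auto simp: inverse_eq_divide)
      obtain B1 where B1: "(\<Sum>k<n. f (lshift k c) - (e + d q)) \<le> B1" for n using elim(1) by blast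
      obtain B2 where B2: "(\<Sum>k<n. (e - d q) - f (lshift k c)) \<le> B2" for n using elim(2) by blast
      define B where "B = max B1 B2"
      have B: "?s n - real n * (e + d q) \<le> B" "real n * (e - d q) - ?s n \<le> B" for n
        using B1[of n] B2[of n] by (auto simp: sum_subtractf B_def)
      obtain N :: nat where N: "2 * B / r < real N" using reals_Archimedean2 by blast
      show "\<exists>no. \<forall>n\<ge>no. norm (?s n / real n - e) < r"
      proof (intro exI allI impI)
        fix n assume n: "Suc N \<le> n"
        then have n0: "0 < real n" by simp
        have "2 * B / r < real n" using N n by simp
        then have Bn: "B < real n * (r / 2)" using \<open>0 < r\<close> by (simp add: field_simps)
        have "real n * d q < real n * (r / 2)" using q n0 by simp
        then have "\<bar>?s n - real n * e\<bar> < real n * r"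
          using B[of n] Bn by (auto simp: algebra_simps abs_less_iff)
        moreover have "?s n / real n - e = (?s n - real n * e) / real n"
          using n0 by (simp add: field_simps)
        ultimately show "norm (?s n / real n - e) < r"
          using n0 by (simp add: field_simps)
      qed
    qed
  qed
qed

text \<open>The first coordinate is independent of the tail. The first order of integration
  conditions on the first cell of a column; the second one freezes the later columns while the first
  column is integrated.\<close>

lemma integral_iter:
  fixes h :: "_ \<Rightarrow> real"
  assumes h [measurable]: "h \<in> borel_measurable S" and bnd: "\<And>c. \<bar>h c\<bar> \<le> B"
  shows "(\<integral>c. h c \<partial>S) = (\<integral>x. (\<integral>c. h (case_nat x c) \<partial>S) \<partial>M)"
    and "(\<integral>c. h c \<partial>S) = (\<integral>c. (\<integral>x. h (case_nat x c) \<partial>M) \<partial>S)"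
proof -
  interpret MS: pair_prob_space M S ..
  have cm [measurable]: "(\<lambda>p. case_nat (fst p) (snd p)) \<in> M \<Otimes>\<^sub>M S \<rightarrow>\<^sub>M S"
    by measurable
  have int: "integrable (M \<Otimes>\<^sub>M S) (\<lambda>p. h (case_nat (fst p) (snd p)))"
    by (rule MS.integrable_const_bound[of _ B]) (use bnd in auto)
  have "(\<integral>c. h c \<partial>S) = (\<integral>c. h c \<partial>distr (M \<Otimes>\<^sub>M S) S (\<lambda>(s, w). case_nat s w))"
    by (simp add: PiM_iter)
  also have "\<dots> = (\<integral>p. h (case_nat (fst p) (snd p)) \<partial>(M \<Otimes>\<^sub>M S))"
    by (subst integral_distr) (auto simp: case_prod_beta')
  finally have *: "(\<integral>c. h c \<partial>S) = (\<integral>p. h (case_nat (fst p) (snd p)) \<partial>(M \<Otimes>\<^sub>M S))" .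
  show "(\<integral>c. h c \<partial>S) = (\<integral>x. (\<integral>c. h (case_nat x c) \<partial>S) \<partial>M)"
    unfolding * using MS.integral_fst'[OF int] by simp
  show "(\<integral>c. h c \<partial>S) = (\<integral>c. (\<integral>x. h (case_nat x c) \<partial>M) \<partial>S)"
    unfolding * using MS.integral_snd[of "\<lambda>x c. h (case_nat x c)"] int
    by (simp add: case_prod_beta')
qed

end

section \<open>Failures before a given number of successes\<close>

text \<open>Tosses \<open>A\<close> are read until the \<open>m\<close>-th success, but at most
  \<open>n\<close> of them. The cap makes the count total and bounded, so that all its moments
  exist; the estimates below do not depend on \<open>n\<close>.\<close>

primrec failures :: "nat \<Rightarrow> (nat \<Rightarrow> bool) \<Rightarrow> nat \<Rightarrow> nat" where
  "failures 0 A m = 0"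
| "failures (Suc n) A m = (if m = 0 then 0
     else if A 0 then failures n (\<lambda>i. A (Suc i)) (m - 1)
     else Suc (failures n (\<lambda>i. A (Suc i)) m))"

lemma failures_le: "failures n A m \<le> n"
  by (induction n arbitrary: A m) (auto intro: le_SucI)

lemma failures_0 [simp]: "failures n A 0 = 0"
  by (cases n) auto

lemma failures_mono: "m \<le> m' \<Longrightarrow> failures n A m \<le> failures n A m'"
  by (induction n arbitrary: A m m') (auto simp: le_diff_conv)

lemma failures_eq_0: "(\<And>i. i < m \<Longrightarrow> A i) \<Longrightarrow> failures n A m = 0"
  by (induction n arbitrary: A m) auto

text \<open>A path yields a set of failing positions rather than a recursion. Dropping the first
  toss shifts the positions by one, and lowers the success counts by one if that toss
  succeeded.\<close>

lemma card_le_failures: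
  "card {i. i < n \<and> \<not> A i \<and> card {l. l < i \<and> A l} < m} \<le> failures n A m"
proof (induction n arbitrary: A m)
  case (Suc n)
  let ?T = "\<lambda>A i. card {l. l < i \<and> A l}"
  let ?E = "\<lambda>n A m. {i. i < n \<and> \<not> A i \<and> ?T A i < m}"
  let ?A = "\<lambda>i. A (Suc i)"
  have T: "?T A (Suc i) = (if A 0 then 1 else 0) + ?T ?A i" for i
  proof -
    have "{l. l < Suc i \<and> A l} = (if A 0 then {0} else {}) \<union> Suc ` {l. l < i \<and> ?A l}"
      by (auto simp: image_iff less_Suc_eq_0_disj)
    then have "?T A (Suc i) = card (if A 0 then {0::nat} else {}) + card (Suc ` {l. l < i \<and> ?A l})"
      by (simp only:) (rule card_Un_disjoint, auto)
    then show ?thesis by (simp add: card_image)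
  qed
  show ?case
  proof (cases "m = 0")
    case False
    show ?thesis
    proof (cases "A 0")
      case True
      have "?E (Suc n) A m \<subseteq> Suc ` ?E n ?A (m - 1)"
      proof
        fix i assume i: "i \<in> ?E (Suc n) A m"
        then obtain i' where i': "i = Suc i'" using True by (cases i) auto
        then show "i \<in> Suc ` ?E n ?A (m - 1)" using i T[of i'] True by auto
      qed
      then have "card (?E (Suc n) A m) \<le> card (Suc ` ?E n ?A (m - 1))" by (intro card_mono) auto
      also have "\<dots> = card (?E n ?A (m - 1))" by (rule card_image) auto
      also have "\<dots> \<le> failures n ?A (m - 1)" by (rule Suc)
      finally show ?thesis using True False by simp
    next
      case f: False
      have "?E (Suc n) A m \<subseteq> insert 0 (Suc ` ?E n ?A m)"
      proof
        fix i assume i: "i \<in> ?E (Suc n) A m"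
        show "i \<in> insert 0 (Suc ` ?E n ?A m)"
        proof (cases i)
          case (Suc i')
          then show ?thesis using i T[of i'] f by auto
        qed simp
      qed
      then have "card (?E (Suc n) A m) \<le> card (insert 0 (Suc ` ?E n ?A m))"
        by (intro card_mono) auto
      also have "\<dots> = Suc (card (?E n ?A m))"
        by (subst card_insert_disjoint) (auto simp: card_image)
      also have "\<dots> \<le> Suc (failures n ?A m)" using Suc by simp
      finally show ?thesis using f False by simp
    qed
  qed simp
qed simp

lemma measurable_failures [measurable (raw)]:
  assumes "\<And>i. Measurable.pred N (\<lambda>x. A x i)"
  shows "(\<lambda>x. failures n (A x) m) \<in> N \<rightarrow>\<^sub>M count_space UNIV"
  using assms
proof (induction n arbitrary: A m)
  case (Suc n)
  note [measurable] = Suc.prems Suc.IH[of "\<lambda>x i. A x (Suc i)", OF Suc.prems]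
  show ?case by simp
qed simp

section \<open>Columns with a geometric number of cookies\<close>

text \<open>
  Truncating the geometric number of cookies at \<open>K\<close> treats the case \<open>b = 1\<close> together with
  \<open>b < 1\<close>.
\<close>

locale cookie_columns = sequence_space M for M :: "'c measure" +
  fixes good :: "'c \<Rightarrow> bool" and u :: "'c \<Rightarrow> real" and a b :: real
  assumes good_measurable [measurable]: "Measurable.pred M good"
    and u_measurable [measurable]: "u \<in> borel_measurable M"
    and a: "0 < a" "a \<le> 1" and b: "0 < b" "b \<le> 1"
    and prob_good: "measure M {x \<in> space M. good x} = b"
    and prob_good_up: "measure M {x \<in> space M. good x \<and> u x \<le> (1 + a) / 2} = b * ((1 + a) / 2)"
    and prob_up: "measure M {x \<in> space M. u x \<le> 1 / 2} = 1 / 2"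
    and prob_bad_up: "measure M {x \<in> space M. \<not> good x \<and> u x \<le> 1 / 2} = (1 - b) / 2"
begin

abbreviation "T \<equiv> PiM (UNIV :: nat set) (\<lambda>_. S)"

sublocale columns: sequence_space S
  by unfold_locales

text \<open>The bias at position \<open>i\<close> requires all of the first \<open>i + 1\<close>
  cells to be good, since the site met at visit \<open>i\<close> may carry any one of them.\<close>

definition arrows :: "nat \<Rightarrow> (nat \<Rightarrow> 'c) \<Rightarrow> nat \<Rightarrow> bool" where
  "arrows K c i \<longleftrightarrow> u (c i) \<le> (if i < K \<and> (\<forall>l\<le>i. good (c l)) then (1 + a) / 2 else 1 / 2)"

text \<open>Expected number of biased tosses in a column: position \<open>i < K\<close> is biased
  with probability \<open>b ^ (i + 1)\<close>. For \<open>b < 1\<close> the limit in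
  \<open>K\<close> is \<open>b / (1 - b)\<close>.\<close>

definition \<beta> :: "nat \<Rightarrow> real" where
  "\<beta> K = (\<Sum>i=1..K. b ^ i)"

lemma \<beta>_0 [simp]: "\<beta> 0 = 0"
  by (simp add: \<beta>_def)

lemma \<beta>_Suc: "\<beta> (Suc K) = b * (1 + \<beta> K)"
proof -
  have "\<beta> (Suc K) = b ^ 1 + (\<Sum>i=Suc 1..Suc K. b ^ i)"
    unfolding \<beta>_def by (subst sum.atLeast_Suc_atMost) auto
  also have "(\<Sum>i=Suc 1..Suc K. b ^ i) = b * \<beta> K"
    unfolding \<beta>_def sum.shift_bounds_cl_Suc_ivl by (simp add: sum_distrib_left)
  finally show ?thesis by (simp add: algebra_simps)
qed

lemma \<beta>_bounds: "0 \<le> \<beta> K" "\<beta> K \<le> K"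
proof -
  show "0 \<le> \<beta> K" unfolding \<beta>_def using b by (intro sum_nonneg) auto
  have "\<beta> K \<le> (\<Sum>i=1..K. 1)" unfolding \<beta>_def using b by (intro sum_mono power_le_one) auto
  then show "\<beta> K \<le> K" by simp
qed

lemma arrows_measurable [measurable]: "Measurable.pred S (\<lambda>c. arrows K c i)"
  unfolding arrows_def by measurable

text \<open>Markov structure of a column: behind a good first cell there remains a column with at
  most \<open>K\<close> cookies, behind a bad one a column of fair tosses.\<close>

lemma arrows_Suc_case_nat:
  "arrows (Suc K) (case_nat x c) 0 \<longleftrightarrow> u x \<le> (if good x then (1 + a) / 2 else 1 / 2)"
  "(\<lambda>i. arrows (Suc K) (case_nat x c) (Suc i)) = arrows (if good x then K else 0) c"
proof -
  have all: "(\<forall>l\<le>Suc i. good (case_nat x c l)) \<longleftrightarrow> good x \<and> (\<forall>l\<le>i. good (c l))" for i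
  proof safe
    assume *: "\<forall>l\<le>Suc i. good (case_nat x c l)"
    show "good x" using *[rule_format, of 0] by simp
    show "good (c l)" if "l \<le> i" for l using *[rule_format, of "Suc l"] that by simp
  next
    fix l assume "good x" "\<forall>l\<le>i. good (c l)" "l \<le> Suc i"
    then show "good (case_nat x c l)" by (cases l) auto
  qed
  show "(\<lambda>i. arrows (Suc K) (case_nat x c) (Suc i)) = arrows (if good x then K else 0) c"
    unfolding arrows_def all by (rule ext) auto
qed (simp add: arrows_def)

lemma arrows_0_case_nat:
  "arrows 0 (case_nat x c) 0 \<longleftrightarrow> u x \<le> 1 / 2"
  "(\<lambda>i. arrows 0 (case_nat x c) (Suc i)) = arrows 0 c"
  by (simp_all add: arrows_def fun_eq_iff)

definition mean :: "(nat \<Rightarrow> real) \<Rightarrow> nat \<Rightarrow> nat \<Rightarrow> nat \<Rightarrow> real" where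
  "mean \<phi> n K m = (\<integral>c. \<phi> (failures n (arrows K c) m) \<partial>S)"

lemma abs_failures_le: "\<bar>\<phi> (failures n A m)\<bar> \<le> (\<Sum>i\<le>n. \<bar>\<phi> i :: real\<bar>)"
  using failures_le[of n A m] by (intro member_le_sum[of _ "{..n}" "\<lambda>i. \<bar>\<phi> i\<bar>"]) auto

lemma integrable_failures: "integrable S (\<lambda>c. \<phi> (failures n (arrows K c) m) :: real)"
  by (rule P.integrable_const_bound[of _ "\<Sum>i\<le>n. \<bar>\<phi> i\<bar>"]) (auto simp: abs_failures_le)

lemma mean_0 [simp]: "mean \<phi> 0 K m = \<phi> 0"
  by (simp add: mean_def P.prob_space)

lemma mean_mono:
  assumes "mono \<phi>" "m \<le> m'"
  shows "mean \<phi> n K m \<le> mean \<phi> n K m'"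
  unfolding mean_def
  by (intro integral_mono integrable_failures monoD[OF assms(1)] failures_mono assms(2))

lemma integral_cases:
  fixes A B C D :: real
  shows "(\<integral>x. (if good x then if u x \<le> (1 + a) / 2 then A else B
      else if u x \<le> 1 / 2 then C else D) \<partial>M) =
    b * ((1 + a) / 2) * A + b * ((1 - a) / 2) * B + (1 - b) / 2 * C + (1 - b) / 2 * D"
proof -
  define E1 where "E1 = {x \<in> space M. good x \<and> u x \<le> (1 + a) / 2}"
  define E2 where "E2 = {x \<in> space M. good x}"
  define E3 where "E3 = {x \<in> space M. \<not> good x \<and> u x \<le> 1 / 2}"
  have [measurable]: "E1 \<in> sets M" "E2 \<in> sets M" "E3 \<in> sets M"
    unfolding E1_def E2_def E3_def by measurable
  have "(\<integral>x. (if good x then if u x \<le> (1 + a) / 2 then A else B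
        else if u x \<le> 1 / 2 then C else D) \<partial>M) =
      (\<integral>x. (A - B) * indicator E1 x + (B - D) * indicator E2 x + (C - D) * indicator E3 x + D \<partial>M)"
    by (intro Bochner_Integration.integral_cong) (auto simp: E1_def E2_def E3_def indicator_def)
  also have "\<dots> = (A - B) * measure M E1 + (B - D) * measure M E2 + (C - D) * measure M E3 + D"
    by (simp add: M.prob_space less_top[symmetric])
  also have "\<dots> = (A - B) * (b * ((1 + a) / 2)) + (B - D) * b + (C - D) * ((1 - b) / 2) + D"
    unfolding E1_def E2_def E3_def prob_good prob_good_up prob_bad_up ..
  also have "\<dots> = b * ((1 + a) / 2) * A + b * ((1 - a) / 2) * B + (1 - b) / 2 * C + (1 - b) / 2 * D"
    by (simp add: field_simps)
  finally show ?thesis .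
qed

lemma integral_up:
  fixes C D :: real
  shows "(\<integral>x. (if u x \<le> 1 / 2 then C else D) \<partial>M) = C / 2 + D / 2"
proof -
  define E where "E = {x \<in> space M. u x \<le> 1 / 2}"
  have [measurable]: "E \<in> sets M" unfolding E_def by measurable
  have "(\<integral>x. (if u x \<le> 1 / 2 then C else D) \<partial>M) = (\<integral>x. (C - D) * indicator E x + D \<partial>M)"
    by (intro Bochner_Integration.integral_cong) (auto simp: E_def indicator_def)
  also have "\<dots> = (C - D) * measure M E + D" by (simp add: M.prob_space less_top[symmetric])
  also have "measure M E = 1 / 2" unfolding E_def by (rule prob_up)
  finally show ?thesis by (simp add: field_simps)
qed

lemma mean_iter: "mean \<phi> n K m = (\<integral>x. (\<integral>c. \<phi> (failures n (arrows K (case_nat x c)) m) \<partial>S) \<partial>M)"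
  unfolding mean_def by (rule integral_iter(1)[OF _ abs_failures_le]) measurable

text \<open>First-toss analysis: a success lowers the target to \<open>m - 1\<close>, a failure is
  added to the count, and the type of the cell decides whether cookies remain.\<close>

lemma mean_Suc_Suc:
  assumes "0 < m"
  shows "mean \<phi> (Suc n) (Suc K) m =
    b * ((1 + a) / 2) * mean \<phi> n K (m - 1) + b * ((1 - a) / 2) * mean (\<lambda>i. \<phi> (Suc i)) n K m +
    (1 - b) / 2 * mean \<phi> n 0 (m - 1) + (1 - b) / 2 * mean (\<lambda>i. \<phi> (Suc i)) n 0 m"
proof -
  have "mean \<phi> (Suc n) (Suc K) m =
    (\<integral>x. (if good x then if u x \<le> (1 + a) / 2 then mean \<phi> n K (m - 1) else mean (\<lambda>i. \<phi> (Suc i)) n K m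
      else if u x \<le> 1 / 2 then mean \<phi> n 0 (m - 1) else mean (\<lambda>i. \<phi> (Suc i)) n 0 m) \<partial>M)"
    unfolding mean_iter[of \<phi> "Suc n"] using assms
    by (intro Bochner_Integration.integral_cong) (auto simp: mean_def arrows_Suc_case_nat)
  then show ?thesis by (simp only: integral_cases)
qed

lemma mean_Suc_0:
  assumes "0 < m"
  shows "mean \<phi> (Suc n) 0 m = mean \<phi> n 0 (m - 1) / 2 + mean (\<lambda>i. \<phi> (Suc i)) n 0 m / 2"
proof -
  have "mean \<phi> (Suc n) 0 m =
      (\<integral>x. (if u x \<le> 1 / 2 then mean \<phi> n 0 (m - 1) else mean (\<lambda>i. \<phi> (Suc i)) n 0 m) \<partial>M)"
    unfolding mean_iter[of \<phi> "Suc n"] using assms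
    by (intro Bochner_Integration.integral_cong) (auto simp: mean_def arrows_0_case_nat)
  then show ?thesis by (simp only: integral_up)
qed

lemma mean_Suc_real: "mean (\<lambda>i. real (Suc i)) n K m = 1 + mean real n K m"
  unfolding mean_def using integrable_failures[of real n K m] by (simp add: P.prob_space)

lemma mean_Suc_sq:
  "mean (\<lambda>i. (real (Suc i))\<^sup>2) n K m = 1 + 2 * mean real n K m + mean (\<lambda>i. (real i)\<^sup>2) n K m"
proof -
  have "mean (\<lambda>i. (real (Suc i))\<^sup>2) n K m = (\<integral>c. 1 + 2 * real (failures n (arrows K c) m) +
      (real (failures n (arrows K c) m))\<^sup>2 \<partial>S)"
    unfolding mean_def
    by (intro Bochner_Integration.integral_cong) (auto simp: power2_eq_square algebra_simps)
  then show ?thesis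
    unfolding mean_def
    using integrable_failures[of real n K m] integrable_failures[of "\<lambda>i. (real i)\<^sup>2" n K m]
    by (simp add: P.prob_space)
qed

text \<open>Successes minus failures minus \<open>a\<close> times the number of biased tosses is a
  martingale. By \<open>K \<le> m\<close> all biased tosses come before or at the
  \<open>m\<close>-th success, so without cap the mean is \<open>m - a * \<beta> K\<close>; the cap
  can only lower the count. Fair tosses have second moment at most \<open>m^2 + 2 * m\<close>, and
  the term with \<open>a^2 * K^2\<close> is slack that lets the induction close.\<close>

lemma mean_failures_bounds:
  assumes "K \<le> m"
  shows "mean real n K m \<le> m - a * \<beta> K"
    and "mean (\<lambda>i. (real i)\<^sup>2) n K m \<le> (real m)\<^sup>2 + 2 * real m - 2 * a * m * \<beta> K + a\<^sup>2 * (real K)\<^sup>2"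
proof -
  let ?sq = "\<lambda>i::nat. (real i)\<^sup>2"
  define Q where "Q K m = (real m)\<^sup>2 + 2 * real m - 2 * a * m * \<beta> K + a\<^sup>2 * (real K)\<^sup>2" for K m
  have "mean real n K m \<le> m - a * \<beta> K \<and> mean ?sq n K m \<le> Q K m"
    using assms
  proof (induction n arbitrary: K m)
    case 0
    \<comment> \<open>With zero tosses both bounds must be nonnegative: the first by
      \<open>\<beta> K \<le> K \<le> m\<close>, the second after completing the square, where the
      slack dominates \<open>a^2 * (\<beta> K)^2\<close>.\<close>
    have "a * \<beta> K \<le> 1 * real K" using a \<beta>_bounds by (intro mult_mono) auto
    moreover have "0 \<le> (m - a * \<beta> K)\<^sup>2 + a\<^sup>2 * ((real K)\<^sup>2 - (\<beta> K)\<^sup>2) + 2 * m"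
      using \<beta>_bounds[of K] by (auto intro!: add_nonneg_nonneg mult_nonneg_nonneg power_mono)
    ultimately show ?case using 0 by (auto simp: Q_def power2_eq_square algebra_simps)
  next
    case (Suc n)
    show ?case
    proof (cases "m = 0")
      case True
      then show ?thesis using Suc.prems by (simp add: mean_def Q_def)
    next
      case m: False
      then have rm: "real (m - 1) = real m - 1" by simp
      have I0: "mean real n 0 (m - 1) \<le> real m - 1" "mean real n 0 m \<le> m"
        "mean ?sq n 0 (m - 1) \<le> Q 0 (m - 1)" "mean ?sq n 0 m \<le> Q 0 m"
        using Suc.IH[of 0 "m - 1"] Suc.IH[of 0 m] rm by auto
      show ?thesis
      proof (cases K)
        case 0
        have "mean real (Suc n) 0 m \<le> (real m - 1) / 2 + (1 + real m) / 2"
          unfolding mean_Suc_0[of m, OF m[unfolded neq0_conv]] mean_Suc_real using I0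
          by (intro add_mono divide_right_mono) auto
        moreover have "(real m - 1) / 2 + (1 + real m) / 2 = real m" by (simp add: field_simps)
        moreover have "mean ?sq (Suc n) 0 m \<le> Q 0 (m - 1) / 2 + (1 + 2 * real m + Q 0 m) / 2"
          unfolding mean_Suc_0[of m, OF m[unfolded neq0_conv]] mean_Suc_sq using I0
          by (intro add_mono divide_right_mono) auto
        moreover have "Q 0 (m - 1) / 2 + (1 + 2 * real m + Q 0 m) / 2 = Q 0 m"
          unfolding Q_def rm by (simp add: power2_eq_square field_simps)
        ultimately show ?thesis unfolding 0 by (simp only: \<beta>_0) simp
      next
        case (Suc K')
        have IK: "mean real n K' (m - 1) \<le> real m - 1 - a * \<beta> K'" "mean real n K' m \<le> m - a * \<beta> K'"
          "mean ?sq n K' (m - 1) \<le> Q K' (m - 1)" "mean ?sq n K' m \<le> Q K' m"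
          using Suc.IH[of K' "m - 1"] Suc.IH[of K' m] Suc.prems rm Suc by auto
        have "mean real (Suc n) K m \<le> b * ((1 + a) / 2) * (real m - 1 - a * \<beta> K') +
            b * ((1 - a) / 2) * (1 + (m - a * \<beta> K')) + (1 - b) / 2 * (real m - 1) + (1 - b) / 2 * (1 + real m)"
          unfolding Suc mean_Suc_Suc[of m, OF m[unfolded neq0_conv]] mean_Suc_real
          using I0 IK a b by (intro add_mono mult_left_mono) auto
        also have "\<dots> = m - a * \<beta> K"
          unfolding Suc \<beta>_Suc by (simp add: field_simps)
        finally have 1: "mean real (Suc n) K m \<le> m - a * \<beta> K" .
        have "mean ?sq (Suc n) K m \<le> b * ((1 + a) / 2) * Q K' (m - 1) +
            b * ((1 - a) / 2) * (1 + 2 * (m - a * \<beta> K') + Q K' m) +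
            (1 - b) / 2 * Q 0 (m - 1) + (1 - b) / 2 * (1 + 2 * real m + Q 0 m)"
          unfolding Suc mean_Suc_Suc[of m, OF m[unfolded neq0_conv]] mean_Suc_sq
          using I0 IK a b by (intro add_mono mult_left_mono) auto
        also have "\<dots> = (real m)\<^sup>2 + 2 * real m - 2 * a * m * (b * (1 + \<beta> K')) +
            b * (a\<^sup>2 * ((real K')\<^sup>2 + 2 * \<beta> K') - a)"
          unfolding Q_def rm by (simp add: power2_eq_square field_simps)
        \<comment> \<open>The slack grows from \<open>K'^2\<close> to \<open>(K' + 1)^2\<close>,
          which covers the new term \<open>2 * \<beta> K'\<close> because
          \<open>\<beta> K' \<le> K'\<close>.\<close>
        also have "\<dots> \<le> Q K m"
        proof -
          have "b * (a\<^sup>2 * ((real K')\<^sup>2 + 2 * \<beta> K') - a) \<le> b * (a\<^sup>2 * ((real K')\<^sup>2 + 2 * \<beta> K'))"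
            using a b by (intro mult_left_mono) auto
          also have "\<dots> \<le> 1 * (a\<^sup>2 * (real K)\<^sup>2)"
            using a b \<beta>_bounds[of K'] unfolding Suc
            by (intro mult_mono mult_left_mono) (auto simp: power2_eq_square algebra_simps)
          finally show ?thesis unfolding Q_def Suc \<beta>_Suc by simp
        qed
        finally show ?thesis using 1 by simp
      qed
    qed
  qed
  then show "mean real n K m \<le> m - a * \<beta> K"
    and "mean ?sq n K m \<le> (real m)\<^sup>2 + 2 * real m - 2 * a * m * \<beta> K + a\<^sup>2 * (real K)\<^sup>2"
    by (auto simp: Q_def)
qed

text \<open>
  Started from \<open>0\<close> in column \<open>k\<close> and read towards column \<open>0\<close>, this is the branching process with
  migration formed by the numbers of down-crossings of the levels.
\<close>

primrec branching :: "nat \<Rightarrow> nat \<Rightarrow> nat \<Rightarrow> (nat \<Rightarrow> nat \<Rightarrow> 'c) \<Rightarrow> nat" where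
  "branching n K 0 c = 0"
| "branching n K (Suc k) c = failures n (arrows K (c 0)) (Suc (branching n K k (lshift 1 c)))"

text \<open>Starting one column farther away replaces the initial state 0 by some state at least 0,
  and every later transition is monotone in the state.\<close>

lemma branching_mono: "branching n K k c \<le> branching n K (Suc k) c"
proof (induction k arbitrary: c)
  case (Suc k)
  show ?case
    unfolding branching.simps(2)[of n K "Suc k" c] branching.simps(2)[of n K k c]
    by (intro failures_mono Suc_le_mono[THEN iffD2] Suc)
qed simp

lemma branching_le: "branching n K k c \<le> n"
  by (cases k) (auto intro: failures_le)

lemma branching_measurable [measurable]: "branching n K k \<in> T \<rightarrow>\<^sub>M count_space UNIV"
proof (induction k)
  case (Suc k)
  have "(\<lambda>c. failures n (arrows K (c 0)) (Suc m)) \<in> T \<rightarrow>\<^sub>M count_space UNIV" for m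
    by (rule measurable_compose[of "\<lambda>c. c 0" T S]) measurable
  moreover have "(\<lambda>c. branching n K k (lshift 1 c)) \<in> T \<rightarrow>\<^sub>M count_space UNIV"
    by (rule measurable_compose[OF measurable_lshift Suc])
  ultimately have "(\<lambda>c. failures n (arrows K (c 0)) (Suc (branching n K k (lshift 1 c)))) \<in>
      T \<rightarrow>\<^sub>M count_space UNIV"
    by (rule measurable_compose_countable)
  then show ?case by simp
qed simp

lemma integrable_branching: "integrable T (\<lambda>c. \<phi> (branching n K k c) :: real)"
proof (rule columns.P.integrable_const_bound[of _ "\<Sum>i\<le>n. \<bar>\<phi> i\<bar>"])
  have "\<bar>\<phi> (branching n K k c)\<bar> \<le> (\<Sum>i\<le>n. \<bar>\<phi> i\<bar>)" for c
    using branching_le[of n K k c] by (intro member_le_sum[of _ "{..n}" "\<lambda>i. \<bar>\<phi> i\<bar>"]) auto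
  then show "AE c in T. norm (\<phi> (branching n K k c)) \<le> (\<Sum>i\<le>n. \<bar>\<phi> i\<bar>)" by simp
qed measurable

text \<open>Column 0 is independent of the columns behind it, which determine the current state; so
  one more column is one transition of a Markov chain with kernel \<open>mean\<close>.\<close>

lemma integral_branching_Suc:
  fixes \<phi> :: "nat \<Rightarrow> real"
  shows "(\<integral>c. \<phi> (branching n K (Suc k) c) \<partial>T) = (\<integral>c. mean \<phi> n K (Suc (branching n K k c)) \<partial>T)"
proof -
  have "(\<integral>c. \<phi> (branching n K (Suc k) c) \<partial>T) =
      (\<integral>c. (\<integral>x. \<phi> (branching n K (Suc k) (case_nat x c)) \<partial>S) \<partial>T)"
  proof (rule columns.integral_iter(2))
    show "\<bar>\<phi> (branching n K (Suc k) c)\<bar> \<le> (\<Sum>i\<le>n. \<bar>\<phi> i\<bar>)" for c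
      using branching_le[of n K "Suc k" c] by (intro member_le_sum[of _ "{..n}" "\<lambda>i. \<bar>\<phi> i\<bar>"]) auto
  qed (use integrable_branching in blast)
  then show ?thesis by (simp add: mean_def)
qed

lemma integrable_mean_branching: "integrable T (\<lambda>c. mean \<phi> n K (f (branching n K k c)))"
  by (rule integrable_branching[of "\<lambda>i. mean \<phi> n K (f i)"])

text \<open>The mean of the chain loses \<open>\<delta> - 1\<close> per step, except for a
  correction on small states. If the chain were too rarely small at one time, monotonicity in
  \<open>k\<close> would make it so at all later times, and the mean would become negative. From a
  small state, \<open>K\<close> successes at the start of a column lead to 0.\<close>

lemma prob_branching_eq_0:
  assumes \<delta>: "1 < a * \<beta> K"
  shows "\<exists>\<epsilon>>0. \<forall>n k. \<epsilon> \<le> measure T {c \<in> space T. branching n K k c = 0}"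
proof -
  define \<delta> where "\<delta> = a * \<beta> K"
  \<comment> \<open>The frequency of small states at which the correction
    \<open>K + \<delta>\<close> just balances the loss \<open>\<delta> - 1\<close>.\<close>
  define \<eta> where "\<eta> = (\<delta> - 1) / (K + \<delta>)"
  have \<delta>1: "1 < \<delta>" using assms by (simp add: \<delta>_def)
  have \<eta>: "0 < \<eta>" unfolding \<eta>_def using \<delta>1 by (intro divide_pos_pos) auto
  define s where "s n k = measure T {c \<in> space T. Suc (branching n K k c) < K}" for n k
  define e where "e n k = (\<integral>c. real (branching n K k c) \<partial>T)" for n k
  have s_anti: "s n (k + j) \<le> s n k" for n k j
  proof -
    have "branching n K k c \<le> branching n K (k + j) c" for c
      by (rule lift_Suc_mono_le[of "\<lambda>k. branching n K k c"]) (auto intro: branching_mono simp del: branching.simps)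
    then show ?thesis
      unfolding s_def by (intro columns.P.finite_measure_mono) (auto intro: le_less_trans)
  qed
  have step: "mean real n K (Suc z) \<le> real z + (1 - \<delta>) + (K + \<delta>) * indicator {z. Suc z < K} z" for n z
  proof (cases "Suc z < K")
    case True
    have "mean real n K (Suc z) \<le> mean real n K K"
      using True by (intro mean_mono) (auto simp: mono_def)
    also have "\<dots> \<le> K - \<delta>" unfolding \<delta>_def by (rule mean_failures_bounds) simp
    finally show ?thesis using True \<delta>1 by simp
  next
    case False
    then show ?thesis using mean_failures_bounds(1)[of K "Suc z" n] by (simp add: \<delta>_def)
  qed
  have e_step: "e n (Suc k) \<le> e n k + (1 - \<delta>) + (K + \<delta>) * s n k" for n k
  proof -
    have "e n (Suc k) = (\<integral>c. mean real n K (Suc (branching n K k c)) \<partial>T)"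
      unfolding e_def by (rule integral_branching_Suc)
    also have "\<dots> \<le> (\<integral>c. real (branching n K k c) + (1 - \<delta>) +
        (K + \<delta>) * indicator {z. Suc z < K} (branching n K k c) \<partial>T)"
      using integrable_branching[of "\<lambda>z. real z + (1 - \<delta>) + (K + \<delta>) * indicator {z. Suc z < K} z" n K k]
      by (intro integral_mono integrable_mean_branching step)
    also have "\<dots> = e n k + (1 - \<delta>) + (K + \<delta>) * (\<integral>c. indicator {z. Suc z < K} (branching n K k c) \<partial>T)"
      using integrable_branching[of real n K k]
        integrable_branching[of "indicator {z. Suc z < K}" n K k]
      by (simp add: e_def columns.P.prob_space)
    also have "(\<integral>c. indicator {z. Suc z < K} (branching n K k c) \<partial>T) = s n k"
    proof -
      have "(\<integral>c. indicator {z. Suc z < K} (branching n K k c) \<partial>T) =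
          (\<integral>c. indicator {c \<in> space T. Suc (branching n K k c) < K} c \<partial>T :: real)"
        by (intro Bochner_Integration.integral_cong) (auto simp: indicator_def)
      also have "\<dots> = s n k" unfolding s_def by simp
      finally show ?thesis .
    qed
    finally show ?thesis .
  qed
  have s_low: "\<eta> \<le> s n k" for n k
  proof (rule ccontr)
    assume "\<not> \<eta> \<le> s n k"
    then have "(K + \<delta>) * s n k < \<delta> - 1"
      using \<delta>1 by (simp add: \<eta>_def not_le pos_less_divide_eq mult.commute)
    then obtain g where g: "0 < g" "(K + \<delta>) * s n k + g = \<delta> - 1"
      by (metis add_diff_cancel_left' diff_gt_0_iff_gt add.commute diff_add_cancel)
    have "e n (k + j) \<le> e n k - real j * g" for j
    proof (induction j)
      case (Suc j)
      have "(K + \<delta>) * s n (k + j) \<le> (K + \<delta>) * s n k"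
        using s_anti[of n k j] \<delta>1 by (intro mult_left_mono) auto
      then show ?case using e_step[of n "k + j"] Suc g by (simp add: algebra_simps)
    qed simp
    moreover have "0 \<le> e n (k + j)" for j unfolding e_def by simp
    ultimately have "real j * g \<le> e n k" for j by (smt (verit))
    moreover obtain j :: nat where "e n k / g < real j" using reals_Archimedean2 by blast
    then have "e n k < real j * g" using g(1) by (simp add: pos_divide_less_eq)
    ultimately show False by (simp add: not_le[symmetric])
  qed
  \<comment> \<open>A seed of at most 1/2 points upwards under both thresholds, so \<open>K\<close>
    such seeds in front exclude a failure before the \<open>m\<close>-th success.\<close>
  have all_up: "(1 / 2) ^ K \<le> mean (indicator {0}) n K m" if "m \<le> K" for n m
  proof -
    let ?U = "{x \<in> space M. u x \<le> 1 / 2}"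
    let ?E = "prod_emb UNIV (\<lambda>_. M) {..<K} (\<Pi>\<^sub>E i\<in>{..<K}. ?U)"
    have [measurable]: "?E \<in> sets S" by (intro sets_PiM_I) auto
    have "(1 / 2) ^ K = measure S ?E"
      by (subst measure_PiM_emb) (simp_all only: prob_up prod_constant card_lessThan, auto)
    also have "\<dots> = (\<integral>c. indicator ?E c \<partial>S)" by simp
    also have "\<dots> \<le> mean (indicator {0}) n K m"
      unfolding mean_def
    proof (intro integral_mono integrable_failures)
      fix c
      show "indicator ?E c \<le> (indicator {0} (failures n (arrows K c) m) :: real)"
      proof (cases "c \<in> ?E")
        case True
        then have "u (c i) \<le> 1 / 2" if "i < K" for i using that by (auto simp: prod_emb_def PiE_iff)
        then have "arrows K c i" if "i < m" for i using that \<open>m \<le> K\<close> a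
          by (auto simp: arrows_def) (smt (verit) field_sum_of_halves less_le_trans)
        then show ?thesis by (simp add: failures_eq_0)
      qed simp
    qed (auto simp: less_top[symmetric])
    finally show ?thesis .
  qed
  have low: "(1 / 2) ^ K * \<eta> \<le> measure T {c \<in> space T. branching n K k c = 0}" for n k
  proof (cases k)
    case 0
    have "\<eta> \<le> 1" using s_low[of n 0] columns.P.prob_le_1 order_trans unfolding s_def by blast
    moreover have "(1 / 2 :: real) ^ K \<le> 1" by (rule power_le_one) auto
    ultimately have "(1 / 2) ^ K * \<eta> \<le> 1 * 1" using \<eta> by (intro mult_mono) auto
    then show ?thesis using 0 by (simp add: columns.P.prob_space)
  next
    case (Suc k')
    have "(1 / 2) ^ K * \<eta> \<le> (1 / 2) ^ K * s n k'" using s_low by (intro mult_left_mono) auto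
    also have "\<dots> = (\<integral>c. (1 / 2) ^ K * indicator {c \<in> space T. Suc (branching n K k' c) < K} c \<partial>T)"
      unfolding s_def by simp
    also have "\<dots> \<le> (\<integral>c. mean (indicator {0}) n K (Suc (branching n K k' c)) \<partial>T)"
    proof (intro integral_mono integrable_mean_branching)
      fix c
      have "0 \<le> mean (indicator {0}) n K m" for m unfolding mean_def by simp
      then show "(1 / 2) ^ K * indicator {c \<in> space T. Suc (branching n K k' c) < K} c
          \<le> mean (indicator {0}) n K (Suc (branching n K k' c))"
        using all_up[of "Suc (branching n K k' c)" n] by (auto simp: indicator_def)
    qed (auto intro!: columns.P.integrable_const_bound[of _ 1] simp: indicator_def power_le_one)
    also have "\<dots> = (\<integral>c. indicator {0} (branching n K (Suc k') c) \<partial>T)"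
      by (rule integral_branching_Suc[symmetric])
    also have "\<dots> = (\<integral>c. indicator {c \<in> space T. branching n K k c = 0} c \<partial>T)"
      unfolding Suc
      by (intro Bochner_Integration.integral_cong) (auto simp: indicator_def simp del: branching.simps)
    also have "\<dots> = measure T {c \<in> space T. branching n K k c = 0}"
      by simp
    finally show ?thesis .
  qed
  moreover have "0 < (1 / 2 :: real) ^ K * \<eta>" using \<eta> by simp
  ultimately show ?thesis by blast
qed

text \<open>In mean the square of the state changes by at most \<open>- g * z + C\<close> from state
  \<open>z\<close>. Summed over \<open>k\<close> steps started at 0, and with the final square
  nonnegative, this bounds \<open>g\<close> times the sum of the means by
  \<open>C * k\<close>.\<close>

lemma sum_branching_le:
  assumes \<delta>: "2 < a * \<beta> K"
  shows "\<exists>C\<ge>0. \<forall>n k. (\<Sum>t<k. \<integral>c. real (branching n K t c) \<partial>T) \<le> C * real k"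
proof -
  define \<delta> where "\<delta> = a * \<beta> K"
  \<comment> \<open>Minus the coefficient of \<open>z\<close> in
    \<open>(z + 1)^2 + 2 * (z + 1) - 2 * \<delta> * (z + 1)\<close>, which is the leading part of
    the bound at \<open>m = z + 1\<close>.\<close>
  define g where "g = 2 * \<delta> - 4"
  \<comment> \<open>Covers both ranges of \<open>z\<close>: for \<open>Suc z < K\<close> the whole
    second moment and the subtracted \<open>g * z\<close>, otherwise the remainder
    \<open>3 - 2 * \<delta> + a^2 * K^2\<close>.\<close>
  define C where "C = 2 * (real K)\<^sup>2 + 2 * real K + 3 + g * K"
  have g: "0 < g" using assms by (simp add: g_def \<delta>_def)
  have C: "0 \<le> C" unfolding C_def using g by simp
  let ?sq = "\<lambda>i::nat. (real i)\<^sup>2"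
  have aK: "a\<^sup>2 * (real K)\<^sup>2 \<le> (real K)\<^sup>2"
    using a power_le_one[of a 2] by (simp add: mult_left_le_one_le)
  have step: "mean ?sq n K (Suc z) \<le> ?sq z - g * z + C" for n z
  proof (cases "Suc z < K")
    case True
    have "mean ?sq n K (Suc z) \<le> mean ?sq n K K"
      using True by (intro mean_mono) (auto simp: mono_def)
    also have "\<dots> \<le> (real K)\<^sup>2 + 2 * real K - 2 * a * K * \<beta> K + a\<^sup>2 * (real K)\<^sup>2"
      by (rule mean_failures_bounds) simp
    also have "\<dots> \<le> 2 * (real K)\<^sup>2 + 2 * real K"
    proof -
      have "0 \<le> 2 * a * K * \<beta> K" using a \<beta>_bounds[of K] by simp
      then show ?thesis using aK by linarith
    qed
    also have "\<dots> \<le> ?sq z - g * z + C"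
    proof -
      have "g * z \<le> g * K" using True g by (intro mult_left_mono) auto
      then show ?thesis unfolding C_def using zero_le_power2[of "real z"] by linarith
    qed
    finally show ?thesis .
  next
    case False
    have "mean ?sq n K (Suc z) \<le>
        (real (Suc z))\<^sup>2 + 2 * real (Suc z) - 2 * a * real (Suc z) * \<beta> K + a\<^sup>2 * (real K)\<^sup>2"
      using False by (intro mean_failures_bounds) simp
    also have "\<dots> = ?sq z - g * z + 3 - 2 * \<delta> + a\<^sup>2 * (real K)\<^sup>2"
      unfolding g_def \<delta>_def by (simp add: power2_eq_square algebra_simps)
    also have "\<dots> \<le> ?sq z - g * z + C"
    proof -
      have "0 \<le> \<delta>" "0 \<le> g * K" "0 \<le> 2 * real K" "0 \<le> (real K)\<^sup>2"
        using g by (auto simp: g_def)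
      then show ?thesis unfolding C_def using aK by linarith
    qed
    finally show ?thesis .
  qed
  have sum: "g * (\<Sum>t<k. \<integral>c. real (branching n K t c) \<partial>T) + (\<integral>c. ?sq (branching n K k c) \<partial>T) \<le> C * k"
    for n k
  proof (induction k)
    case (Suc k)
    have "(\<integral>c. ?sq (branching n K (Suc k) c) \<partial>T) = (\<integral>c. mean ?sq n K (Suc (branching n K k c)) \<partial>T)"
      by (rule integral_branching_Suc)
    also have "\<dots> \<le> (\<integral>c. ?sq (branching n K k c) - g * branching n K k c + C \<partial>T)"
      using integrable_branching[of "\<lambda>z. ?sq z - g * z + C" n K k]
      by (intro integral_mono integrable_mean_branching step)
    also have "\<dots> = (\<integral>c. ?sq (branching n K k c) \<partial>T) - g * (\<integral>c. real (branching n K k c) \<partial>T) + C"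
      using integrable_branching[of real n K k] integrable_branching[of ?sq n K k]
      by (simp add: columns.P.prob_space)
    finally show ?case using Suc by (simp add: algebra_simps)
  qed simp
  have "(\<Sum>t<k. \<integral>c. real (branching n K t c) \<partial>T) \<le> C / g * k" for n k
  proof -
    have "0 \<le> (\<integral>c. ?sq (branching n K k c) \<partial>T)" by simp
    then have "g * (\<Sum>t<k. \<integral>c. real (branching n K t c) \<partial>T) \<le> C * k" using sum[of n k] by linarith
    then show ?thesis using g by (simp add: field_simps)
  qed
  then show ?thesis using C g by (intro exI[of _ "C / g"]) auto
qed

end

section \<open>Crossings of nearest neighbour sequences of integers\<close>

definition ups :: "(nat \<Rightarrow> int) \<Rightarrow> int \<Rightarrow> nat \<Rightarrow> nat" where
  "ups Y j t = card {n. n < t \<and> Y n = j \<and> Y (Suc n) = j + 1}"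

definition downs :: "(nat \<Rightarrow> int) \<Rightarrow> int \<Rightarrow> nat \<Rightarrow> nat" where
  "downs Y j t = card {n. n < t \<and> Y n = j \<and> Y (Suc n) = j - 1}"

definition visits :: "(nat \<Rightarrow> int) \<Rightarrow> nat \<Rightarrow> nat" where
  "visits Y n = card {l. l < n \<and> Y l = Y n}"

definition hitting_time :: "(nat \<Rightarrow> int) \<Rightarrow> nat \<Rightarrow> nat" where
  "hitting_time Y k = (LEAST n. Y n = int k)"

lemma card_less_Suc_Collect:
  "card {n. n < Suc t \<and> P n} = card {n. n < t \<and> P n} + (if P t then 1 else 0)"
proof -
  have "{n. n < Suc t \<and> P n} = (if P t then insert t {n. n < t \<and> P n} else {n. n < t \<and> P n})"
    by (auto simp: less_Suc_eq)
  then show ?thesis by simp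
qed

locale nn_path =
  fixes Y :: "nat \<Rightarrow> int"
  assumes Y_0 [simp]: "Y 0 = 0"
    and Y_step: "Y (Suc n) = Y n + 1 \<or> Y (Suc n) = Y n - 1"
begin

text \<open>The path starts at or below \<open>j\<close>, so the crossings of the edge between
  \<open>j\<close> and \<open>j + 1\<close> alternate, beginning with an upward one.\<close>

lemma ups_eq:
  assumes "0 \<le> j"
  shows "ups Y j t = downs Y (j + 1) t + (if j < Y t then 1 else 0)"
proof (induction t)
  case (Suc t)
  have "ups Y j (Suc t) = ups Y j t + (if Y t = j \<and> Y (Suc t) = j + 1 then 1 else 0)"
    "downs Y (j + 1) (Suc t) = downs Y (j + 1) t + (if Y t = j + 1 \<and> Y (Suc t) = j then 1 else 0)"
    unfolding ups_def downs_def by (subst card_less_Suc_Collect, simp)+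
  then show ?case using Suc Y_step[of t] by auto
qed (use assms in \<open>simp add: ups_def downs_def\<close>)

lemma exists_between:
  assumes "s \<le> t" "Y s \<le> j" "j < Y t"
  shows "\<exists>n. s \<le> n \<and> n < t \<and> Y n = j \<and> Y (Suc n) = j + 1"
  using assms
proof (induction rule: dec_induct)
  case (step t)
  show ?case
  proof (cases "j < Y t")
    case True
    then show ?thesis using step by (meson less_SucI)
  next
    case False
    then have "Y t = j" "Y (Suc t) = j + 1" using Y_step[of t] step by auto
    then show ?thesis using step by blast
  qed
qed simp

lemma before_hit:
  assumes t: "\<And>l. l < t \<Longrightarrow> Y l \<noteq> int k" and l: "l < t" and k: "0 < k"
  shows "Y l < int k"
proof (rule ccontr)
  assume "\<not> Y l < int k"
  moreover have "Y l \<noteq> int k" by (rule t) (rule l)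
  ultimately have "int k < Y l" by simp
  then obtain n where "n < l" "Y n = int k"
    using exists_between[of 0 l "int k"] by auto
  then show False using t[of n] l by simp
qed

lemma
  assumes "\<exists>n. Y n = int k"
  shows Y_hitting_time: "Y (hitting_time Y k) = int k"
    and before_hitting_time: "l < hitting_time Y k \<Longrightarrow> Y l < int k"
proof -
  show "Y (hitting_time Y k) = int k"
    unfolding hitting_time_def using assms by (rule LeastI_ex)
  assume l: "l < hitting_time Y k"
  then have "Y i \<noteq> int k" if "i < hitting_time Y k" for i
    using that not_less_Least unfolding hitting_time_def by blast
  moreover have "0 < k" using l by (cases k) (auto simp: hitting_time_def Least_eq_0)
  ultimately show "Y l < int k" using before_hit l by blast
qed

lemma hitting_time_eqI:
  assumes "Y t = int k" "\<And>l. l < t \<Longrightarrow> Y l < int k"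
  shows "hitting_time Y k = t"
  unfolding hitting_time_def
proof (rule Least_equality)
  fix l assume "Y l = int k"
  then show "t \<le> l" using assms(2)[of l] by (cases "l < t") auto
qed (rule assms(1))

lemma Y_le: "Y n \<le> int n"
proof (induction n)
  case (Suc n)
  then show ?case using Y_step[of n] by auto
qed simp

lemma hitting_time_ge:
  assumes "\<exists>n. Y n = int k"
  shows "k \<le> hitting_time Y k"
  using Y_hitting_time[OF assms] Y_le[of "hitting_time Y k"] by simp

lemma hitting_time_mono:
  assumes "\<exists>n. Y n = int k" "\<exists>n. Y n = int k'" "k \<le> k'"
  shows "hitting_time Y k \<le> hitting_time Y k'"
proof (rule ccontr)
  assume "\<not> ?thesis"
  then have "Y (hitting_time Y k') < int k" by (intro before_hitting_time assms) simp
  then show False using Y_hitting_time[OF assms(2)] assms(3) by simp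
qed

text \<open>
  If every visit at which the reference arrow \<open>A i\<close> of level \<open>j\<close> points upwards is followed by a step up, then
  before the last up-crossing of level \<open>j\<close> the reference arrows have pointed upwards fewer times
  than the walk, so every down-step is matched by a counted failure of the reference arrows.
\<close>

lemma downs_le_failures:
  assumes A: "\<And>n. Y n = j \<Longrightarrow> A (visits Y n) \<Longrightarrow> Y (Suc n) = j + 1"
    and t: "j < Y t" "t \<le> N" and m: "ups Y j t \<le> m"
  shows "downs Y j t \<le> failures N A m"
proof -
  let ?D = "{n. n < t \<and> Y n = j \<and> Y (Suc n) = j - 1}"
  let ?F = "{i. i < N \<and> \<not> A i \<and> card {l. l < i \<and> A l} < m}"
  have vis_less: "visits Y n < visits Y n'" if "n < n'" "Y n = j" "Y n' = j" for n n'
    unfolding visits_def using that by (intro psubset_card_mono) auto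
  have inj: "inj_on (visits Y) {n. Y n = j}"
  proof (rule inj_onI)
    fix n n' assume *: "n \<in> {n. Y n = j}" "n' \<in> {n. Y n = j}" "visits Y n = visits Y n'"
    show "n = n'"
    proof (rule linorder_cases[of n n'])
      assume "n < n'" then show ?thesis using vis_less[of n n'] * by simp
    next
      assume "n' < n" then show ?thesis using vis_less[of n' n] * by simp
    qed
  qed
  have vis_le: "visits Y n \<le> n" for n
    unfolding visits_def using card_mono[of "{..<n}" "{l. l < n \<and> Y l = Y n}"] by auto
  have "visits Y ` ?D \<subseteq> ?F"
  proof
    fix i assume "i \<in> visits Y ` ?D"
    then obtain n where n: "n < t" "Y n = j" "Y (Suc n) = j - 1" and i: "i = visits Y n" by auto
    have nA: "\<not> A i" using A[OF n(2)] n(3) i by auto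
    \<comment> \<open>Visit numbers grow by one from visit to visit, so the earlier visits to
      \<open>j\<close> carry exactly the numbers below \<open>i\<close>.\<close>
    have surj: "visits Y ` {l. l < n \<and> Y l = j} = {..<i}"
    proof (rule card_subset_eq)
      show "visits Y ` {l. l < n \<and> Y l = j} \<subseteq> {..<i}"
        using vis_less n(2) i by auto
      have "card (visits Y ` {l. l < n \<and> Y l = j}) = card {l. l < n \<and> Y l = j}"
        by (intro card_image inj_on_subset[OF inj]) auto
      also have "\<dots> = i" unfolding i visits_def n(2) ..
      finally show "card (visits Y ` {l. l < n \<and> Y l = j}) = card {..<i}" by simp
    qed simp
    have "{l. l < i \<and> A l} \<subseteq> visits Y ` {l. l < n \<and> Y l = j \<and> Y (Suc l) = j + 1}"
    proof
      fix l assume l: "l \<in> {l. l < i \<and> A l}"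
      then have "l \<in> visits Y ` {l. l < n \<and> Y l = j}" unfolding surj by simp
      then obtain l' where "l = visits Y l'" "l' < n" "Y l' = j" by auto
      moreover from this have "Y (Suc l') = j + 1" using A l by auto
      ultimately show "l \<in> visits Y ` {l. l < n \<and> Y l = j \<and> Y (Suc l) = j + 1}" by blast
    qed
    then have "card {l. l < i \<and> A l} \<le> ups Y j n"
      unfolding ups_def by (rule surj_card_le[rotated]) simp
    \<comment> \<open>After the down-step the path is below \<open>j\<close>, at time
      \<open>t\<close> it is above, so an up-crossing is still to come. This gives the strict
      inequality needed for fewer than \<open>m\<close> successes.\<close>
    also have "ups Y j n < ups Y j t"
    proof -
      obtain l where "Suc n \<le> l" "l < t" "Y l = j" "Y (Suc l) = j + 1"
        using exists_between[of "Suc n" t j] n t by auto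
      then have "{n'. n' < n \<and> Y n' = j \<and> Y (Suc n') = j + 1} \<subseteq>
          {n. n < t \<and> Y n = j \<and> Y (Suc n) = j + 1} - {l}"
        using n by auto
      moreover have "l \<in> {n. n < t \<and> Y n = j \<and> Y (Suc n) = j + 1}"
        using \<open>l < t\<close> \<open>Y l = j\<close> \<open>Y (Suc l) = j + 1\<close> by simp
      ultimately show ?thesis unfolding ups_def by (intro psubset_card_mono psubsetI) (simp, blast, blast)
    qed
    finally have "card {l. l < i \<and> A l} < m" using m by simp
    moreover have "i < N" using vis_le[of n] n(1) t(2) i by simp
    ultimately show "i \<in> ?F" using nA by simp
  qed
  moreover have "inj_on (visits Y) ?D" by (rule inj_on_subset[OF inj]) auto
  ultimately have "card ?D \<le> card ?F" by (intro card_inj_on_le) auto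
  then show ?thesis unfolding downs_def using card_le_failures order_trans by blast
qed

lemma downs_hitting_time:
  assumes "\<exists>n. Y n = int k"
  shows "downs Y (int k) (hitting_time Y k) = 0"
proof -
  have "\<not> (n < hitting_time Y k \<and> Y n = int k \<and> Y (Suc n) = int k - 1)" for n
    using before_hitting_time[OF assms, of n] by auto
  then show ?thesis unfolding downs_def by simp
qed

lemma card_visits:
  "card {n. n < t \<and> Y n = j} = ups Y j t + downs Y j t"
proof -
  let ?U = "{n. n < t \<and> Y n = j \<and> Y (Suc n) = j + 1}"
  let ?D = "{n. n < t \<and> Y n = j \<and> Y (Suc n) = j - 1}"
  have "n \<in> {n. n < t \<and> Y n = j} \<longleftrightarrow> n \<in> ?U \<union> ?D" for n
    using Y_step[of n] by auto
  then have "{n. n < t \<and> Y n = j} = ?U \<union> ?D" by blast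
  moreover have "card (?U \<union> ?D) = card ?U + card ?D"
    by (rule card_Un_disjoint) auto
  ultimately show ?thesis unfolding ups_def downs_def by simp
qed

text \<open>Negative levels are left out because the comparison with the branching process bounds
  crossings of levels at least 0 only.\<close>

definition occupation :: "nat \<Rightarrow> nat" where
  "occupation k = card {n. n < hitting_time Y k \<and> 0 \<le> Y n}"

text \<open>Each visit is followed by an up- or a down-step, and before level \<open>k\<close> is
  hit the up-steps from \<open>j < k\<close> exceed the down-steps from \<open>j + 1\<close> by one;
  hence the factor 2 and the summand \<open>k\<close>.\<close>

lemma occupation_le:
  assumes hit: "\<exists>n. Y n = int k"
  shows "occupation k \<le> k + 2 * (\<Sum>j\<le>k. downs Y (int j) (hitting_time Y k))"
proof -
  let ?t = "hitting_time Y k"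
  have "{n. n < ?t \<and> 0 \<le> Y n} = (\<Union>j<k. {n. n < ?t \<and> Y n = int j})"
  proof (intro set_eqI iffI)
    fix n assume "n \<in> {n. n < ?t \<and> 0 \<le> Y n}"
    then have "n < ?t" "Y n = int (nat (Y n))" "nat (Y n) < k"
      using before_hitting_time[OF hit, of n] by auto
    then show "n \<in> (\<Union>j<k. {n. n < ?t \<and> Y n = int j})" by blast
  qed auto
  then have "occupation k = card (\<Union>j<k. {n. n < ?t \<and> Y n = int j})" by (simp add: occupation_def)
  also have "\<dots> \<le> (\<Sum>j<k. card {n. n < ?t \<and> Y n = int j})" by (rule card_UN_le) simp
  also have "\<dots> = (\<Sum>j<k. downs Y (int (Suc j)) ?t + 1 + downs Y (int j) ?t)"
    unfolding card_visits
    by (intro sum.cong) (auto simp: ups_eq Y_hitting_time[OF hit] add.commute)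
  also have "\<dots> = (\<Sum>j<k. downs Y (int (Suc j)) ?t) + k + (\<Sum>j<k. downs Y (int j) ?t)"
    by (simp only: sum.distrib sum_constant card_lessThan mult_1_right of_nat_id)
  also have "\<dots> \<le> (\<Sum>j\<le>k. downs Y (int j) ?t) + k + (\<Sum>j\<le>k. downs Y (int j) ?t)"
  proof -
    have "(\<Sum>j<k. downs Y (int (Suc j)) ?t) = (\<Sum>j\<in>Suc ` {..<k}. downs Y (int j) ?t)"
      by (subst sum.reindex) auto
    also have "\<dots> \<le> (\<Sum>j\<le>k. downs Y (int j) ?t)" by (rule sum_mono2) auto
    finally show ?thesis by (intro add_mono sum_mono2) auto
  qed
  finally show ?thesis by simp
qed

end

text \<open>Induction downwards from level \<open>k\<close>, which has not been left before it is
  hit. The up-crossings of \<open>j\<close> exceed the down-crossings of \<open>j + 1\<close> by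
  one, and their number is the number of successes to be read in column \<open>j\<close>. As every
  visit number is below \<open>N\<close>, a cap of \<open>N\<close> tosses loses nothing.\<close>

lemma (in cookie_columns) downs_le_branching:
  assumes Y: "nn_path Y" and hit: "\<exists>n. Y n = int k" and N: "hitting_time Y k \<le> N"
    and A: "\<And>j n. Y n = int j \<Longrightarrow> arrows K (c j) (visits Y n) \<Longrightarrow> Y (Suc n) = int j + 1"
  shows "j \<le> k \<Longrightarrow> downs Y (int j) (hitting_time Y k) \<le> branching N K (k - j) (lshift j c)"
proof (induction rule: inc_induct)
  case base
  show ?case using nn_path.downs_hitting_time[OF Y hit] by simp
next
  case (step j)
  interpret nn_path Y by (rule Y)
  let ?t = "hitting_time Y k"
  let ?m = "Suc (branching N K (k - Suc j) (lshift (Suc j) c))"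
  have "ups Y (int j) ?t \<le> ?m"
    using step ups_eq[of "int j" ?t] by (simp add: add.commute)
  then have "downs Y (int j) ?t \<le> failures N (arrows K (c j)) ?m"
    using step N Y_hitting_time[OF hit] by (intro downs_le_failures A) auto
  moreover have "k - j = Suc (k - Suc j)" using step by simp
  moreover have "lshift j c 0 = c j" by (simp add: lshift_def)
  ultimately show ?case by simp
qed

section \<open>The walk as a function of its columns\<close>

definition level :: "int ^ 'd \<Rightarrow> int" where
  "level x = (\<Sum>i\<in>UNIV. x $ i)"

lemma level_add: "level (x + y) = level x + level y"
  by (simp add: level_def sum.distrib)

lemma level_0 [simp]: "level 0 = 0"
  by (simp add: level_def)

definition visit :: "(int ^ 'd) list \<Rightarrow> nat" where
  "visit h = length (filter (\<lambda>y. level y = level (hd h)) (tl h))"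

text \<open>In chronological order the history is cut at the first visit to the current site, and
  the sites of its level seen before the cut are counted without repetition. So later visits do not
  change the rank of a site.\<close>

definition rank :: "(int ^ 'd) list \<Rightarrow> nat" where
  "rank h = card {z \<in> set (takeWhile (\<lambda>z. z \<noteq> hd h) (rev h)). level z = level (hd h)}"

lemma visit_map: "visit (map x (rev [0..<Suc n])) = visits (\<lambda>l. level (x l)) n"
proof -
  let ?P = "\<lambda>l. level (x l) = level (x n)"
  have "visit (map x (rev [0..<Suc n])) = length (filter ?P (rev [0..<n]))"
    by (simp add: visit_def filter_map o_def)
  also have "\<dots> = card (set (filter ?P (rev [0..<n])))"
    by (subst distinct_card) auto
  also have "set (filter ?P (rev [0..<n])) = {l. l < n \<and> ?P l}"
    by auto
  finally show ?thesis by (simp add: visits_def)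
qed

text \<open>Sites discovered earlier have been visited earlier. This ties the law in force at visit
  \<open>i\<close> to the first \<open>i + 1\<close> cells of the column.\<close>

lemma rank_le_visit:
  assumes "h \<noteq> []"
  shows "rank h \<le> visit h"
proof -
  let ?P = "\<lambda>y. level y = level (hd h)"
  have "{z \<in> set (takeWhile (\<lambda>z. z \<noteq> hd h) (rev h)). ?P z} \<subseteq> set (filter ?P (tl h))"
    using assms by (cases h) (auto dest!: set_takeWhileD)
  then have "rank h \<le> card (set (filter ?P (tl h)))" unfolding rank_def by (intro card_mono) auto
  also have "\<dots> \<le> visit h" unfolding visit_def by (rule card_length)
  finally show ?thesis .
qed

text \<open>A past strictly below the level of \<open>v\<close> contributes neither visits nor
  discoveries to the levels from there on, and a translation preserves both counts.\<close>

lemma rank_append: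
  assumes g: "\<And>z. z \<in> set g \<Longrightarrow> level z < level v" and h: "h \<noteq> []" "0 \<le> level (hd h)"
  shows "rank (map (\<lambda>x. x + v) h @ g) = rank h" and "visit (map (\<lambda>x. x + v) h @ g) = visit h"
proof -
  have hd: "hd (map (\<lambda>x. x + v) h @ g) = hd h + v" using h by (cases h) auto
  have tl: "tl (map (\<lambda>x. x + v) h @ g) = map (\<lambda>x. x + v) (tl h) @ g" using h by (cases h) auto
  have ng: "level z \<noteq> level (hd h + v)" if "z \<in> set g" for z
    using g[OF that] h by (simp add: level_add)
  have "takeWhile (\<lambda>z. z \<noteq> hd h + v) (rev (map (\<lambda>x. x + v) h @ g)) =
      rev g @ map (\<lambda>x. x + v) (takeWhile (\<lambda>z. z \<noteq> hd h) (rev h))"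
  proof -
    have "takeWhile (\<lambda>z. z \<noteq> hd h + v) (rev g @ map (\<lambda>x. x + v) (rev h)) =
        rev g @ takeWhile (\<lambda>z. z \<noteq> hd h + v) (map (\<lambda>x. x + v) (rev h))"
      using ng by (intro takeWhile_append2) auto
    then show ?thesis by (simp add: rev_map takeWhile_map o_def)
  qed
  then have "{z \<in> set (takeWhile (\<lambda>z. z \<noteq> hd h + v) (rev (map (\<lambda>x. x + v) h @ g))).
        level z = level (hd h + v)} =
      (\<lambda>x. x + v) ` {z \<in> set (takeWhile (\<lambda>z. z \<noteq> hd h) (rev h)). level z = level (hd h)}"
    using ng by (auto simp: level_add)
  then show "rank (map (\<lambda>x. x + v) h @ g) = rank h"
    unfolding rank_def hd by (simp only:) (rule card_image, auto simp: inj_on_def)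
  have "filter (\<lambda>y. level y = level (hd h + v)) g = []" using ng by (auto simp: filter_empty_conv)
  then show "visit (map (\<lambda>x. x + v) h @ g) = visit h"
    unfolding visit_def hd tl by (simp add: filter_map o_def level_add)
qed

text \<open>
  Histories list the most recent position first. The cell \<open>w j i\<close> contains the transition law of
  the site that is discovered as number \<open>i\<close> in level \<open>j\<close>, and the randomness that is used at visit
  number \<open>i\<close> to level \<open>j\<close>; these two indices are \<^const>\<open>rank\<close> and \<^const>\<open>visit\<close>. This bookkeeping makes the
  part of the walk after it first reaches a level, and until it leaves it downwards, a function of
  the columns above that level.
\<close>

type_synonym ('p, 's) columns = "int \<Rightarrow> nat \<Rightarrow> 'p \<times> 's"

locale column_walk =
  fixes step :: "'p \<Rightarrow> 's \<Rightarrow> int ^ 'd"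
  assumes step: "level (step p s) = 1 \<or> level (step p s) = - 1"
begin

definition succ :: "('p, 's) columns \<Rightarrow> (int ^ 'd) list \<Rightarrow> int ^ 'd" where
  "succ w h = hd h +
    step (fst (w (level (hd h)) (rank h))) (snd (w (level (hd h)) (visit h)))"

primrec history :: "('p, 's) columns \<Rightarrow> nat \<Rightarrow> (int ^ 'd) list" where
  "history w 0 = [0]"
| "history w (Suc n) = succ w (history w n) # history w n"

definition X :: "('p, 's) columns \<Rightarrow> nat \<Rightarrow> int ^ 'd" where
  "X w n = hd (history w n)"

definition Y :: "('p, 's) columns \<Rightarrow> nat \<Rightarrow> int" where
  "Y w n = level (X w n)"

lemma history_Suc: "history w (Suc n) = X w (Suc n) # history w n"
  by (simp add: X_def)

lemma history_eq: "history w n = map (X w) (rev [0..<Suc n])"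
proof (induction n)
  case (Suc n)
  then show ?case unfolding history_Suc by simp
qed (simp add: X_def)

lemma history_not_Nil [simp]: "history w n \<noteq> []"
  by (cases n) simp_all

lemma length_history [simp]: "length (history w n) = Suc n"
  by (induction n) simp_all

lemma X_Suc: "X w (Suc n) = X w n +
    step (fst (w (Y w n) (rank (history w n)))) (snd (w (Y w n) (visit (history w n))))"
  by (simp add: X_def Y_def succ_def)

lemma nn_path_Y: "nn_path (Y w)"
proof
  show "Y w 0 = 0" by (simp add: Y_def X_def)
  fix n
  obtain p s where "X w (Suc n) = X w n + step p s" using X_Suc by blast
  then show "Y w (Suc n) = Y w n + 1 \<or> Y w (Suc n) = Y w n - 1"
    using step[of p s] by (auto simp: Y_def level_add)
qed

lemma visit_history: "visit (history w n) = visits (Y w) n"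
  unfolding history_eq visit_map Y_def ..

definition above :: "nat \<Rightarrow> ('p, 's) columns \<Rightarrow> ('p, 's) columns" where
  "above k w = (\<lambda>j. w (j + int k))"

lemma above_above [simp]: "above k (above l w) = above (k + l) w"
  by (simp add: above_def algebra_simps)

lemma above_0 [simp]: "above 0 w = w"
  by (simp add: above_def)

text \<open>The past of the first visit to level \<open>k\<close> lies strictly below
  \<open>k\<close>, so ranks and visit numbers start afresh there. Only times before
  \<open>n\<close> must stay up: position \<open>n\<close> itself may be the first one
  below.\<close>

lemma history_above:
  assumes t: "Y w t = int k" "\<And>l. l < t \<Longrightarrow> Y w l < int k"
    and n: "\<And>l. l < n \<Longrightarrow> 0 \<le> Y (above k w) l"
  shows "history w (t + n) = map (\<lambda>x. x + X w t) (history (above k w) n) @ map (X w) (rev [0..<t])"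
  using n
proof (induction n)
  case 0
  show ?case using history_eq[of w t] by simp
next
  case (Suc n)
  let ?g = "map (X w) (rev [0..<t])"
  let ?h = "history (above k w) n"
  have IH: "history w (t + n) = map (\<lambda>x. x + X w t) ?h @ ?g" using Suc by simp
  have g: "level z < level (X w t)" if "z \<in> set ?g" for z using that t by (auto simp: Y_def)
  have nonneg: "0 \<le> level (hd ?h)" using Suc.prems[of n] by (simp add: Y_def X_def)
  have hd: "hd (history w (t + n)) = hd ?h + X w t" unfolding IH by (simp add: hd_append hd_map)
  have lev: "level (X w t) = int k" using t(1) by (simp add: Y_def)
  have rk: "rank (map (\<lambda>x. x + X w t) ?h @ ?g) = rank ?h"
    and vs: "visit (map (\<lambda>x. x + X w t) ?h @ ?g) = visit ?h"
    by (rule rank_append; use g nonneg in simp)+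
  have "succ w (history w (t + n)) = succ (above k w) ?h + X w t"
    unfolding succ_def hd level_add lev
    unfolding IH rk vs by (simp add: above_def)
  then show ?case by (simp add: IH)
qed

lemma Y_above:
  assumes "Y w t = int k" "\<And>l. l < t \<Longrightarrow> Y w l < int k" "\<And>l. l < n \<Longrightarrow> 0 \<le> Y (above k w) l"
  shows "Y w (t + n) = int k + Y (above k w) n"
proof -
  have "hd (history w (t + n)) = hd (history (above k w) n) + X w t"
    by (subst history_above) (use assms in \<open>auto simp: hd_append hd_map\<close>)
  then have "X w (t + n) = X (above k w) n + X w t"
    unfolding X_def[of w "t + n"] X_def[of "above k w" n] .
  then show ?thesis using assms(1) by (simp add: Y_def level_add)
qed

lemma history_cong:
  assumes w: "\<And>j. 0 \<le> j \<Longrightarrow> w j = w' j" and n: "\<And>l. l < n \<Longrightarrow> 0 \<le> Y w l"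
  shows "history w n = history w' n"
  using n
proof (induction n)
  case (Suc n)
  have "0 \<le> level (hd (history w n))" using Suc.prems[of n] by (simp add: Y_def X_def)
  then show ?case using Suc by (simp add: succ_def w)
qed simp

section \<open>Events and durations that depend on the nonnegative columns only\<close>

definition stays :: "('p, 's) columns \<Rightarrow> bool" where
  "stays w \<longleftrightarrow> (\<forall>n. 0 \<le> Y w n)"

definition climbs :: "('p, 's) columns \<Rightarrow> bool" where
  "climbs w \<longleftrightarrow> (\<forall>k. \<exists>n. Y w n = int k)"

abbreviation H :: "('p, 's) columns \<Rightarrow> nat \<Rightarrow> nat" where
  "H w \<equiv> hitting_time (Y w)"

lemma stays_cong:
  assumes w: "\<And>j. 0 \<le> j \<Longrightarrow> w j = w' j"
  shows "stays w \<longleftrightarrow> stays w'"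
proof -
  have *: "stays w'" if eq: "\<And>j. 0 \<le> j \<Longrightarrow> w j = w' j" and st: "stays w" for w w'
  proof -
    have "history w n = history w' n" for n
      using history_cong[of w w' n] eq st by (auto simp: stays_def)
    then show ?thesis using st by (simp add: stays_def Y_def X_def)
  qed
  show ?thesis using *[of w w'] *[of w' w] w by auto
qed

text \<open>Time to the next regeneration level, or 0 if level 0 is not regenerative or the next one
  is farther than \<open>L\<close>. The cut-off keeps a sum over the first \<open>K\<close> levels
  within the time needed to climb to level \<open>K + L\<close>.\<close>

definition duration :: "nat \<Rightarrow> ('p, 's) columns \<Rightarrow> nat" where
  "duration L w = (if stays w \<and> (\<exists>k. 0 < k \<and> k \<le> L \<and> stays (above k w))
     then H w (LEAST k. 0 < k \<and> stays (above k w)) else 0)"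

lemma duration_cong:
  assumes w: "\<And>j. 0 \<le> j \<Longrightarrow> w j = w' j"
  shows "duration L w = duration L w'"
proof (cases "stays w")
  case True
  have "history w n = history w' n" for n
    using history_cong[of w w' n] w True by (auto simp: stays_def)
  then have 1: "Y w = Y w'" by (simp add: Y_def X_def fun_eq_iff)
  have 2: "stays (above k w) = stays (above k w')" for k
    by (rule stays_cong) (simp add: above_def w)
  have 3: "stays w = stays w'" by (rule stays_cong) (rule w)
  show ?thesis unfolding duration_def 1 2 3 ..
next
  case False
  then show ?thesis using stays_cong[of w w'] w by (simp add: duration_def)
qed

lemma duration_mono: "duration L w \<le> duration (L + l) w"
  unfolding duration_def by (auto intro: trans_le_add1)

end

locale climbing_walk = column_walk step for step :: "'p \<Rightarrow> 's \<Rightarrow> int ^ 'd" +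
  fixes w :: "('p, 's) columns"
  assumes climbs: "\<And>k. climbs (above k w)"
begin

sublocale nn_path "Y w" by (rule nn_path_Y)

lemma hit: "\<exists>n. Y w n = int k"
  using climbs[of 0] by (simp add: climbs_def)

lemma Y_after:
  assumes "stays (above k w)"
  shows "Y w (H w k + n) = int k + Y (above k w) n"
  using assms Y_hitting_time[OF hit] before_hitting_time[OF hit]
  by (intro Y_above) (auto simp: stays_def)

lemma Y_after_ge:
  assumes "stays (above k w)" "H w k \<le> n"
  shows "int k \<le> Y w n"
  using Y_after[OF assms(1), of "n - H w k"] assms by (simp add: stays_def)

text \<open>After a regeneration level the walk is a translated copy of the walk in the columns
  above, and before it all levels are smaller, so hitting times add.\<close>

lemma H_add:
  assumes k: "stays (above k w)"
  shows "H w (k + l) = H w k + H (above k w) l"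
proof -
  interpret A: nn_path "Y (above k w)" by (rule nn_path_Y)
  have ex: "\<exists>n. Y (above k w) n = int l" using climbs[of k] by (simp add: climbs_def)
  show ?thesis
  proof (rule hitting_time_eqI)
    show "Y w (H w k + H (above k w) l) = int (k + l)"
      using Y_after[OF k] A.Y_hitting_time[OF ex] by simp
    fix i assume i: "i < H w k + H (above k w) l"
    show "Y w i < int (k + l)"
    proof (cases "i < H w k")
      case True
      then show ?thesis using before_hitting_time[OF hit[of k], of i] by simp
    next
      case False
      then have "Y w i = int k + Y (above k w) (i - H w k)" using Y_after[OF k, of "i - H w k"] by simp
      then show ?thesis using A.before_hitting_time[OF ex, of "i - H w k"] i False by simp
    qed
  qed
qed

lemma H_mono: "k \<le> l \<Longrightarrow> H w k \<le> H w l"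
  using hit by (intro hitting_time_mono) auto

definition G :: "nat set" where
  "G = {k. stays (above k w)}"

definition next_G :: "nat \<Rightarrow> nat" where
  "next_G k = (LEAST l. k < l \<and> l \<in> G)"

lemma next_G:
  assumes "k < l" "l \<in> G"
  shows "k < next_G k" "next_G k \<in> G" "next_G k \<le> l"
  using LeastI[of "\<lambda>l. k < l \<and> l \<in> G", of l] Least_le[of "\<lambda>l. k < l \<and> l \<in> G" l] assms
  unfolding next_G_def by auto

lemma duration_above:
  "duration L (above k w) =
    (if k \<in> G \<and> (\<exists>l. k < l \<and> l \<le> k + L \<and> l \<in> G) then H w (next_G k) - H w k else 0)"
proof -
  have ex: "(\<exists>l. 0 < l \<and> l \<le> L \<and> stays (above (l + k) w)) \<longleftrightarrow> (\<exists>l. k < l \<and> l \<le> k + L \<and> l \<in> G)"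
  proof safe
    fix l assume "0 < l" "l \<le> L" "stays (above (l + k) w)"
    then show "\<exists>l. k < l \<and> l \<le> k + L \<and> l \<in> G" by (intro exI[of _ "l + k"]) (auto simp: G_def)
  next
    fix l assume "k < l" "l \<le> k + L" "l \<in> G"
    then show "\<exists>l. 0 < l \<and> l \<le> L \<and> stays (above (l + k) w)"
      by (intro exI[of _ "l - k"]) (auto simp: G_def)
  qed
  show ?thesis
  proof (cases "k \<in> G \<and> (\<exists>l. k < l \<and> l \<le> k + L \<and> l \<in> G)")
    case True
    then obtain l where l: "k < l" "l \<in> G" by blast
    let ?m = "LEAST m. 0 < m \<and> stays (above (m + k) w)"
    have "?m = next_G k - k"
    proof (rule Least_equality)
      show "0 < next_G k - k \<and> stays (above (next_G k - k + k) w)"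
        using next_G[OF l] by (auto simp: G_def)
      fix m assume m: "0 < m \<and> stays (above (m + k) w)"
      then have "next_G k \<le> m + k" by (intro next_G) (auto simp: G_def)
      then show "next_G k - k \<le> m" by simp
    qed
    then have "duration L (above k w) = H (above k w) (next_G k - k)"
      using True ex by (simp add: duration_def G_def)
    also have "\<dots> = H w (next_G k) - H w k"
      using H_add[of k "next_G k - k"] True next_G[OF l] by (simp add: G_def)
    finally show ?thesis using True by simp
  next
    case False
    then show ?thesis using ex by (auto simp: duration_def G_def)
  qed
qed

text \<open>The time intervals between consecutive regeneration levels are disjoint, over when level
  \<open>K + L\<close> is hit, and spent at nonnegative levels.\<close>

lemma sum_duration_le: "(\<Sum>k<K. duration L (above k w)) \<le> occupation (K + L)"
proof -
  define S where "S = {k. k < K \<and> k \<in> G \<and> (\<exists>l. k < l \<and> l \<le> k + L \<and> l \<in> G)}"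
  define I where "I k = {H w k..<H w (next_G k)}" for k
  have "(\<Sum>k<K. duration L (above k w)) = (\<Sum>k\<in>S. card (I k))"
    by (rule sum.mono_neutral_cong_right) (auto simp: S_def I_def duration_above)
  also have "\<dots> = card (\<Union>k\<in>S. I k)"
  proof (rule card_UN_disjoint[symmetric])
    have "I i \<inter> I j = {}" if "i < j" "i \<in> S" "j \<in> S" for i j
    proof -
      have "next_G i \<le> j" using that by (intro next_G) (auto simp: S_def)
      then have "H w (next_G i) \<le> H w j" by (rule H_mono)
      then show ?thesis by (auto simp: I_def)
    qed
    then show "\<forall>i\<in>S. \<forall>j\<in>S. i \<noteq> j \<longrightarrow> I i \<inter> I j = {}" by (metis Int_commute linorder_neq_iff)
  qed (auto simp: S_def I_def)
  also have "\<dots> \<le> card {n. n < H w (K + L) \<and> 0 \<le> Y w n}"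
  proof (rule card_mono)
    show "(\<Union>k\<in>S. I k) \<subseteq> {n. n < H w (K + L) \<and> 0 \<le> Y w n}"
    proof clarify
      fix k n assume k: "k \<in> S" and n: "n \<in> I k"
      obtain l where l: "k < l" "l \<le> k + L" "l \<in> G" using k by (auto simp: S_def)
      have "next_G k \<le> l" by (rule next_G) fact+
      also have "l \<le> K + L" using l k by (simp add: S_def)
      finally have "H w (next_G k) \<le> H w (K + L)" by (rule H_mono)
      moreover have "int k \<le> Y w n"
        using k n by (intro Y_after_ge) (auto simp: S_def I_def G_def)
      ultimately show "n < H w (K + L) \<and> 0 \<le> Y w n" using n by (auto simp: I_def)
    qed
  qed simp
  finally show ?thesis by (simp add: occupation_def)
qed

end

section \<open>Regeneration levels\<close>

context column_walk
begin

text \<open>The cut-off is set to the distance of the next regeneration level, so it has no effect.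
  In this form every gap is some \<open>duration L w\<close>, and bounds uniform in \<open>L\<close>
  carry over.\<close>

definition gap :: "('p, 's) columns \<Rightarrow> nat" where
  "gap w = duration (LEAST k. 0 < k \<and> stays (above k w)) w"

lemma gap_cong:
  assumes w: "\<And>j. 0 \<le> j \<Longrightarrow> w j = w' j"
  shows "gap w = gap w'"
proof -
  have 1: "duration L w = duration L w'" for L by (rule duration_cong) (rule w)
  have 2: "stays (above k w) = stays (above k w')" for k
    by (rule stays_cong) (simp add: above_def w)
  show ?thesis unfolding gap_def 1 2 ..
qed

lemma gap_eq_duration: "\<exists>L. gap w = duration L w"
  by (auto simp: gap_def)

end

context climbing_walk
begin

lemma transient:
  assumes "infinite G"
  shows "filterlim (\<lambda>n. real_of_int (Y w n)) at_top sequentially"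
  unfolding filterlim_at_top
proof
  fix Z :: real
  obtain m :: nat where m: "Z \<le> real m" using real_arch_simple by blast
  obtain k where k: "m \<le> k" "k \<in> G" using assms by (auto simp: infinite_nat_iff_unbounded_le)
  have "Z \<le> real_of_int (Y w n)" if "H w k \<le> n" for n
    using Y_after_ge[of k n] k m that by (simp add: G_def)
  then show "\<forall>\<^sub>F n in sequentially. Z \<le> real_of_int (Y w n)"
    by (auto simp: eventually_sequentially)
qed

lemma gap_above:
  assumes inf: "infinite G"
  shows "gap (above k w) = (if k \<in> G then H w (next_G k) - H w k else 0)"
proof -
  obtain l where l: "k < l" "l \<in> G" using inf by (auto simp: infinite_nat_iff_unbounded)
  note ng = next_G[OF l]
  have "(LEAST m. 0 < m \<and> stays (above m (above k w))) = next_G k - k"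
  proof (rule Least_equality)
    show "0 < next_G k - k \<and> stays (above (next_G k - k) (above k w))"
      using ng by (simp add: G_def)
    fix m assume m: "0 < m \<and> stays (above m (above k w))"
    have "next_G k \<le> m + k" by (rule next_G(3)) (use m in \<open>auto simp: G_def\<close>)
    then show "next_G k - k \<le> m" by simp
  qed
  moreover have "\<exists>l. k < l \<and> l \<le> k + (next_G k - k) \<and> l \<in> G"
    using ng by (intro exI[of _ "next_G k"]) simp
  ultimately show ?thesis unfolding gap_def by (simp add: duration_above)
qed

text \<open>Telescoping: off \<open>G\<close> the gaps vanish, and on \<open>G\<close> they are
  differences of consecutive hitting times.\<close>

lemma sum_gap:
  assumes inf: "infinite G" and k0: "k0 \<in> G" "\<And>k. k < k0 \<Longrightarrow> k \<notin> G"
  shows "K \<in> G \<Longrightarrow> H w K = H w k0 + (\<Sum>k<K. gap (above k w))"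
proof (induction K rule: less_induct)
  case (less K)
  show ?case
  proof (cases "K = k0")
    case True
    have "(\<Sum>k<K. gap (above k w)) = 0" using True k0(2) by (simp add: gap_above[OF inf])
    then show ?thesis using True by simp
  next
    case False
    then have K: "k0 < K" using k0(2) less.prems by (meson linorder_neqE_nat)
    define k where "k = Max {k \<in> G. k < K}"
    have fin: "finite {k \<in> G. k < K}" by simp
    have kin: "k \<in> {k \<in> G. k < K}" unfolding k_def using K k0(1) by (intro Max_in fin) auto
    have kmax: "i \<le> k" if "i \<in> G" "i < K" for i unfolding k_def using that by (intro Max_ge fin) auto
    have nk: "next_G k = K"
    proof -
      have "k < next_G k" "next_G k \<in> G" "next_G k \<le> K"
        using next_G[of k K] kin less.prems by auto
      then show ?thesis using kmax[of "next_G k"] by fastforce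
    qed
    have le: "H w k \<le> H w K" using kin by (intro H_mono) auto
    have "gap (above i w) = 0" if "i < K" "\<not> i < k" "i \<noteq> k" for i
      using kmax[of i] that by (auto simp: gap_above[OF inf])
    then have "(\<Sum>i<K. gap (above i w)) = (\<Sum>i\<in>{..<k} \<union> {k}. gap (above i w))"
      using kin by (intro sum.mono_neutral_right) auto
    also have "\<dots> = (\<Sum>i<k. gap (above i w)) + gap (above k w)" by simp
    also have "gap (above k w) = H w K - H w k" using kin nk by (simp add: gap_above[OF inf])
    finally show ?thesis using less.IH[of k] kin le by simp
  qed
qed

text \<open>Inversion from levels to times. At time \<open>n\<close> the walk is between the last
  regeneration level \<open>\<kappa> n\<close> hit so far and the next one
  \<open>\<kappa>' n\<close>, and the hitting time of either is about \<open>c\<close> times the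
  level. The counts of regeneration levels below the two differ by one, so the positive density
  \<open>p\<close> forces \<open>\<kappa>' n / \<kappa> n\<close> to tend to 1.\<close>

lemma speed:
  assumes c: "(\<lambda>K. (\<Sum>k<K. real (gap (above k w))) / real K) \<longlonglongrightarrow> c"
    and p: "(\<lambda>K. (\<Sum>k<K. of_bool (stays (above k w))) / real K) \<longlonglongrightarrow> p" "0 < p"
    and inf: "infinite G"
  shows "0 < c" and "(\<lambda>n. real_of_int (Y w n) / real n) \<longlonglongrightarrow> 1 / c"
proof -
  define k0 where "k0 = (LEAST k. k \<in> G)"
  have "\<exists>k. k \<in> G" using inf by (metis infinite_imp_nonempty ex_in_conv)
  then have k0: "k0 \<in> G" unfolding k0_def by (rule LeastI_ex)
  have k0_min: "k \<notin> G" if "k < k0" for k using that not_less_Least unfolding k0_def by blast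
  define S where "S K = (\<Sum>k<K. real (gap (above k w)))" for K
  define R where "R K = (\<Sum>k<K. of_bool (stays (above k w)) :: real)" for K
  have HS: "real (H w k) = real (H w k0) + S k" if "k \<in> G" for k
    using sum_gap[OF inf k0 k0_min that] by (simp add: S_def)
  define \<kappa> where "\<kappa> n = Max {k \<in> G. H w k \<le> n}" for n
  define \<kappa>' where "\<kappa>' n = next_G (\<kappa> n)" for n
  have fin: "finite {k \<in> G. H w k \<le> n}" for n
  proof (rule finite_subset)
    show "{k \<in> G. H w k \<le> n} \<subseteq> {..n}" using hitting_time_ge[OF hit] by (auto intro: order_trans)
  qed simp
  have \<kappa>: "\<kappa> n \<in> G" "H w (\<kappa> n) \<le> n" if "H w k0 \<le> n" for n
  proof -
    have "\<kappa> n \<in> {k \<in> G. H w k \<le> n}" unfolding \<kappa>_def using that k0 by (intro Max_in fin) auto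
    then show "\<kappa> n \<in> G" "H w (\<kappa> n) \<le> n" by auto
  qed
  have \<kappa>_ge: "k \<le> \<kappa> n" if "k \<in> G" "H w k \<le> n" for k n
    unfolding \<kappa>_def using that by (intro Max_ge fin) auto
  have \<kappa>': "\<kappa> n < \<kappa>' n" "\<kappa>' n \<in> G" for n
  proof -
    obtain l where "\<kappa> n < l" "l \<in> G" using inf by (auto simp: infinite_nat_iff_unbounded)
    from next_G[OF this] show "\<kappa> n < \<kappa>' n" "\<kappa>' n \<in> G" by (auto simp: \<kappa>'_def)
  qed
  have next_H: "n < H w (\<kappa>' n)" for n
  proof (rule ccontr)
    assume "\<not> ?thesis"
    then have "\<kappa>' n \<le> \<kappa> n" using \<kappa>'(2)[of n] by (intro \<kappa>_ge) auto
    then show False using \<kappa>'(1)[of n] by simp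
  qed
  have Y_bounds: "int (\<kappa> n) \<le> Y w n" "Y w n \<le> int (\<kappa>' n)" if n: "H w k0 \<le> n" for n
    using \<kappa>[OF n] before_hitting_time[OF hit next_H[of n]]
    by (auto simp: G_def intro!: Y_after_ge)
  have \<kappa>_top: "filterlim \<kappa> at_top sequentially"
    unfolding filterlim_at_top
  proof
    fix m
    obtain k where k: "m \<le> k" "k \<in> G" using inf by (auto simp: infinite_nat_iff_unbounded_le)
    have "m \<le> \<kappa> n" if "H w k \<le> n" for n using \<kappa>_ge[OF k(2) that] k(1) by simp
    then show "\<forall>\<^sub>F n in sequentially. m \<le> \<kappa> n" by (auto simp: eventually_sequentially)
  qed
  have \<kappa>'_top: "filterlim \<kappa>' at_top sequentially"
    by (rule filterlim_at_top_mono[OF \<kappa>_top]) (use \<kappa>'(1) in \<open>auto intro!: always_eventually less_imp_le\<close>)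
  have real_top: "filterlim (\<lambda>n. real (f n)) at_top sequentially"
    if "filterlim f at_top sequentially" for f :: "nat \<Rightarrow> nat"
    using filterlim_compose[OF filterlim_real_sequentially that] .
  have SH: "(\<lambda>n. real (H w (f n)) / real (f n)) \<longlonglongrightarrow> c"
    if f: "filterlim f at_top sequentially" and fG: "\<forall>\<^sub>F n in sequentially. f n \<in> G" for f
  proof -
    have "(\<lambda>n. real (H w k0) / real (f n)) \<longlonglongrightarrow> 0"
      by (rule tendsto_divide_0[OF tendsto_const filterlim_at_top_imp_at_infinity[OF real_top[OF f]]])
    moreover have "(\<lambda>n. S (f n) / real (f n)) \<longlonglongrightarrow> c"
      using filterlim_compose[OF c f] by (simp add: S_def)
    ultimately have "(\<lambda>n. real (H w k0) / real (f n) + S (f n) / real (f n)) \<longlonglongrightarrow> 0 + c"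
      by (rule tendsto_add)
    moreover have "\<forall>\<^sub>F n in sequentially.
        real (H w k0) / real (f n) + S (f n) / real (f n) = real (H w (f n)) / real (f n)"
      using fG by eventually_elim (simp add: HS add_divide_distrib)
    ultimately show ?thesis by (simp add: tendsto_cong)
  qed
  have ev: "\<forall>\<^sub>F n in sequentially. H w k0 \<le> n \<and> 0 < \<kappa> n"
    using eventually_ge_at_top[of "H w k0"] \<kappa>_top[unfolded filterlim_at_top, rule_format, of 1]
    by eventually_elim auto
  have SH\<kappa>: "(\<lambda>n. real (H w (\<kappa> n)) / real (\<kappa> n)) \<longlonglongrightarrow> c"
    by (rule SH[OF \<kappa>_top]) (use ev in \<open>eventually_elim, auto intro: \<kappa>\<close>)
  have SH\<kappa>': "(\<lambda>n. real (H w (\<kappa>' n)) / real (\<kappa>' n)) \<longlonglongrightarrow> c"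
    by (rule SH[OF \<kappa>'_top]) (simp add: \<kappa>')
  have "1 \<le> c"
  proof (rule tendsto_lowerbound[OF SH\<kappa>'])
    have "1 \<le> real (H w (\<kappa>' n)) / real (\<kappa>' n)" for n
      using \<kappa>'(1)[of n] hitting_time_ge[OF hit, of "\<kappa>' n"] by (simp add: le_divide_eq)
    then show "\<forall>\<^sub>F n in sequentially. 1 \<le> real (H w (\<kappa>' n)) / real (\<kappa>' n)" by simp
  qed simp
  then show c0: "0 < c" by simp
  have R_next: "R (\<kappa>' n) = R (\<kappa> n) + 1" if n: "H w k0 \<le> n" for n
  proof -
    have "\<not> stays (above i w)" if "\<kappa> n < i" "i < \<kappa>' n" for i
      using next_G(3)[of "\<kappa> n" i] that by (auto simp: \<kappa>'_def G_def)
    then have "R (\<kappa>' n) = (\<Sum>i\<in>{..<\<kappa> n} \<union> {\<kappa> n}. of_bool (stays (above i w)))"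
      unfolding R_def using \<kappa>'(1)[of n]
      by (intro sum.mono_neutral_right) (auto simp: not_less)
    also have "\<dots> = R (\<kappa> n) + 1" using \<kappa>(1)[OF n] by (simp add: R_def G_def)
    finally show ?thesis .
  qed
  have ratio: "(\<lambda>n. real (\<kappa>' n) / real (\<kappa> n)) \<longlonglongrightarrow> 1"
  proof -
    have 1: "(\<lambda>n. 1 / real (\<kappa> n)) \<longlonglongrightarrow> 0"
      by (rule tendsto_divide_0[OF tendsto_const filterlim_at_top_imp_at_infinity[OF real_top[OF \<kappa>_top]]])
    have 2: "(\<lambda>n. R (\<kappa> n) / real (\<kappa> n)) \<longlonglongrightarrow> p"
      using filterlim_compose[OF p(1) \<kappa>_top] by (simp add: R_def)
    have 3: "(\<lambda>n. R (\<kappa>' n) / real (\<kappa>' n)) \<longlonglongrightarrow> p"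
      using filterlim_compose[OF p(1) \<kappa>'_top] by (simp add: R_def)
    have "(\<lambda>n. (R (\<kappa> n) / real (\<kappa> n) + 1 / real (\<kappa> n)) / (R (\<kappa>' n) / real (\<kappa>' n))) \<longlonglongrightarrow> (p + 0) / p"
      by (intro tendsto_divide tendsto_add 1 2 3) (use p(2) in simp)
    moreover have "\<forall>\<^sub>F n in sequentially. (R (\<kappa> n) / real (\<kappa> n) + 1 / real (\<kappa> n)) / (R (\<kappa>' n) / real (\<kappa>' n)) =
        real (\<kappa>' n) / real (\<kappa> n)"
      using ev
    proof eventually_elim
      case (elim n)
      have "0 \<le> R (\<kappa> n)" unfolding R_def by (intro sum_nonneg) simp
      then have "R (\<kappa>' n) \<noteq> 0" using R_next[of n] elim by simp
      moreover have "R (\<kappa> n) / real (\<kappa> n) + 1 / real (\<kappa> n) = R (\<kappa>' n) / real (\<kappa> n)"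
        using R_next[of n] elim by (simp add: add_divide_distrib)
      ultimately show ?case using \<kappa>'(1)[of n] by (simp add: field_simps)
    qed
    ultimately show ?thesis using p(2) by (simp add: tendsto_cong)
  qed
  show "(\<lambda>n. real_of_int (Y w n) / real n) \<longlonglongrightarrow> 1 / c"
  proof (rule tendsto_sandwich)
    show "(\<lambda>n. 1 / (real (\<kappa>' n) / real (\<kappa> n)) * (1 / (real (H w (\<kappa>' n)) / real (\<kappa>' n)))) \<longlonglongrightarrow> 1 / c"
      by (rule tendsto_eq_rhs[of _ "1 / 1 * (1 / c)"])
        (intro tendsto_mult tendsto_divide tendsto_const ratio SH\<kappa>', use c0 in auto)
    show "(\<lambda>n. real (\<kappa>' n) / real (\<kappa> n) * (1 / (real (H w (\<kappa> n)) / real (\<kappa> n)))) \<longlonglongrightarrow> 1 / c"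
      by (rule tendsto_eq_rhs[of _ "1 * (1 / c)"])
        (intro tendsto_mult tendsto_divide tendsto_const ratio SH\<kappa>, use c0 in auto)
    show "\<forall>\<^sub>F n in sequentially. 1 / (real (\<kappa>' n) / real (\<kappa> n)) * (1 / (real (H w (\<kappa>' n)) / real (\<kappa>' n)))
        \<le> real_of_int (Y w n) / real n"
      using ev eventually_gt_at_top[of 0]
    proof eventually_elim
      case (elim n)
      have "1 / (real (\<kappa>' n) / real (\<kappa> n)) * (1 / (real (H w (\<kappa>' n)) / real (\<kappa>' n))) = real (\<kappa> n) / real (H w (\<kappa>' n))"
        using elim \<kappa>'(1)[of n] by simp
      also have "\<dots> \<le> real_of_int (Y w n) / real n"
        using elim Y_bounds(1)[of n] next_H[of n] by (intro frac_le) auto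
      finally show ?case .
    qed
    show "\<forall>\<^sub>F n in sequentially. real_of_int (Y w n) / real n
        \<le> real (\<kappa>' n) / real (\<kappa> n) * (1 / (real (H w (\<kappa> n)) / real (\<kappa> n)))"
      using ev eventually_gt_at_top[of 0]
    proof eventually_elim
      case (elim n)
      have "0 < H w (\<kappa> n)" using hitting_time_ge[OF hit, of "\<kappa> n"] elim by simp
      then have "real_of_int (Y w n) / real n \<le> real (\<kappa>' n) / real (H w (\<kappa> n))"
        using elim Y_bounds(2)[of n] \<kappa>(2)[of n] by (intro frac_le) auto
      also have "\<dots> = real (\<kappa>' n) / real (\<kappa> n) * (1 / (real (H w (\<kappa> n)) / real (\<kappa> n)))"
        using elim by simp
      finally show ?case .
    qed
  qed
qed

end

section \<open>Sampling a step\<close>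

text \<open>Inverse distribution function along a list. The last entry takes every remaining
  \<open>u\<close>, so on a nonempty list an entry results for all \<open>f\<close> and
  \<open>u\<close>, and the walk makes unit steps whatever the cells contain.\<close>

primrec pick :: "('x \<Rightarrow> real) \<Rightarrow> 'x list \<Rightarrow> real \<Rightarrow> 'x" where
  "pick f [] u = undefined"
| "pick f (x # xs) u = (if u \<le> f x \<or> xs = [] then x else pick f xs (u - f x))"

lemma pick_in: "xs \<noteq> [] \<Longrightarrow> pick f xs u \<in> set xs"
  by (induction xs arbitrary: u) auto

lemma pick_append:
  "\<lbrakk>xs \<noteq> []; u \<le> sum_list (map f xs)\<rbrakk> \<Longrightarrow> pick f (xs @ ys) u \<in> set xs"
proof (induction xs arbitrary: u)
  case (Cons x xs)
  show ?case
  proof (cases "u \<le> f x \<or> xs = []")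
    case False
    then show ?thesis using Cons by auto
  qed (use Cons.prems in auto)
qed simp

text \<open>The list cuts the seeds into consecutive half-open intervals whose lengths are the
  weights; so a uniform seed selects each entry with its weight.\<close>

lemma pick_interval:
  assumes "distinct xs" "x \<in> set xs" "\<And>y. 0 \<le> f y"
  shows "\<exists>l\<ge>0. {u. 0 < u \<and> u \<le> sum_list (map f xs) \<and> pick f xs u = x} = {l<..l + f x}"
  using assms(1,2)
proof (induction xs)
  case (Cons y ys)
  have nonneg: "0 \<le> sum_list (map f ys)" using assms(3) by (intro sum_list_nonneg) auto
  show ?case
  proof (cases "x = y")
    case True
    have "pick f (y # ys) u = y \<longleftrightarrow> u \<le> f y" if "0 < u" "u \<le> f y + sum_list (map f ys)" for u
      using that Cons.prems pick_in[of ys f "u - f y"] by auto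
    then have "0 < u \<and> u \<le> sum_list (map f (y # ys)) \<and> pick f (y # ys) u = x \<longleftrightarrow>
        0 < u \<and> u \<le> 0 + f x" for u
      using nonneg True by (auto simp del: pick.simps)
    then have "{u. 0 < u \<and> u \<le> sum_list (map f (y # ys)) \<and> pick f (y # ys) u = x} = {0<..0 + f x}"
      unfolding greaterThanAtMost_def greaterThan_def atMost_def by blast
    then show ?thesis by blast
  next
    case False
    then have x: "x \<in> set ys" using Cons.prems by simp
    then obtain l where l: "0 \<le> l"
      "{u. 0 < u \<and> u \<le> sum_list (map f ys) \<and> pick f ys u = x} = {l<..l + f x}"
      using Cons by auto
    have *: "0 < u \<and> u \<le> sum_list (map f ys) \<and> pick f ys u = x \<longleftrightarrow> l < u \<and> u \<le> l + f x" for u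
      using l(2)[unfolded set_eq_iff, rule_format, of u] by simp
    have "0 < u \<and> u \<le> sum_list (map f (y # ys)) \<and> pick f (y # ys) u = x \<longleftrightarrow>
        l + f y < u \<and> u \<le> l + f y + f x" for u
    proof (cases "u \<le> f y")
      case True
      then show ?thesis using False l(1) by auto
    next
      case u: False
      moreover have "0 \<le> f y" by (rule assms(3))
      ultimately show ?thesis using *[of "u - f y"] x by auto
    qed
    then have "{u. 0 < u \<and> u \<le> sum_list (map f (y # ys)) \<and> pick f (y # ys) u = x} =
        {l + f y<..l + f y + f x}"
      unfolding greaterThanAtMost_def greaterThan_def atMost_def by blast
    then show ?thesis using l(1) assms(3)[of y] by (intro exI[of _ "l + f y"]) auto
  qed
qed simp

lemma measurable_pick [measurable (raw)]:
  fixes f :: "'a \<Rightarrow> 'x \<Rightarrow> real"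
  assumes "\<And>x. (\<lambda>w. f w x) \<in> borel_measurable N" "u \<in> borel_measurable N"
  shows "(\<lambda>w. pick (f w) xs (u w)) \<in> N \<rightarrow>\<^sub>M count_space UNIV"
  using assms(2)
proof (induction xs arbitrary: u)
  case (Cons x xs)
  note [measurable] = assms(1) Cons.prems Cons.IH[of "\<lambda>w. u w - f w x"]
  show ?case by simp
qed simp

definition up_list :: "(int ^ 'd) list" where
  "up_list = (SOME xs. distinct xs \<and> set xs = range (\<lambda>i. axis i 1))"

lemma up_list: "distinct (up_list :: (int ^ 'd) list)" "set up_list = range (\<lambda>i :: 'd. axis i (1::int))"
proof -
  have "\<exists>xs. distinct xs \<and> set xs = range (\<lambda>i :: 'd. axis i (1::int))"
    using finite_distinct_list[of "range (\<lambda>i :: 'd. axis i (1::int))"] by auto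
  from someI_ex[OF this] show "distinct (up_list :: (int ^ 'd) list)"
    "set up_list = range (\<lambda>i :: 'd. axis i (1::int))"
    by (auto simp: up_list_def)
qed

text \<open>The upward steps come first, so that small seeds lead upwards.\<close>

definition dirs :: "(int ^ 'd) list" where
  "dirs = up_list @ map uminus up_list"

lemma level_axis [simp]: "level (axis i 1) = 1"
  by (simp add: level_def axis_def)

lemma level_uminus [simp]: "level (- x) = - level x"
  by (simp add: level_def sum_negf)

lemma level_up: "x \<in> set up_list \<Longrightarrow> level x = 1"
  by (auto simp: up_list)

lemma set_dirs: "set dirs = unit_vectors"
  by (auto simp: dirs_def up_list unit_vectors_def image_iff)

lemma distinct_dirs: "distinct dirs"
proof -
  have "distinct (map uminus up_list)" using up_list(1) by (simp add: distinct_map)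
  moreover have "x \<notin> set (map uminus up_list)" if "x \<in> set up_list" for x
    using level_up[OF that] level_up[of "- x"] by auto
  ultimately show ?thesis using up_list(1) by (auto simp: dirs_def)
qed

lemma up_list_not_Nil: "up_list \<noteq> []"
  using up_list(2) by (metis empty_is_image empty_not_UNIV empty_set)

lemma finite_unit_vectors: "finite unit_vectors"
  by (simp add: unit_vectors_def)

definition sample :: "(int ^ 'd) measure \<Rightarrow> real \<Rightarrow> int ^ 'd" where
  "sample p u = pick (\<lambda>e. measure p {e}) dirs u"

lemma level_sample: "level (sample p u) = 1 \<or> level (sample p u) = - 1"
proof -
  have "sample p u \<in> set dirs" unfolding sample_def by (rule pick_in) (simp add: dirs_def up_list_not_Nil)
  then show ?thesis using level_up by (auto simp: dirs_def)
qed

definition seeds :: "real measure" where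
  "seeds = uniform_measure lborel {0<..1}"

lemma sets_seeds [simp, measurable_cong]: "sets seeds = sets borel"
  by (simp add: seeds_def)

lemma space_seeds [simp]: "space seeds = UNIV"
  by (simp add: seeds_def)

lemma prob_space_seeds: "prob_space seeds"
  unfolding seeds_def by (rule prob_space_uniform_measure) auto

lemma emeasure_seeds: "A \<in> sets borel \<Longrightarrow> emeasure seeds A = emeasure lborel ({0<..1} \<inter> A)"
  by (simp add: seeds_def divide_ennreal_def)

lemma measure_seeds_le:
  assumes "0 \<le> t" "t \<le> 1"
  shows "measure seeds {u. u \<le> t} = t"
proof -
  have "{0<..1} \<inter> {u. u \<le> t} = {0<..t}" using assms by auto
  then show ?thesis using assms by (simp add: measure_def emeasure_seeds)
qed

lemma drift_eq: "drift p \<bullet> diagonal = (\<Sum>i\<in>UNIV. measure p {axis i 1} - measure p {- axis i 1})"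
proof -
  have "diagonal $ i = 1" for i :: 'a
    by (simp add: diagonal_def axis_def)
  then show ?thesis by (simp add: drift_def inner_vec_def)
qed

lemma sum_list_up: "sum_list (map f (up_list :: (int ^ 'd) list)) = (\<Sum>i\<in>UNIV. f (axis (i :: 'd) 1) :: real)"
proof -
  have "sum_list (map f (up_list :: (int ^ 'd) list)) = (\<Sum>x\<in>set up_list. f x)"
    by (rule sum_list_distinct_conv_sum_set) (rule up_list)
  also have "\<dots> = (\<Sum>i\<in>UNIV. f (axis (i :: 'd) 1))"
    unfolding up_list(2) by (subst sum.reindex) (auto simp: inj_on_def axis_eq_axis)
  finally show ?thesis .
qed

lemma sum_list_down:
  "sum_list (map f (map uminus (up_list :: (int ^ 'd) list))) = (\<Sum>i\<in>UNIV. f (- axis (i :: 'd) 1) :: real)"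
  using sum_list_up[of "\<lambda>x. f (- x)"] by (simp add: o_def)

context
  fixes p :: "(int ^ 'd) measure"
  assumes p: "p \<in> space transition_laws"
begin

lemma sets_law: "sets p = Pow unit_vectors" and prob_law: "prob_space p"
  using p by (auto simp: transition_laws_iff)

lemma space_law: "space p = unit_vectors"
  using sets_eq_imp_space_eq[of p "count_space unit_vectors"] sets_law by simp

lemma sum_list_law: "sum_list (map (\<lambda>e. measure p {e}) dirs) = 1"
proof -
  interpret prob_space p by (rule prob_law)
  have "sum_list (map (\<lambda>e. measure p {e}) dirs) = (\<Sum>e\<in>unit_vectors. measure p {e})"
    using sum_list_distinct_conv_sum_set[OF distinct_dirs] set_dirs by metis
  also have "\<dots> = measure p unit_vectors"
    using finite_unit_vectors sets_law
    by (intro finite_measure_eq_sum_singleton[symmetric]) auto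
  finally show ?thesis using prob_space by (simp add: space_law)
qed

text \<open>The masses of the upward and downward vectors add up to 1 and differ by the
  drift.\<close>

lemma sum_list_up_drift: "sum_list (map (\<lambda>e. measure p {e}) up_list) = (1 + drift p \<bullet> diagonal) / 2"
  using sum_list_law sum_list_up[of "\<lambda>e. measure p {e}"] sum_list_down[of "\<lambda>e. measure p {e}"]
  by (simp add: drift_eq dirs_def sum_subtractf)

lemma level_sample_up:
  assumes "u \<le> (1 + drift p \<bullet> diagonal) / 2"
  shows "level (sample p u) = 1"
proof (rule level_up)
  show "sample p u \<in> set up_list"
    unfolding sample_def dirs_def
    by (rule pick_append[OF up_list_not_Nil]) (use assms sum_list_up_drift in simp)
qed

lemma drift_le_1: "drift p \<bullet> diagonal \<le> 1"
proof -
  have *: "0 \<le> y \<Longrightarrow> x + y = 1 \<Longrightarrow> x = (1 + z) / 2 \<Longrightarrow> z \<le> 1" for x y z :: real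
    by (auto simp: field_simps)
  have "0 \<le> sum_list (map (\<lambda>e. measure p {e}) (map uminus up_list))"
    by (intro sum_list_nonneg) auto
  then show ?thesis
    using sum_list_law[unfolded dirs_def map_append sum_list_append] sum_list_up_drift by (rule *)
qed

lemma emeasure_sample: "emeasure seeds {u. sample p u = e} = emeasure p {e}"
proof (cases "e \<in> unit_vectors")
  case True
  interpret prob_space p by (rule prob_law)
  have "(\<lambda>u. sample p u) \<in> borel \<rightarrow>\<^sub>M count_space UNIV" unfolding sample_def by measurable
  then have "{u \<in> space borel. sample p u = e} \<in> sets borel" by measurable
  then have meas: "{u. sample p u = e} \<in> sets borel" by simp
  have "\<exists>l\<ge>0. {u. 0 < u \<and> u \<le> 1 \<and> sample p u = e} = {l<..l + measure p {e}}"
    using pick_interval[of dirs e "\<lambda>e. measure p {e}"] distinct_dirs True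
    by (simp add: sum_list_law set_dirs sample_def)
  moreover have "{0<..1} \<inter> {u. sample p u = e} = {u. 0 < u \<and> u \<le> 1 \<and> sample p u = e}" by auto
  ultimately obtain l where "{0<..1} \<inter> {u. sample p u = e} = {l<..l + measure p {e}}" by auto
  then show ?thesis using meas by (simp add: emeasure_seeds emeasure_eq_measure)
next
  case False
  have "sample p u \<in> set dirs" for u
    unfolding sample_def by (rule pick_in) (simp add: dirs_def up_list_not_Nil)
  then have "{u. sample p u = e} = {}" using False by (auto simp: set_dirs)
  then show ?thesis using False sets_law by (simp add: emeasure_notin_sets)
qed

end

section \<open>The walk has the annealed law\<close>

locale rwre =
  fixes \<mu> :: "(int ^ 'd) measure measure" and a b :: real
  assumes prob_\<mu>: "prob_space \<mu>" and sets_\<mu>: "sets \<mu> = sets transition_laws"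
    and drift_nonneg: "measure \<mu> {p \<in> space \<mu>. drift p \<bullet> diagonal \<ge> 0} = 1"
    and drift_ge: "measure \<mu> {p \<in> space \<mu>. drift p \<bullet> diagonal \<ge> a} = b"
    and a_pos: "0 < a" and b_pos: "0 < b"
begin

definition "cell = \<mu> \<Otimes>\<^sub>M seeds"

definition "column_law = PiM (UNIV :: nat set) (\<lambda>_. cell)"

definition "env = PiM (UNIV :: int set) (\<lambda>_. column_law)"

sublocale column_walk sample
  by unfold_locales (rule level_sample)

sublocale \<mu>: prob_space \<mu> by (rule prob_\<mu>)

sublocale seeds: prob_space seeds by (rule prob_space_seeds)

sublocale cell: prob_space cell
  unfolding cell_def by (intro prob_space_pair prob_\<mu> prob_space_seeds)

sublocale column_law: prob_space column_law
  unfolding column_law_def by (rule prob_space_PiM) (rule cell.prob_space_axioms)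

sublocale env: prob_space env
  unfolding env_def by (rule prob_space_PiM) (rule column_law.prob_space_axioms)

lemma space_\<mu>: "space \<mu> = space transition_laws"
  using sets_\<mu> by (rule sets_eq_imp_space_eq)

lemma measurable_law_measure [measurable]: "(\<lambda>p. measure p {e}) \<in> borel_measurable \<mu>"
proof (cases "e \<in> unit_vectors")
  case True
  have "(\<lambda>p. measure p {e}) \<in> borel_measurable transition_laws"
    unfolding transition_laws_def using True by (intro measurable_measure_prob_algebra) auto
  then show ?thesis by (simp add: measurable_cong_sets[OF sets_\<mu> refl])
next
  case False
  have "measure p {e} = 0" if "p \<in> space \<mu>" for p
    using that False by (auto simp: space_\<mu> transition_laws_iff measure_notin_sets)
  then show ?thesis by (subst measurable_cong[where g = "\<lambda>_. 0"]) auto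
qed

lemma measurable_law_emeasure [measurable]: "(\<lambda>p. emeasure p {e}) \<in> borel_measurable \<mu>"
proof -
  have "emeasure p {e} = ennreal (measure p {e})" if "p \<in> space \<mu>" for p
  proof -
    interpret prob_space p using that by (auto simp: space_\<mu> transition_laws_iff)
    show ?thesis by (rule emeasure_eq_measure)
  qed
  then show ?thesis by (subst measurable_cong[where g = "\<lambda>p. ennreal (measure p {e})"]) auto
qed

lemma measurable_drift [measurable]: "(\<lambda>p. drift p \<bullet> diagonal) \<in> borel_measurable \<mu>"
  unfolding drift_eq by measurable

lemma measurable_sample [measurable]: "(\<lambda>v. sample (fst v) (snd v)) \<in> cell \<rightarrow>\<^sub>M count_space UNIV"
  unfolding sample_def cell_def by measurable

lemma measurable_fst_cell [measurable]: "fst \<in> cell \<rightarrow>\<^sub>M \<mu>" and measurable_snd_cell [measurable]: "snd \<in> cell \<rightarrow>\<^sub>M seeds"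
  unfolding cell_def by measurable

lemma measurable_column_cell [measurable]: "(\<lambda>c. c i) \<in> column_law \<rightarrow>\<^sub>M cell"
  unfolding column_law_def by measurable

lemma measurable_env_column [measurable]: "(\<lambda>w. w j) \<in> env \<rightarrow>\<^sub>M column_law"
  unfolding env_def by measurable

lemma measurable_env_cell [measurable]: "(\<lambda>w. w j i) \<in> env \<rightarrow>\<^sub>M cell"
  by (rule measurable_compose[OF measurable_env_column measurable_column_cell])

lemma env_law: "w \<in> space env \<Longrightarrow> fst (w j i) \<in> space transition_laws"
  using measurable_space[OF measurable_env_cell] measurable_space[OF measurable_fst_cell]
  by (metis space_\<mu>)

lemma measurable_sample_env [measurable]:
  "(\<lambda>w. sample (fst (w j r)) (snd (w j v))) \<in> env \<rightarrow>\<^sub>M count_space UNIV"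
proof -
  have "(\<lambda>w. (fst (w j r), snd (w j v))) \<in> env \<rightarrow>\<^sub>M cell"
    unfolding cell_def
    by (intro measurable_Pair measurable_compose[OF measurable_env_cell measurable_fst_cell]
      measurable_compose[OF measurable_env_cell measurable_snd_cell])
  from measurable_compose[OF this measurable_sample] show ?thesis by simp
qed

lemma measurable_history [measurable]: "(\<lambda>w. history w n) \<in> env \<rightarrow>\<^sub>M count_space UNIV"
proof (induction n)
  case (Suc n)
  have "(\<lambda>w. succ w h # h) \<in> env \<rightarrow>\<^sub>M count_space UNIV" for h
    unfolding succ_def by measurable
  from measurable_compose_countable[OF this Suc] show ?case by simp
qed simp

lemma measurable_X [measurable]: "(\<lambda>w. X w n) \<in> env \<rightarrow>\<^sub>M count_space UNIV"
  unfolding X_def by measurable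

lemma measurable_Y [measurable]: "(\<lambda>w. Y w n) \<in> env \<rightarrow>\<^sub>M count_space UNIV"
  unfolding Y_def by measurable

section \<open>Redrawing a cell, or only its seed\<close>

definition upd :: "(int \<Rightarrow> nat \<Rightarrow> 'x) \<Rightarrow> int \<Rightarrow> nat \<Rightarrow> 'x \<Rightarrow> int \<Rightarrow> nat \<Rightarrow> 'x" where
  "upd f j i v = f(j := (f j)(i := v))"

lemma measurable_upd: "(\<lambda>p. upd (fst p) j i (snd p)) \<in> env \<Otimes>\<^sub>M cell \<rightarrow>\<^sub>M env"
proof -
  have "(\<lambda>p. (fst p j)(i := snd p)) \<in> env \<Otimes>\<^sub>M cell \<rightarrow>\<^sub>M column_law"
    unfolding column_law_def
  proof (rule measurable_fun_upd[where J = UNIV])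
    show "(\<lambda>p. fst p j) \<in> env \<Otimes>\<^sub>M cell \<rightarrow>\<^sub>M PiM UNIV (\<lambda>_. cell)"
      using measurable_compose[OF measurable_fst measurable_env_column] by (simp add: column_law_def)
  qed auto
  then show ?thesis
    unfolding upd_def
    by (subst (2) env_def, intro measurable_fun_upd[where J = UNIV]) (auto simp: env_def)
qed

lemma nn_integral_resample_cell:
  assumes F [measurable]: "F \<in> borel_measurable env"
  shows "(\<integral>\<^sup>+w. F w \<partial>env) = (\<integral>\<^sup>+w. (\<integral>\<^sup>+v. F (upd w j i v) \<partial>cell) \<partial>env)"
proof -
  note [measurable] = measurable_upd
  define K where "K w = (\<integral>\<^sup>+v. F (upd w j i v) \<partial>cell)" for w
  have K [measurable]: "K \<in> borel_measurable env"
    unfolding K_def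
    by (rule cell.borel_measurable_nn_integral)
      (use measurable_compose[OF measurable_upd F] in \<open>simp add: case_prod_beta'\<close>)
  have col: "(\<lambda>c. fun_upd w j c) \<in> column_law \<rightarrow>\<^sub>M env" if "w \<in> space env" for w
    using that unfolding env_def by (intro measurable_fun_upd[where J = UNIV]) auto
  have inner: "(\<integral>\<^sup>+c. K (fun_upd w j c) \<partial>column_law) = (\<integral>\<^sup>+c. F (fun_upd w j c) \<partial>column_law)"
    if "w \<in> space env" for w
  proof -
    have "(\<lambda>c. F (fun_upd w j c)) \<in> borel_measurable column_law"
      by (rule measurable_compose[OF col[OF that] F])
    then have "(\<integral>\<^sup>+c. F (fun_upd w j c) \<partial>column_law) =
        (\<integral>\<^sup>+c. (\<integral>\<^sup>+v. F (fun_upd w j (c(i := v))) \<partial>cell) \<partial>column_law)"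
      unfolding column_law_def
      by (intro nn_integral_PiM_resample) (auto intro: cell.prob_space_axioms)
    then show ?thesis by (simp add: K_def upd_def)
  qed
  have "(\<integral>\<^sup>+w. K w \<partial>env) = (\<integral>\<^sup>+w. (\<integral>\<^sup>+c. K (fun_upd w j c) \<partial>column_law) \<partial>env)"
    using K unfolding env_def by (intro nn_integral_PiM_resample) (auto intro: column_law.prob_space_axioms)
  also have "\<dots> = (\<integral>\<^sup>+w. (\<integral>\<^sup>+c. F (fun_upd w j c) \<partial>column_law) \<partial>env)"
    by (intro nn_integral_cong inner)
  also have "\<dots> = (\<integral>\<^sup>+w. F w \<partial>env)"
    using F unfolding env_def
    by (intro nn_integral_PiM_resample[symmetric]) (auto intro: column_law.prob_space_axioms)
  finally show ?thesis by (simp add: K_def)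
qed

lemma nn_integral_cell:
  assumes "F \<in> borel_measurable cell"
  shows "(\<integral>\<^sup>+v. F v \<partial>cell) = (\<integral>\<^sup>+p. (\<integral>\<^sup>+u. F (p, u) \<partial>seeds) \<partial>\<mu>)"
  using assms unfolding cell_def by (rule seeds.nn_integral_fst[symmetric])

text \<open>Redraw the whole cell as well: the redrawn seed is then overwritten by the second one,
  so by Fubini both sides reduce to redrawing the cell once.\<close>

lemma nn_integral_resample_seed:
  assumes F [measurable]: "F \<in> borel_measurable env"
  shows "(\<integral>\<^sup>+w. F w \<partial>env) = (\<integral>\<^sup>+w. (\<integral>\<^sup>+u. F (upd w j i (fst (w j i), u)) \<partial>seeds) \<partial>env)"
proof -
  define K where "K w = (\<integral>\<^sup>+u. F (upd w j i (fst (w j i), u)) \<partial>seeds)" for w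
  have pair: "(\<lambda>p. (fst p, (fst (fst p j i), snd p))) \<in> env \<Otimes>\<^sub>M seeds \<rightarrow>\<^sub>M env \<Otimes>\<^sub>M cell"
  proof (rule measurable_Pair)
    have "(\<lambda>p. fst (fst p j i)) \<in> env \<Otimes>\<^sub>M seeds \<rightarrow>\<^sub>M \<mu>"
      by (rule measurable_compose[OF measurable_compose[OF measurable_fst measurable_env_cell] measurable_fst_cell])
    then show "(\<lambda>p. (fst (fst p j i), snd p)) \<in> env \<Otimes>\<^sub>M seeds \<rightarrow>\<^sub>M cell"
      unfolding cell_def by (rule measurable_Pair) (rule measurable_snd)
  qed (rule measurable_fst)
  have K [measurable]: "K \<in> borel_measurable env"
    unfolding K_def
    by (rule seeds.borel_measurable_nn_integral)
      (use measurable_compose[OF pair measurable_compose[OF measurable_upd F, of j i]] in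
        \<open>simp add: case_prod_beta'\<close>)
  have "(\<integral>\<^sup>+w. K w \<partial>env) = (\<integral>\<^sup>+w. (\<integral>\<^sup>+v. K (upd w j i v) \<partial>cell) \<partial>env)"
    by (rule nn_integral_resample_cell) (rule K)
  also have "\<dots> = (\<integral>\<^sup>+w. (\<integral>\<^sup>+v. F (upd w j i v) \<partial>cell) \<partial>env)"
  proof (rule nn_integral_cong)
    fix w assume w: "w \<in> space env"
    have updw: "(\<lambda>v. upd w j i v) \<in> cell \<rightarrow>\<^sub>M env"
      using measurable_compose[OF measurable_Pair1'[OF w] measurable_upd] by simp
    have "(\<integral>\<^sup>+v. K (upd w j i v) \<partial>cell) =
        (\<integral>\<^sup>+p. (\<integral>\<^sup>+u. K (upd w j i (p, u)) \<partial>seeds) \<partial>\<mu>)"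
      by (rule nn_integral_cell) (rule measurable_compose[OF updw K])
    also have "\<dots> = (\<integral>\<^sup>+p. (\<integral>\<^sup>+u. F (upd w j i (p, u)) \<partial>seeds) \<partial>\<mu>)"
      by (simp add: K_def upd_def seeds.emeasure_space_1[simplified])
    also have "\<dots> = (\<integral>\<^sup>+v. F (upd w j i v) \<partial>cell)"
      by (rule nn_integral_cell[symmetric]) (rule measurable_compose[OF updw F])
    finally show "(\<integral>\<^sup>+v. K (upd w j i v) \<partial>cell) = (\<integral>\<^sup>+v. F (upd w j i v) \<partial>cell)" .
  qed
  also have "\<dots> = (\<integral>\<^sup>+w. F w \<partial>env)"
    by (rule nn_integral_resample_cell[symmetric]) (rule F)
  finally show ?thesis by (simp add: K_def)
qed

section \<open>Path probabilities: first the seeds, then the site laws are integrated out\<close>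

lemma upd_same: "fst (upd f j i (fst (f j i), u) j' i') = fst (f j' i')"
  by (simp add: upd_def)

lemma upd_other: "(j', i') \<noteq> (j, i) \<Longrightarrow> upd f j i v j' i' = f j' i'"
  by (auto simp: upd_def)

lemma upd_eq: "upd f j i v j i = v"
  by (simp add: upd_def)

abbreviation rank_at :: "(nat \<Rightarrow> int ^ 'd) \<Rightarrow> nat \<Rightarrow> nat" where
  "rank_at x k \<equiv> rank (map x (rev [0..<Suc k]))"

abbreviation visit_at :: "(nat \<Rightarrow> int ^ 'd) \<Rightarrow> nat \<Rightarrow> nat" where
  "visit_at x k \<equiv> visit (map x (rev [0..<Suc k]))"

definition follows :: "(nat \<Rightarrow> int ^ 'd) \<Rightarrow> nat \<Rightarrow> ((int ^ 'd) measure, real) columns \<Rightarrow> bool" where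
  "follows x k w \<longleftrightarrow> sample (fst (w (level (x k)) (rank_at x k))) (snd (w (level (x k)) (visit_at x k))) =
    x (Suc k) - x k"

text \<open>Along a prescribed path the histories are known, so the event splits into conditions on
  cells with deterministic indices.\<close>

lemma X_path_iff: "(\<forall>k\<le>n. X w k = x k) \<longleftrightarrow> x 0 = 0 \<and> (\<forall>k<n. follows x k w)"
proof (induction n)
  case 0
  show ?case by (auto simp: X_def)
next
  case (Suc n)
  show ?case
  proof (cases "\<forall>k\<le>n. X w k = x k")
    case True
    then have h: "history w n = map x (rev [0..<Suc n])" unfolding history_eq by auto
    have "X w (Suc n) = x (Suc n) \<longleftrightarrow> follows x n w"
      using True by (auto simp: X_Suc h follows_def Y_def algebra_simps)
    then show ?thesis using Suc True by (auto simp: le_Suc_eq less_Suc_eq)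
  next
    case False
    then show ?thesis using Suc by (auto simp: le_Suc_eq less_Suc_eq)
  qed
qed

lemma visit_at_less:
  assumes "k < n" "level (x k) = level (x n)"
  shows "visit_at x k < visit_at x n"
  unfolding visit_map visits_def using assms by (intro psubset_card_mono) auto

text \<open>An earlier step uses another seed, because visit numbers within a level are distinct;
  and the laws stay as they are.\<close>

lemma follows_upd:
  assumes "k < n"
  shows "follows x k (upd w (level (x n)) (visit_at x n) (fst (w (level (x n)) (visit_at x n)), u)) \<longleftrightarrow>
    follows x k w"
proof -
  have "(level (x k), visit_at x k) \<noteq> (level (x n), visit_at x n)"
    using visit_at_less[OF assms, of x] by auto
  then show ?thesis unfolding follows_def upd_same by (subst upd_other) simp_all
qed

lemma measurable_follows [measurable]: "Measurable.pred env (follows x k)"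
  unfolding follows_def by measurable

lemma measurable_env_emeasure [measurable]:
  "(\<lambda>w. emeasure (fst (w j i)) {e}) \<in> borel_measurable env"
  by (rule measurable_compose[OF measurable_compose[OF measurable_env_cell measurable_fst_cell]
    measurable_law_emeasure])

text \<open>The last step goes first: its seed is read by no earlier step, so redrawing it turns the
  indicator into a transition probability. This factor depends on laws only and joins
  \<open>G\<close>, which is why a general \<open>G\<close> is carried along.\<close>

lemma nn_integral_follows:
  assumes "G \<in> borel_measurable env" "\<And>w j i u. G (upd w j i (fst (w j i), u)) = G w"
  shows "(\<integral>\<^sup>+w. G w * (\<Prod>k<n. of_bool (follows x k w)) \<partial>env) =
    (\<integral>\<^sup>+w. G w * (\<Prod>k<n. emeasure (fst (w (level (x k)) (rank_at x k))) {x (Suc k) - x k}) \<partial>env)"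
  using assms
proof (induction n arbitrary: G)
  case (Suc n)
  note [measurable] = Suc.prems(1)
  let ?j = "level (x n)" and ?r = "rank_at x n" and ?v = "visit_at x n" and ?e = "x (Suc n) - x n"
  let ?I = "\<lambda>k w. of_bool (follows x k w) :: ennreal"
  let ?U = "\<lambda>w u. upd w ?j ?v (fst (w ?j ?v), u)"
  have [measurable]: "(\<lambda>w. ?I k w) \<in> borel_measurable env" for k by measurable
  have "(\<integral>\<^sup>+w. G w * (\<Prod>k<Suc n. ?I k w) \<partial>env) =
      (\<integral>\<^sup>+w. (\<integral>\<^sup>+u. G (?U w u) * (\<Prod>k<Suc n. ?I k (?U w u)) \<partial>seeds) \<partial>env)"
    by (rule nn_integral_resample_seed) measurable
  also have "\<dots> = (\<integral>\<^sup>+w. (G w * emeasure (fst (w ?j ?r)) {?e}) * (\<Prod>k<n. ?I k w) \<partial>env)"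
  proof (rule nn_integral_cong)
    fix w assume w: "w \<in> space env"
    have 1: "(\<Prod>k<n. ?I k (?U w u)) = (\<Prod>k<n. ?I k w)" for u
      by (rule prod.cong) (auto simp only: follows_upd lessThan_iff)
    have 2: "?I n (?U w u) = indicator {u. sample (fst (w ?j ?r)) u = ?e} u" for u
      by (simp add: follows_def upd_same upd_eq indicator_def)
    have meas: "{u. sample (fst (w ?j ?r)) u = ?e} \<in> sets borel"
    proof -
      have "(\<lambda>u. sample (fst (w ?j ?r)) u) \<in> borel \<rightarrow>\<^sub>M count_space UNIV"
        unfolding sample_def by measurable
      then have "{u \<in> space borel. sample (fst (w ?j ?r)) u = ?e} \<in> sets borel" by measurable
      then show ?thesis by simp
    qed
    have "(\<integral>\<^sup>+u. G (?U w u) * (\<Prod>k<Suc n. ?I k (?U w u)) \<partial>seeds) =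
        (\<integral>\<^sup>+u. (G w * (\<Prod>k<n. ?I k w)) * indicator {u. sample (fst (w ?j ?r)) u = ?e} u \<partial>seeds)"
      unfolding prod.lessThan_Suc 1 2 Suc.prems(2) by (simp add: mult.assoc)
    also have "\<dots> = (G w * (\<Prod>k<n. ?I k w)) * emeasure seeds {u. sample (fst (w ?j ?r)) u = ?e}"
      using meas by (intro nn_integral_cmult_indicator) simp
    also have "emeasure seeds {u. sample (fst (w ?j ?r)) u = ?e} = emeasure (fst (w ?j ?r)) {?e}"
      by (rule emeasure_sample) (rule env_law[OF w])
    finally show "(\<integral>\<^sup>+u. G (?U w u) * (\<Prod>k<Suc n. ?I k (?U w u)) \<partial>seeds) =
        (G w * emeasure (fst (w ?j ?r)) {?e}) * (\<Prod>k<n. ?I k w)"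
      by (simp add: ac_simps)
  qed
  also have "\<dots> = (\<integral>\<^sup>+w. (G w * emeasure (fst (w ?j ?r)) {?e}) *
      (\<Prod>k<n. emeasure (fst (w (level (x k)) (rank_at x k))) {x (Suc k) - x k}) \<partial>env)"
    by (rule Suc.IH) (measurable, simp only: Suc.prems(2) upd_same)
  finally show ?case by (simp add: ac_simps)
qed simp

lemma nn_integral_sites_env:
  assumes "finite S" "inj_on \<iota> S" "\<And>y. g y \<in> borel_measurable \<mu>"
  shows "(\<integral>\<^sup>+w. (\<Prod>y\<in>S. g y (fst (w (fst (\<iota> y)) (snd (\<iota> y))))) \<partial>env) = (\<Prod>y\<in>S. \<integral>\<^sup>+p. g y p \<partial>\<mu>)"
  using assms(1,2)
proof (induction S)
  case empty
  show ?case by (simp add: env.emeasure_space_1)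
next
  case (insert y S)
  note [measurable] = assms(3)
  let ?B = "\<lambda>w y. fst (w (fst (\<iota> y)) (snd (\<iota> y)))"
  have [measurable]: "(\<lambda>w. g z (?B w z')) \<in> borel_measurable env" for z z'
    by (rule measurable_compose[OF measurable_compose[OF measurable_env_cell measurable_fst_cell] assms(3)])
  have gc [measurable]: "(\<lambda>v. g y (fst v)) \<in> borel_measurable cell"
    by measurable
  have "(\<integral>\<^sup>+w. (\<Prod>z\<in>insert y S. g z (?B w z)) \<partial>env) =
      (\<integral>\<^sup>+w. (\<integral>\<^sup>+v. (\<Prod>z\<in>insert y S. g z (?B (upd w (fst (\<iota> y)) (snd (\<iota> y)) v) z)) \<partial>cell) \<partial>env)"
    by (rule nn_integral_resample_cell) measurable
  also have "\<dots> = (\<integral>\<^sup>+w. (\<Prod>z\<in>S. g z (?B w z)) * (\<integral>\<^sup>+p. g y p \<partial>\<mu>) \<partial>env)"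
  proof (rule nn_integral_cong)
    fix w :: "((int ^ 'd) measure, real) columns"
    have "?B (upd w (fst (\<iota> y)) (snd (\<iota> y)) v) z = ?B w z" if "z \<in> S" for z v
    proof -
      have "\<iota> z \<noteq> \<iota> y" using that insert by (auto simp: inj_on_def)
      then show ?thesis by (subst upd_other) (auto simp: prod_eq_iff)
    qed
    then have "(\<Prod>z\<in>insert y S. g z (?B (upd w (fst (\<iota> y)) (snd (\<iota> y)) v) z)) =
        (\<Prod>z\<in>S. g z (?B w z)) * g y (fst v)" for v
      using insert by (simp add: upd_eq mult.commute)
    then have "(\<integral>\<^sup>+v. (\<Prod>z\<in>insert y S. g z (?B (upd w (fst (\<iota> y)) (snd (\<iota> y)) v) z)) \<partial>cell) =
        (\<Prod>z\<in>S. g z (?B w z)) * (\<integral>\<^sup>+v. g y (fst v) \<partial>cell)"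
      by (simp add: nn_integral_cmult)
    also have "(\<integral>\<^sup>+v. g y (fst v) \<partial>cell) = (\<integral>\<^sup>+p. g y p \<partial>\<mu>)"
      by (subst nn_integral_cell) (auto simp: seeds.emeasure_space_1[simplified])
    finally show "(\<integral>\<^sup>+v. (\<Prod>z\<in>insert y S. g z (?B (upd w (fst (\<iota> y)) (snd (\<iota> y)) v) z)) \<partial>cell) =
        (\<Prod>z\<in>S. g z (?B w z)) * (\<integral>\<^sup>+p. g y p \<partial>\<mu>)" .
  qed
  also have "\<dots> = (\<integral>\<^sup>+w. (\<Prod>z\<in>S. g z (?B w z)) \<partial>env) * (\<integral>\<^sup>+p. g y p \<partial>\<mu>)"
    by (rule nn_integral_multc) measurable
  finally show ?case using insert by (simp add: mult.commute)
qed

lemma nn_integral_sites_law: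
  assumes "finite S" "\<And>y. g y \<in> borel_measurable \<mu>"
  shows "(\<integral>\<^sup>+w. (\<Prod>y\<in>S. g y (w y)) \<partial>environment_law \<mu>) = (\<Prod>y\<in>S. \<integral>\<^sup>+p. g y p \<partial>\<mu>)"
  using assms(1)
proof (induction S)
  case empty
  interpret E: prob_space "environment_law \<mu>"
    unfolding environment_law_def by (rule prob_space_PiM) (rule prob_\<mu>)
  show ?case by (simp add: E.emeasure_space_1)
next
  case (insert y S)
  note [measurable] = assms(2)
  have [measurable]: "(\<lambda>w. g z (w z)) \<in> borel_measurable (environment_law \<mu>)" for z
    unfolding environment_law_def by measurable
  have "(\<integral>\<^sup>+w. (\<Prod>z\<in>insert y S. g z (w z)) \<partial>environment_law \<mu>) =
      (\<integral>\<^sup>+w. (\<integral>\<^sup>+p. (\<Prod>z\<in>insert y S. g z ((fun_upd w y p) z)) \<partial>\<mu>) \<partial>environment_law \<mu>)"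
    unfolding environment_law_def
    by (rule nn_integral_PiM_resample) (auto intro: prob_\<mu>)
  also have "\<dots> = (\<integral>\<^sup>+w. (\<Prod>z\<in>S. g z (w z)) * (\<integral>\<^sup>+p. g y p \<partial>\<mu>) \<partial>environment_law \<mu>)"
  proof (rule nn_integral_cong)
    fix w :: "int ^ 'd \<Rightarrow> (int ^ 'd) measure"
    have "(\<Prod>z\<in>S. g z ((fun_upd w y p) z)) = (\<Prod>z\<in>S. g z (w z))" for p
      using insert by (intro prod.cong) auto
    then have "(\<Prod>z\<in>insert y S. g z ((fun_upd w y p) z)) = (\<Prod>z\<in>S. g z (w z)) * g y p" for p
      using insert by (simp add: mult.commute)
    then show "(\<integral>\<^sup>+p. (\<Prod>z\<in>insert y S. g z ((fun_upd w y p) z)) \<partial>\<mu>) =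
        (\<Prod>z\<in>S. g z (w z)) * (\<integral>\<^sup>+p. g y p \<partial>\<mu>)"
      by (simp add: nn_integral_cmult)
  qed
  also have "\<dots> = (\<integral>\<^sup>+w. (\<Prod>z\<in>S. g z (w z)) \<partial>environment_law \<mu>) * (\<integral>\<^sup>+p. g y p \<partial>\<mu>)"
    by (rule nn_integral_multc) measurable
  finally show ?case using insert by (simp add: mult.commute)
qed

text \<open>Along a fixed path, distinct sites use distinct cells, so their laws are independent.\<close>

lemma nn_integral_path:
  fixes x :: "nat \<Rightarrow> int ^ 'd"
  shows "(\<integral>\<^sup>+w. (\<Prod>k<n. emeasure (fst (w (level (x k)) (rank_at x k))) {e k}) \<partial>env) =
    (\<integral>\<^sup>+w. (\<Prod>k<n. emeasure (w (x k)) {e k}) \<partial>environment_law \<mu>)"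
proof -
  define D where "D y = {z \<in> set (takeWhile (\<lambda>z. z \<noteq> y) (map x [0..<n])). level z = level y}" for y
  define \<iota> where "\<iota> y = (level y, card (D y))" for y
  define g where "g y p = (\<Prod>k\<in>{k \<in> {..<n}. x k = y}. emeasure p {e k})" for y p
  have gm: "g y \<in> borel_measurable \<mu>" for y
    unfolding g_def by measurable
  \<comment> \<open>The cut at the first visit to \<open>x k\<close> comes at time \<open>k\<close>
    at the latest. So the rank can be read off the whole path and is a function of the site.\<close>
  have rank: "rank_at x k = snd (\<iota> (x k))" if "k < n" for k
  proof -
    have "[0..<n] = [0..<Suc k] @ [Suc k..<n]" using that by (metis upt_add_eq_append Suc_leI le_add_diff_inverse zero_le)
    then have "takeWhile (\<lambda>z. z \<noteq> x k) (map x [0..<n]) = takeWhile (\<lambda>z. z \<noteq> x k) (map x [0..<Suc k])"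
      by (simp only: map_append) (rule takeWhile_append1[of "x k"], auto)
    moreover have "hd (map x (rev [0..<Suc k])) = x k" by simp
    ultimately show ?thesis
      unfolding rank_def \<iota>_def D_def by (simp only: rev_map[symmetric] rev_rev_ident snd_conv)
  qed
  have "inj_on \<iota> (x ` {..<n})"
  proof (rule inj_onI)
    \<comment> \<open>Of two sites in one level, the earlier one belongs to the set counted for the
      later one but not to its own set, and its own set is contained in the other.\<close>
    have less: "card (D y) < card (D y')"
      if "y \<in> x ` {..<n}" "y' \<in> x ` {..<n}" "y \<noteq> y'" "level y = level y'"
        "y \<in> set (takeWhile (\<lambda>z. z \<noteq> y') (map x [0..<n]))" for y y'
    proof (rule psubset_card_mono)
      have "set (takeWhile (\<lambda>z. z \<noteq> y) (map x [0..<n])) \<subseteq> set (takeWhile (\<lambda>z. z \<noteq> y') (map x [0..<n]))"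
      proof -
        have "map x [0..<n] = takeWhile (\<lambda>z. z \<noteq> y') (map x [0..<n]) @ dropWhile (\<lambda>z. z \<noteq> y') (map x [0..<n])"
          by simp
        then have "takeWhile (\<lambda>z. z \<noteq> y) (map x [0..<n]) =
            takeWhile (\<lambda>z. z \<noteq> y) (takeWhile (\<lambda>z. z \<noteq> y') (map x [0..<n]))"
          using takeWhile_append1[of y "takeWhile (\<lambda>z. z \<noteq> y') (map x [0..<n])" "\<lambda>z. z \<noteq> y"] that(5)
          by metis
        then show ?thesis by (metis set_takeWhileD subsetI)
      qed
      moreover have "y \<notin> set (takeWhile (\<lambda>z. z \<noteq> y) (map x [0..<n]))"
        by (auto dest: set_takeWhileD)
      ultimately show "D y \<subset> D y'" using that(4,5) unfolding D_def by auto
    qed (simp add: D_def)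
    fix y y' assume y: "y \<in> x ` {..<n}" "y' \<in> x ` {..<n}" "\<iota> y = \<iota> y'"
    show "y = y'"
    proof (rule ccontr)
      assume ne: "y \<noteq> y'"
      obtain k k' where k: "k < n" "x k = y" "k' < n" "x k' = y'" using y by auto
      define k0 where "k0 = (LEAST k. k < n \<and> (x k = y \<or> x k = y'))"
      have k0: "k0 < n \<and> (x k0 = y \<or> x k0 = y')"
        unfolding k0_def by (rule LeastI[of _ k]) (use k in simp)
      have before: "x l \<noteq> y \<and> x l \<noteq> y'" if "l < k0" for l
        using that not_less_Least[of l "\<lambda>k. k < n \<and> (x k = y \<or> x k = y')"] k0 unfolding k0_def by force
      have split: "map x [0..<n] = map x [0..<k0] @ x k0 # map x [Suc k0..<n]"
        using upt_add_eq_append[of 0 k0 "n - k0"] upt_conv_Cons[of k0 n] k0 by simp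
      have in_tw: "x k0 \<in> set (takeWhile (\<lambda>z. z \<noteq> w) (map x [0..<n]))" if "w \<noteq> x k0" "w = y \<or> w = y'" for w
      proof -
        have "\<forall>l<k0. x l \<noteq> w" using before that(2) by blast
        then have "takeWhile (\<lambda>z. z \<noteq> w) (map x [0..<k0] @ x k0 # map x [Suc k0..<n]) =
            map x [0..<k0] @ takeWhile (\<lambda>z. z \<noteq> w) (x k0 # map x [Suc k0..<n])"
          by (intro takeWhile_append2) auto
        then show ?thesis using that(1) by (simp add: split)
      qed
      show False
      proof (cases "x k0 = y")
        case True
        then have "card (D y) < card (D y')" using y ne in_tw[of y'] by (intro less) (auto simp: \<iota>_def)
        then show False using y(3) by (simp add: \<iota>_def)
      next
        case False
        then have "x k0 = y'" using k0 by simp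
        then have "card (D y') < card (D y)" using y ne in_tw[of y] by (intro less) (auto simp: \<iota>_def)
        then show False using y(3) by (simp add: \<iota>_def)
      qed
    qed
  qed
  note inj = this
  \<comment> \<open>Repeated visits to a site share one law, so independence is available only after
    the steps have been collected by site.\<close>
  have group: "(\<Prod>k<n. emeasure (q (x k)) {e k}) = (\<Prod>y\<in>x ` {..<n}. g y (q y))" for q
  proof -
    have "(\<Prod>k<n. emeasure (q (x k)) {e k}) =
        (\<Prod>y\<in>x ` {..<n}. \<Prod>k\<in>{k \<in> {..<n}. x k = y}. emeasure (q (x k)) {e k})"
      by (rule prod.image_gen) simp
    also have "\<dots> = (\<Prod>y\<in>x ` {..<n}. g y (q y))"
      unfolding g_def by (intro prod.cong) auto
    finally show ?thesis .
  qed
  have "(\<Prod>k<n. emeasure (fst (w (level (x k)) (rank_at x k))) {e k}) =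
      (\<Prod>y\<in>x ` {..<n}. g y (fst (w (fst (\<iota> y)) (snd (\<iota> y)))))" for w :: "((int ^ 'd) measure, real) columns"
  proof -
    have "(\<Prod>k<n. emeasure (fst (w (level (x k)) (rank_at x k))) {e k}) =
        (\<Prod>k<n. emeasure (fst (w (fst (\<iota> (x k))) (snd (\<iota> (x k))))) {e k})"
    proof (rule prod.cong)
      fix k assume "k \<in> {..<n}"
      then have "rank_at x k = snd (\<iota> (x k))" by (intro rank) simp
      moreover have "level (x k) = fst (\<iota> (x k))" by (simp add: \<iota>_def)
      ultimately show "emeasure (fst (w (level (x k)) (rank_at x k))) {e k} =
          emeasure (fst (w (fst (\<iota> (x k))) (snd (\<iota> (x k))))) {e k}" by metis
    qed simp
    then show ?thesis using group[of "\<lambda>y. fst (w (fst (\<iota> y)) (snd (\<iota> y)))"] by simp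
  qed
  then show ?thesis
    using inj gm by (simp add: group nn_integral_sites_env nn_integral_sites_law)
qed

lemma emeasure_X_path:
  "emeasure env {w \<in> space env. \<forall>k\<le>n. X w k = x k} =
    (if x 0 = 0 then \<integral>\<^sup>+w. (\<Prod>k<n. emeasure (w (x k)) {x (Suc k) - x k}) \<partial>environment_law \<mu> else 0)"
proof (cases "x 0 = 0")
  case True
  have meas: "{w \<in> space env. \<forall>k\<le>n. X w k = x k} \<in> sets env" by measurable
  have "emeasure env {w \<in> space env. \<forall>k\<le>n. X w k = x k} =
      (\<integral>\<^sup>+w. indicator {w \<in> space env. \<forall>k\<le>n. X w k = x k} w \<partial>env)"
    using meas by simp
  also have "\<dots> = (\<integral>\<^sup>+w. 1 * (\<Prod>k<n. of_bool (follows x k w)) \<partial>env)"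
  proof (rule nn_integral_cong)
    fix w assume "w \<in> space env"
    then have "indicator {w \<in> space env. \<forall>k\<le>n. X w k = x k} w = (of_bool (\<forall>k<n. follows x k w) :: ennreal)"
      using True X_path_iff[of n w x] by (simp add: indicator_def)
    also have "\<dots> = (\<Prod>k<n. of_bool (follows x k w))"
      by (induction n) (auto simp: less_Suc_eq)
    finally show "indicator {w \<in> space env. \<forall>k\<le>n. X w k = x k} w =
        (1 * (\<Prod>k<n. of_bool (follows x k w)) :: ennreal)" by simp
  qed
  also have "\<dots> = (\<integral>\<^sup>+w. 1 * (\<Prod>k<n. emeasure (fst (w (level (x k)) (rank_at x k))) {x (Suc k) - x k}) \<partial>env)"
    by (rule nn_integral_follows) auto
  finally show ?thesis using True nn_integral_path by simp
next
  case False
  then have "\<not> (\<forall>k\<le>n. X w k = x k)" for w using X_path_iff[of n w x] by simp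
  then have "{w \<in> space env. \<forall>k\<le>n. X w k = x k} = {}" by blast
  then show ?thesis using False by (simp only: emeasure_empty if_False)
qed

section \<open>Identification of the two laws on finite paths\<close>

definition cylinder :: "nat \<Rightarrow> (nat \<Rightarrow> int ^ 'd) \<Rightarrow> (nat \<Rightarrow> int ^ 'd) set" where
  "cylinder n x = {z. \<forall>k\<le>n. z k = x k}"

definition cylinders :: "(nat \<Rightarrow> int ^ 'd) set set" where
  "cylinders = insert {} (range (\<lambda>(n, x). cylinder n x))"

lemma cylinders_cases: "A \<in> cylinders \<Longrightarrow> A = {} \<or> (\<exists>n x. A = cylinder n x)"
  by (auto simp: cylinders_def)

lemma Int_stable_cylinders: "Int_stable cylinders"
proof (rule Int_stableI)
  fix A B assume AB: "A \<in> cylinders" "B \<in> cylinders"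
  have "cylinder n x \<inter> cylinder m y \<in> cylinders" for n m x y
  proof (cases "cylinder n x \<inter> cylinder m y = {}")
    case False
    then obtain z where "z \<in> cylinder n x" "z \<in> cylinder m y" by auto
    then have "cylinder n x \<inter> cylinder m y = cylinder (max n m) z"
      by (auto simp: cylinder_def le_max_iff_disj)
    then show ?thesis by (auto simp: cylinders_def)
  qed (simp add: cylinders_def)
  moreover have "{} \<in> cylinders" by (simp add: cylinders_def)
  ultimately show "A \<inter> B \<in> cylinders"
    using cylinders_cases[OF AB(1)] cylinders_cases[OF AB(2)] by (elim disjE exE) simp_all
qed

lemma cylinder_in_sets: "cylinder n x \<in> sets trajectories"
proof -
  have "cylinder n x = prod_emb UNIV (\<lambda>_. count_space UNIV) {..n} (\<Pi>\<^sub>E k\<in>{..n}. {x k})"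
    by (auto simp: cylinder_def prod_emb_def PiE_iff)
  then show ?thesis
    using sets_PiM_I[of "{..n}" UNIV "\<lambda>k. {x k}" "\<lambda>_. count_space UNIV"] by simp
qed

lemma sets_trajectories: "sets (trajectories :: (nat \<Rightarrow> int ^ 'd) measure) = sigma_sets UNIV cylinders"
proof
  show "sigma_sets UNIV cylinders \<subseteq> sets (trajectories :: (nat \<Rightarrow> int ^ 'd) measure)"
    using sets.sigma_sets_subset[of cylinders "trajectories :: (nat \<Rightarrow> int ^ 'd) measure"]
      cylinder_in_sets cylinders_cases
    by (fastforce simp: space_PiM)
  interpret S: sigma_algebra UNIV "sigma_sets UNIV cylinders"
    by (rule sigma_algebra_sigma_sets) simp
  have single: "{z. z k \<in> A} \<in> sigma_sets UNIV cylinders" for k and A :: "(int ^ 'd) set"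
  proof -
    define L where "L = {xs :: (int ^ 'd) list. length xs = Suc k \<and> xs ! k \<in> A}"
    have "{z. z k \<in> A} = (\<Union>xs\<in>L. cylinder k (\<lambda>i. xs ! i))"
    proof (intro set_eqI iffI)
      fix z :: "nat \<Rightarrow> int ^ 'd" assume "z \<in> {z. z k \<in> A}"
      then have "map z [0..<Suc k] \<in> L" "z \<in> cylinder k (\<lambda>i. map z [0..<Suc k] ! i)"
        by (auto simp: L_def cylinder_def nth_append simp del: upt_Suc)
      then show "z \<in> (\<Union>xs\<in>L. cylinder k (\<lambda>i. xs ! i))" by blast
    qed (auto simp: L_def cylinder_def)
    also have "\<dots> \<in> sigma_sets UNIV cylinders"
      by (intro S.countable_UN'') (auto simp: cylinders_def)
    finally show ?thesis .
  qed
  show "sets (trajectories :: (nat \<Rightarrow> int ^ 'd) measure) \<subseteq> sigma_sets UNIV cylinders"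
    unfolding sets_PiM_single space_count_space PiE_UNIV_domain Pi_UNIV
    by (rule sigma_sets_mono) (auto simp: single)
qed

lemma measurable_X_path: "X \<in> env \<rightarrow>\<^sub>M trajectories"
  by (rule measurable_PiM_single') auto

text \<open>The laws agree on cylinders, which generate the trajectory sets and are stable under
  intersection. The countable cover fixes the position at time 0.\<close>

lemma annealed_law_eq: "annealed_law \<mu> = distr env trajectories X"
proof -
  let ?T = "trajectories :: (nat \<Rightarrow> int ^ 'd) measure"
  interpret E: prob_space "environment_law \<mu>"
    unfolding environment_law_def by (rule prob_space_PiM) (rule prob_\<mu>)
  have sets_E: "sets (environment_law \<mu>) = sets (PiM UNIV (\<lambda>_. transition_laws))"
    unfolding environment_law_def by (intro sets_PiM_cong sets_\<mu> refl)
  have q: "quenched_law \<in> environment_law \<mu> \<rightarrow>\<^sub>M subprob_algebra ?T"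
    using measurable_prob_algebraD[OF measurable_quenched_law]
    by (simp add: measurable_cong_sets[OF sets_E refl])
  have laws: "w y \<in> space transition_laws" if "w \<in> space (environment_law \<mu>)" for w y
    using that by (auto simp: environment_law_def space_PiM space_\<mu>)
  have sets_A: "sets (annealed_law \<mu>) = sets ?T"
    unfolding annealed_law_def
    by (intro sets_bind sets_quenched_law laws E.not_empty)
  have cyl: "emeasure (annealed_law \<mu>) (cylinder n x) = emeasure (distr env ?T X) (cylinder n x)" for n x
  proof -
    have "emeasure (annealed_law \<mu>) (cylinder n x) =
        (\<integral>\<^sup>+w. emeasure (quenched_law w) (cylinder n x) \<partial>environment_law \<mu>)"
      unfolding annealed_law_def by (rule emeasure_bind[OF E.not_empty q cylinder_in_sets])
    also have "\<dots> = (\<integral>\<^sup>+w. (if x 0 = 0 then \<Prod>k<n. emeasure (w (x k)) {x (Suc k) - x k} else 0)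
        \<partial>environment_law \<mu>)"
      unfolding cylinder_def
      by (intro nn_integral_cong emeasure_quenched_law_cylinder laws)
    also have "\<dots> = emeasure env {w \<in> space env. \<forall>k\<le>n. X w k = x k}"
      unfolding emeasure_X_path by simp
    also have "{w \<in> space env. \<forall>k\<le>n. X w k = x k} = X -` cylinder n x \<inter> space env"
      by (auto simp: cylinder_def)
    also have "emeasure env \<dots> = emeasure (distr env ?T X) (cylinder n x)"
      by (rule emeasure_distr[symmetric]) (rule measurable_X_path cylinder_in_sets)+
    finally show ?thesis .
  qed
  show ?thesis
  proof (rule measure_eqI_generator_eq_countable[OF Int_stable_cylinders, where \<Omega> = UNIV and A = "range (\<lambda>x0. cylinder 0 (\<lambda>_. x0))"])
    show "emeasure (annealed_law \<mu>) A = emeasure (distr env ?T X) A" if "A \<in> cylinders" for A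
      using cylinders_cases[OF that] cyl by auto
    show "range (\<lambda>x0. cylinder 0 (\<lambda>_. x0)) \<subseteq> cylinders" by (auto simp: cylinders_def)
    show "\<Union> (range (\<lambda>x0. cylinder 0 (\<lambda>_. x0))) = UNIV" by (auto simp: cylinder_def)
    show "emeasure (annealed_law \<mu>) A \<noteq> \<infinity>" if A: "A \<in> range (\<lambda>x0. cylinder 0 (\<lambda>_. x0))" for A
    proof -
      interpret D: prob_space "distr env ?T X" by (rule env.prob_space_distr) (rule measurable_X_path)
      show ?thesis using A cyl by auto
    qed
  qed (auto simp: sets_A sets_trajectories)
qed

lemma AE_annealed_law:
  assumes "Measurable.pred trajectories P" "AE w in env. P (X w)"
  shows "AE x in annealed_law \<mu>. P x"
  unfolding annealed_law_eq
  using assms by (subst AE_distr_iff[OF measurable_X_path]) auto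

section \<open>The walk reaches every level\<close>

lemma drift_nonneg_AE: "AE p in \<mu>. 0 \<le> drift p \<bullet> diagonal"
  using drift_nonneg by (subst (asm) \<mu>.prob_Collect_eq_1) auto

lemma AE_cell: "AE v in cell. 0 \<le> drift (fst v) \<bullet> diagonal"
proof -
  interpret pair_sigma_finite \<mu> seeds ..
  have "AE p in \<mu>. AE u in seeds. 0 \<le> drift (fst (p, u)) \<bullet> diagonal"
    using drift_nonneg_AE by eventually_elim simp
  then show ?thesis
    unfolding cell_def by (intro AE_pair_measure) measurable
qed

lemma AE_env: "AE w in env. \<forall>j i. 0 \<le> drift (fst (w j i)) \<bullet> diagonal"
proof -
  have col: "AE c in column_law. 0 \<le> drift (fst (c i)) \<bullet> diagonal" for i
  proof (rule AE_distrD[of "\<lambda>c. c i" column_law cell])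
    show "AE v in distr column_law cell (\<lambda>c. c i). 0 \<le> drift (fst v) \<bullet> diagonal"
      unfolding column_law_def using AE_cell
      by (subst distr_PiM_component) (auto intro: cell.prob_space_axioms)
  qed measurable
  have "AE w in env. 0 \<le> drift (fst (w j i)) \<bullet> diagonal" for j i
  proof (rule AE_distrD[of "\<lambda>w. w j" env column_law])
    show "AE c in distr env column_law (\<lambda>w. w j). 0 \<le> drift (fst (c i)) \<bullet> diagonal"
      unfolding env_def using col[of i]
      by (subst distr_PiM_component) (auto intro: column_law.prob_space_axioms)
  qed measurable
  then show ?thesis by (simp add: AE_all_countable)
qed

definition seed_at :: "((int ^ 'd) measure, real) columns \<Rightarrow> (int ^ 'd) list \<Rightarrow> real" where
  "seed_at w h = snd (w (level (hd h)) (visit h))"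

lemma step_up:
  assumes "w \<in> space env" "seed_at w (history w n) \<le> (1 + drift (fst (w (Y w n) (rank (history w n)))) \<bullet> diagonal) / 2"
  shows "Y w (Suc n) = Y w n + 1"
proof -
  have "seed_at w (history w n) = snd (w (Y w n) (visit (history w n)))"
    by (simp add: seed_at_def Y_def X_def)
  then have "level (sample (fst (w (Y w n) (rank (history w n)))) (snd (w (Y w n) (visit (history w n))))) = 1"
    using assms by (intro level_sample_up env_law) auto
  moreover have "Y w (Suc n) = Y w n +
      level (sample (fst (w (Y w n) (rank (history w n)))) (snd (w (Y w n) (visit (history w n)))))"
    unfolding Y_def[of w "Suc n"] X_Suc level_add Y_def[of w n] ..
  ultimately show ?thesis by simp
qed

lemma measurable_seed_at [measurable]: "(\<lambda>w. seed_at w h) \<in> borel_measurable env"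
proof -
  have "(\<lambda>w. snd (w j i)) \<in> env \<rightarrow>\<^sub>M seeds" for j i
    by (rule measurable_compose[OF measurable_env_cell measurable_snd_cell])
  then have "(\<lambda>w. snd (w j i)) \<in> borel_measurable env" for j i
    by (simp add: measurable_cong_sets[OF refl sets_seeds])
  then show ?thesis by (simp add: seed_at_def)
qed

lemma measurable_seed_history [measurable]: "(\<lambda>w. seed_at w (history w n)) \<in> borel_measurable env"
  by (rule measurable_compose_countable[OF measurable_seed_at measurable_history])

text \<open>The seed for the next step has not been read while the history was built, so redrawing
  it leaves the history in place.\<close>

lemma nn_integral_seed_history_single:
  "(\<integral>\<^sup>+w. of_bool (history w n = h) * of_bool (seed_at w h \<le> 1 / 2) \<partial>env) =
    (\<integral>\<^sup>+w. of_bool (history w n = h) \<partial>env) / 2"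
proof (cases "length h = Suc n")
  case True
  define x where "x k = rev h ! k" for k
  have h: "h = map x (rev [0..<Suc n])"
  proof -
    have "rev h = map x [0..<Suc n]" by (rule nth_equalityI) (simp_all add: True x_def del: upt_Suc)
    then show ?thesis by (metis rev_map rev_rev_ident)
  qed
  have hist: "history w n = h \<longleftrightarrow> (\<forall>k\<le>n. X w k = x k)" for w
    unfolding history_eq h by (auto simp del: upt_Suc)
  let ?j = "level (x n)" and ?v = "visit_at x n"
  let ?U = "\<lambda>w u. upd w ?j ?v (fst (w ?j ?v), u)"
  have hd: "level (hd h) = ?j" "visit h = ?v" unfolding h by simp_all
  have inv: "history (?U w u) n = h \<longleftrightarrow> history w n = h" for w u
    unfolding hist X_path_iff by (auto simp only: follows_upd)
  have seed: "seed_at (?U w u) h = u" for w :: "((int ^ 'd) measure, real) columns" and u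
    unfolding seed_at_def hd by (simp only: upd_eq snd_conv)
  have meas: "(\<lambda>w. of_bool (history w n = h) :: ennreal) \<in> borel_measurable env"
    by measurable
  have "(\<integral>\<^sup>+w. of_bool (history w n = h) * of_bool (seed_at w h \<le> 1 / 2) \<partial>env) =
      (\<integral>\<^sup>+w. (\<integral>\<^sup>+u. of_bool (history (?U w u) n = h) * of_bool (seed_at (?U w u) h \<le> 1 / 2) \<partial>seeds) \<partial>env)"
    by (rule nn_integral_resample_seed) measurable
  also have "\<dots> = (\<integral>\<^sup>+w. (\<integral>\<^sup>+u. of_bool (history w n = h) * indicator {u. u \<le> 1 / 2} u \<partial>seeds) \<partial>env)"
    unfolding inv seed by (simp only: indicator_def mem_Collect_eq)
  also have "\<dots> = (\<integral>\<^sup>+w. of_bool (history w n = h) * (1 / 2) \<partial>env)"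
  proof (rule nn_integral_cong)
    fix w
    have "emeasure seeds {u. u \<le> 1 / 2} = ennreal (1 / 2)"
      unfolding seeds.emeasure_eq_measure by (subst measure_seeds_le) auto
    also have "\<dots> = 1 / 2"
      by (metis ennreal_1 ennreal_divide_numeral zero_le_one)
    finally have half: "emeasure seeds {u. u \<le> 1 / 2} = 1 / 2" .
    show "(\<integral>\<^sup>+u. of_bool (history w n = h) * indicator {u. u \<le> 1 / 2} u \<partial>seeds) =
        of_bool (history w n = h) * (1 / 2 :: ennreal)"
      unfolding half[symmetric] by (rule nn_integral_cmult_indicator) simp
  qed
  also have "\<dots> = (\<integral>\<^sup>+w. of_bool (history w n = h) \<partial>env) * (1 / 2)"
    by (rule nn_integral_multc[OF meas])
  finally show ?thesis by (simp add: ennreal_times_divide)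
next
  case False
  then have "history w n \<noteq> h" for w using length_history[of w n] by auto
  then show ?thesis by simp
qed

lemma nn_integral_seed_history:
  fixes g :: "(int ^ 'd) list \<Rightarrow> ennreal"
  shows "(\<integral>\<^sup>+w. g (history w n) * of_bool (seed_at w (history w n) \<le> 1 / 2) \<partial>env) =
    (\<integral>\<^sup>+w. g (history w n) \<partial>env) / 2"
proof -
  have single: "(\<integral>\<^sup>+h. f h * of_bool (history w n = h) \<partial>count_space UNIV) = f (history w n)"
    for f :: "(int ^ 'd) list \<Rightarrow> ennreal" and w
  proof -
    have "(\<integral>\<^sup>+h. f h * of_bool (history w n = h) \<partial>count_space UNIV) =
        (\<integral>\<^sup>+h. f h * indicator {history w n} h \<partial>count_space UNIV)"
      by (intro nn_integral_cong) (auto simp: indicator_def)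
    then show ?thesis by (simp add: nn_integral_indicator_singleton)
  qed
  have swap: "(\<integral>\<^sup>+w. (\<integral>\<^sup>+h. f h w \<partial>count_space UNIV) \<partial>env) = (\<integral>\<^sup>+h. (\<integral>\<^sup>+w. f h w \<partial>env) \<partial>count_space UNIV)"
    if "\<And>h. f h \<in> borel_measurable env" for f :: "(int ^ 'd) list \<Rightarrow> _ \<Rightarrow> ennreal"
    using that by (intro nn_integral_count_space_nn_integral) auto
  have [measurable]: "(\<lambda>w. of_bool (history w n = h) :: ennreal) \<in> borel_measurable env" for h
    by measurable
  have [measurable]: "(\<lambda>w. of_bool (seed_at w h \<le> 1 / 2) :: ennreal) \<in> borel_measurable env" for h
    by measurable
  have "(\<integral>\<^sup>+w. g (history w n) * of_bool (seed_at w (history w n) \<le> 1 / 2) \<partial>env) =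
      (\<integral>\<^sup>+w. (\<integral>\<^sup>+h. (g h * of_bool (seed_at w h \<le> 1 / 2)) * of_bool (history w n = h) \<partial>count_space UNIV) \<partial>env)"
    by (simp only: single)
  also have "\<dots> = (\<integral>\<^sup>+h. (\<integral>\<^sup>+w. (g h * of_bool (seed_at w h \<le> 1 / 2)) * of_bool (history w n = h) \<partial>env) \<partial>count_space UNIV)"
    by (rule swap) measurable
  also have "\<dots> = (\<integral>\<^sup>+h. (\<integral>\<^sup>+w. g h * of_bool (history w n = h) \<partial>env) / 2 \<partial>count_space UNIV)"
  proof (rule nn_integral_cong)
    fix h :: "(int ^ 'd) list"
    have "(\<integral>\<^sup>+w. (g h * of_bool (seed_at w h \<le> 1 / 2)) * of_bool (history w n = h) \<partial>env) =
        g h * (\<integral>\<^sup>+w. of_bool (history w n = h) * of_bool (seed_at w h \<le> 1 / 2) \<partial>env)"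
      by (subst nn_integral_cmult[symmetric]) (auto simp: ac_simps)
    also have "\<dots> = (\<integral>\<^sup>+w. g h * of_bool (history w n = h) \<partial>env) / 2"
      unfolding nn_integral_seed_history_single
      by (subst nn_integral_cmult) (auto simp: ennreal_times_divide)
    finally show "(\<integral>\<^sup>+w. (g h * of_bool (seed_at w h \<le> 1 / 2)) * of_bool (history w n = h) \<partial>env) =
        (\<integral>\<^sup>+w. g h * of_bool (history w n = h) \<partial>env) / 2" .
  qed
  also have "\<dots> = (\<integral>\<^sup>+h. (\<integral>\<^sup>+w. g h * of_bool (history w n = h) \<partial>env) \<partial>count_space UNIV) / 2"
    by (rule nn_integral_divide) simp
  also have "(\<integral>\<^sup>+h. (\<integral>\<^sup>+w. g h * of_bool (history w n = h) \<partial>env) \<partial>count_space UNIV) =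
      (\<integral>\<^sup>+w. (\<integral>\<^sup>+h. g h * of_bool (history w n = h) \<partial>count_space UNIV) \<partial>env)"
    by (rule swap[symmetric]) measurable
  finally show ?thesis by (simp only: single)
qed

lemma integral_seed_history:
  fixes g :: "(int ^ 'd) list \<Rightarrow> real"
  assumes "\<And>h. 0 \<le> g h" "\<And>h. g h \<le> B"
  shows "(\<integral>w. g (history w n) * of_bool (seed_at w (history w n) \<le> 1 / 2) \<partial>env) =
    (\<integral>w. g (history w n) \<partial>env) / 2"
proof -
  have gm [measurable]: "(\<lambda>w. g (history w n)) \<in> borel_measurable env"
    by (rule measurable_compose[OF measurable_history]) simp
  have int: "integrable env (\<lambda>w. g (history w n))"
    by (rule env.integrable_const_bound[of _ B]) (use assms in auto)
  have "(\<integral>w. g (history w n) * of_bool (seed_at w (history w n) \<le> 1 / 2) \<partial>env) =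
      enn2real (\<integral>\<^sup>+w. ennreal (g (history w n) * of_bool (seed_at w (history w n) \<le> 1 / 2)) \<partial>env)"
    using assms by (intro integral_eq_nn_integral) auto
  also have "(\<integral>\<^sup>+w. ennreal (g (history w n) * of_bool (seed_at w (history w n) \<le> 1 / 2)) \<partial>env) =
      (\<integral>\<^sup>+w. ennreal (g (history w n)) * of_bool (seed_at w (history w n) \<le> 1 / 2) \<partial>env)"
    by (intro nn_integral_cong) auto
  also have "\<dots> = (\<integral>\<^sup>+w. ennreal (g (history w n)) \<partial>env) / 2"
    by (rule nn_integral_seed_history[of "\<lambda>h. ennreal (g h)"])
  also have "(\<integral>\<^sup>+w. ennreal (g (history w n)) \<partial>env) = ennreal (\<integral>w. g (history w n) \<partial>env)"
    using assms by (intro nn_integral_eq_integral int) auto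
  finally show ?thesis
    using assms by (simp add: ennreal_divide_numeral integral_nonneg_AE)
qed

text \<open>
  The convex function \<open>(y + m)\<^sup>2\<close> of the level, stopped on leaving \<open>(-m, k)\<close>, has increments of mean
  at least \<open>1\<close> before the exit. This shows both that the exit time is finite and that the exit
  happens at \<open>k\<close> with probability at least \<open>m\<^sup>2 / (m + k)\<^sup>2\<close>.
\<close>

lemma prob_hit_ge:
  assumes m: "0 < m" and N: "0 < N"
  shows "(real m)\<^sup>2 / (real m + real k)\<^sup>2 - (real m + real k)\<^sup>2 / real N \<le>
    measure env {w \<in> space env. \<exists>n. Y w n = int k}"
proof -
  define \<phi> where "\<phi> y = (real_of_int y + real m)\<^sup>2" for y
  define alive :: "nat \<Rightarrow> ((int ^ 'd) measure, real) columns \<Rightarrow> bool" where "alive n w \<longleftrightarrow> (\<forall>l\<le>n. - int m < Y w l \<and> Y w l < int k)" for n w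
  define s where "s = rec_nat (\<lambda>_. 0) (\<lambda>n f w. if alive n w then Y w (Suc n) else f w)"
  have s_0: "s 0 w = 0" and s_Suc: "s (Suc n) w = (if alive n w then Y w (Suc n) else s n w)" for n w
    by (simp_all add: s_def)
  have [measurable]: "Measurable.pred env (alive n)" for n unfolding alive_def by measurable
  have [measurable]: "s n \<in> env \<rightarrow>\<^sub>M count_space UNIV" for n
  proof (induction n)
    case (Suc n)
    note [measurable] = Suc
    have "(\<lambda>w. if alive n w then Y w (Suc n) else s n w) \<in> env \<rightarrow>\<^sub>M count_space UNIV" by measurable
    then show ?case by (simp add: s_Suc[abs_def])
  qed (simp add: s_0[abs_def])
  have step: "Y w (Suc n) = Y w n + 1 \<or> Y w (Suc n) = Y w n - 1" for w n
    by (rule nn_path.Y_step[OF nn_path_Y])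
  have Y0: "Y w 0 = 0" for w by (rule nn_path.Y_0[OF nn_path_Y])
  have s_alive: "s n w = Y w n" if "alive n w" for n w
  proof (cases n)
    case (Suc n')
    then have "alive n' w" using that by (auto simp: alive_def)
    then show ?thesis by (simp add: Suc s_Suc)
  qed (simp add: s_0 Y0)
  have s_bounds: "- int m \<le> s n w \<and> s n w \<le> int k" for n w
  proof (induction n)
    case (Suc n)
    show ?case
    proof (cases "alive n w")
      case True
      then have "- int m < Y w n" "Y w n < int k" by (auto simp: alive_def)
      then show ?thesis using step[of w n] True by (auto simp: s_Suc)
    qed (use Suc in \<open>simp add: s_Suc\<close>)
  qed (simp add: s_0)
  have s_dead: "s n w = - int m \<or> (\<exists>l. Y w l = int k)" if "\<not> alive n w" for n w
    using that
  proof (induction n)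
    case 0
    \<comment> \<open>At time 0 the walk can be outside the interval only for \<open>k = 0\<close>,
      and then it is already at \<open>k\<close>.\<close>
    then show ?case using m by (auto simp: alive_def Y0 intro!: exI[of _ 0])
  next
    case (Suc n)
    show ?case
    proof (cases "alive n w")
      case True
      then have "- int m < Y w n" "Y w n < int k" by (auto simp: alive_def)
      moreover have "\<not> (- int m < Y w (Suc n) \<and> Y w (Suc n) < int k)"
        using True Suc.prems by (auto simp: alive_def le_Suc_eq)
      ultimately have "Y w (Suc n) = - int m \<or> Y w (Suc n) = int k"
        using step[of w n] by auto
      then show ?thesis using True by (auto simp: s_Suc)
    qed (use Suc in \<open>simp add: s_Suc\<close>)
  qed
  define A where "A n = (\<integral>w. \<phi> (s n w) \<partial>env)" for n
  define q where "q n = measure env {w \<in> space env. alive n w}" for n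
  let ?M = "(real m + real k)\<^sup>2"
  have \<phi>_bound: "0 \<le> \<phi> (s n w)" "\<phi> (s n w) \<le> ?M" for n w
  proof -
    have "0 \<le> real_of_int (s n w) + real m" "real_of_int (s n w) + real m \<le> real m + real k"
      using s_bounds[of n w] by linarith+
    then show "\<phi> (s n w) \<le> ?M" unfolding \<phi>_def by (intro power_mono)
  qed (simp add: \<phi>_def)
  have int_\<phi>: "integrable env (\<lambda>w. \<phi> (s n w))" for n
    by (rule env.integrable_const_bound[of _ ?M]) (use \<phi>_bound in auto)
  have A_bounds: "A n \<le> ?M" for n
    unfolding A_def using integral_mono[OF int_\<phi> _ \<phi>_bound(2), of n] by (simp add: env.prob_space)
  have A_0: "A 0 = (real m)\<^sup>2" by (simp add: A_def s_0 \<phi>_def env.prob_space)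
  have A_step: "A n + q n \<le> A (Suc n)" for n
  proof -
    \<comment> \<open>The factor \<open>y + m\<close> in the increment of \<open>\<phi>\<close>,
      switched off after the exit. As a function of the history it is independent of the next
      seed.\<close>
    define g where "g h = (if \<forall>z\<in>set h. - int m < level z \<and> level z < int k
      then if h = [] then 0 else real_of_int (level (hd h)) + real m else 0)" for h :: "(int ^ 'd) list"
    have g_bounds: "0 \<le> g h" "g h \<le> real m + real k" for h
    proof -
      have "0 \<le> real_of_int (level (hd h)) + real m \<and> real_of_int (level (hd h)) + real m \<le> real m + real k"
        if *: "\<forall>z\<in>set h. - int m < level z \<and> level z < int k" "h \<noteq> []"
      proof -
        have "- int m < level (hd h)" "level (hd h) < int k" using * by auto
        then show ?thesis by linarith
      qed
      then show "0 \<le> g h" "g h \<le> real m + real k" by (auto simp: g_def)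
    qed
    have g_hist: "g (history w n) = (if alive n w then real_of_int (Y w n) + real m else 0)" for w
    proof -
      have "(\<forall>z\<in>set (history w n). - int m < level z \<and> level z < int k) \<longleftrightarrow> alive n w"
        unfolding history_eq alive_def Y_def by (auto simp: less_Suc_eq_le simp del: upt_Suc)
      then show ?thesis by (simp add: g_def Y_def X_def)
    qed
    let ?I = "\<lambda>w. of_bool (seed_at w (history w n) \<le> 1 / 2) :: real"
    have gm [measurable]: "(\<lambda>w. g (history w n)) \<in> borel_measurable env"
      by (rule measurable_compose[OF measurable_history]) simp
    have Im [measurable]: "?I \<in> borel_measurable env" by measurable
    have int1: "integrable env (\<lambda>w. g (history w n))"
      by (rule env.integrable_const_bound[of _ "real m + real k"]) (use g_bounds in auto)
    have int2: "integrable env (\<lambda>w. g (history w n) * ?I w)"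
      by (rule env.integrable_const_bound[of _ "real m + real k"]) (use g_bounds in auto)
    have int3: "integrable env (\<lambda>w. indicator {w \<in> space env. alive n w} w :: real)"
      by (rule env.integrable_const_bound[of _ 1]) auto
    \<comment> \<open>The bracket has mean 0, because the seed is at most 1/2 with probability 1/2.
      Before the exit the increment of \<open>\<phi>\<close> is at least 1 plus the bracket: it is
      \<open>2 * (y + m) + 1\<close> on a step up, which such a seed enforces, and at least
      \<open>1 - 2 * (y + m)\<close> in any case.\<close>
    have "A n + q n = (\<integral>w. \<phi> (s n w) + indicator {w \<in> space env. alive n w} w +
        (4 * (g (history w n) * ?I w) - 2 * g (history w n)) \<partial>env)"
      using int_\<phi>[of n] int1 int2 int3 integral_seed_history[of g "real m + real k" n] g_bounds
      by (simp add: A_def q_def)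
    also have "\<dots> \<le> A (Suc n)"
      unfolding A_def
    proof (rule integral_mono_AE)
      show "AE w in env. \<phi> (s n w) + indicator {w \<in> space env. alive n w} w +
          (4 * (g (history w n) * ?I w) - 2 * g (history w n)) \<le> \<phi> (s (Suc n) w)"
        using AE_env AE_space
      proof eventually_elim
        case (elim w)
        show ?case
        proof (cases "alive n w")
          case True
          then have pos: "0 < real_of_int (Y w n) + real m"
            by (auto simp: alive_def)
          have up: "Y w (Suc n) = Y w n + 1" if "seed_at w (history w n) \<le> 1 / 2"
          proof (rule step_up)
            have "0 \<le> drift (fst (w (Y w n) (rank (history w n)))) \<bullet> diagonal" using elim by blast
            then show "seed_at w (history w n) \<le> (1 + drift (fst (w (Y w n) (rank (history w n)))) \<bullet> diagonal) / 2"
              using that by simp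
          qed (use elim in simp)
          show ?thesis
          proof (cases "seed_at w (history w n) \<le> 1 / 2")
            case t: True
            then show ?thesis using True up elim pos
              by (simp add: g_hist s_alive s_Suc \<phi>_def power2_eq_square algebra_simps)
          next
            case f: False
            consider "Y w (Suc n) = Y w n + 1" | "Y w (Suc n) = Y w n - 1" using step[of w n] by blast
            then have "\<phi> (s n w) + 1 - 2 * (real_of_int (Y w n) + real m) \<le> \<phi> (s (Suc n) w)"
            proof cases
              case 1
              then have "\<phi> (s (Suc n) w) = (real_of_int (Y w n) + real m + 1)\<^sup>2"
                using True by (simp add: s_Suc \<phi>_def algebra_simps)
              then show ?thesis
                using True pos by (simp add: s_alive \<phi>_def power2_eq_square algebra_simps)
            next
              case 2
              have "real_of_int (Y w n - 1) + real m = real_of_int (Y w n) + real m - 1" by simp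
              then have "\<phi> (s (Suc n) w) = (real_of_int (Y w n) + real m - 1)\<^sup>2"
                using True 2 by (simp only: s_Suc \<phi>_def if_True)
              then show ?thesis
                using True by (simp add: s_alive \<phi>_def power2_eq_square algebra_simps)
            qed
            then show ?thesis using True f elim by (simp add: g_hist)
          qed
        next
          case False
          then show ?thesis by (simp add: g_hist s_Suc)
        qed
      qed
    qed (use int_\<phi> int1 int2 int3 in auto)
    finally show ?thesis .
  qed
  have A_sum: "(real m)\<^sup>2 + (\<Sum>i<n. q i) \<le> A n" for n
  proof (induction n)
    case (Suc n)
    then show ?case using A_step[of n] by simp
  qed (simp add: A_0)
  have q_anti: "q n \<le> q i" if "i \<le> n" for i n
    unfolding q_def using that by (intro env.finite_measure_mono) (auto simp: alive_def)
  \<comment> \<open>\<open>A\<close> gains \<open>q i\<close> at each step and stays below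
    \<open>?M\<close>; as \<open>q\<close> decreases, survival up to time \<open>N\<close> has
    probability at most \<open>?M / N\<close>.\<close>
  have "real N * q N \<le> (\<Sum>i<N. q i)"
    using sum_bounded_below[of "{..<N}" "q N" q] q_anti by simp
  also have "\<dots> \<le> ?M" using A_sum[of N] A_bounds[of N] zero_le_power2[of "real m"] by linarith
  finally have qN: "q N \<le> ?M / real N" using N by (simp add: field_simps)
  define E where "E = {w \<in> space env. \<exists>n. Y w n = int k}"
  have [measurable]: "E \<in> sets env" unfolding E_def by measurable
  have "(real m)\<^sup>2 \<le> A N" using A_sum[of N] by (smt (verit) q_def measure_nonneg sum_nonneg)
  \<comment> \<open>\<open>\<phi>\<close> vanishes at the lower exit \<open>-m\<close>, so only
    walks that hit \<open>k\<close> or are still inside contribute.\<close>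
  also have "A N \<le> (\<integral>w. ?M * indicator E w + ?M * indicator {w \<in> space env. alive N w} w \<partial>env)"
    unfolding A_def
  proof (rule integral_mono[OF int_\<phi>])
    fix w assume w: "w \<in> space env"
    show "\<phi> (s N w) \<le> ?M * indicator E w + ?M * indicator {w \<in> space env. alive N w} w"
    proof (cases "alive N w")
      case True
      then have "?M * indicator {w \<in> space env. alive N w} w = ?M" using w by simp
      moreover have "0 \<le> ?M * indicator E w" by simp
      ultimately show ?thesis using \<phi>_bound(2)[of N w] by linarith
    next
      case False
      from s_dead[OF this] show ?thesis
      proof
        assume "s N w = - int m"
        then show ?thesis by (simp add: \<phi>_def)
      next
        assume "\<exists>l. Y w l = int k"
        then have "?M * indicator E w = ?M" using w by (simp add: E_def)
        moreover have "0 \<le> ?M * indicator {w \<in> space env. alive N w} w" by simp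
        ultimately show ?thesis using \<phi>_bound(2)[of N w] by linarith
      qed
    qed
  qed (auto simp: less_top[symmetric])
  also have "\<dots> = ?M * measure env E + ?M * q N"
    by (simp add: q_def less_top[symmetric])
  finally have "(real m)\<^sup>2 \<le> ?M * (measure env E + q N)" by (simp add: algebra_simps)
  moreover have "0 < ?M" using m by simp
  ultimately have "(real m)\<^sup>2 / ?M \<le> measure env E + q N" by (simp add: field_simps)
  then show ?thesis using qN by (simp add: E_def)
qed

text \<open>First the time \<open>N\<close>, then the distance \<open>m\<close> of the lower barrier
  tends to infinity.\<close>

lemma AE_hit: "AE w in env. \<exists>n. Y w n = int k"
proof -
  let ?p = "measure env {w \<in> space env. \<exists>n. Y w n = int k}"
  have 1: "(real m)\<^sup>2 / (real m + real k)\<^sup>2 \<le> ?p" if m: "0 < m" for m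
  proof (rule LIMSEQ_le_const2)
    have "(\<lambda>N. (real m)\<^sup>2 / (real m + real k)\<^sup>2 - (real m + real k)\<^sup>2 / real N) \<longlonglongrightarrow>
        (real m)\<^sup>2 / (real m + real k)\<^sup>2 - 0"
      by (intro tendsto_diff tendsto_const lim_const_over_n)
    then show "(\<lambda>N. (real m)\<^sup>2 / (real m + real k)\<^sup>2 - (real m + real k)\<^sup>2 / real N) \<longlonglongrightarrow>
        (real m)\<^sup>2 / (real m + real k)\<^sup>2" by simp
    show "\<exists>N0. \<forall>N\<ge>N0. (real m)\<^sup>2 / (real m + real k)\<^sup>2 - (real m + real k)\<^sup>2 / real N \<le> ?p"
      using prob_hit_ge[OF m] by (intro exI[of _ 1]) auto
  qed
  have "1 \<le> ?p"
  proof (rule LIMSEQ_le_const2)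
    have "(\<lambda>m. real k / real m) \<longlonglongrightarrow> 0" by (rule lim_const_over_n)
    then have "(\<lambda>m. (1 / (1 + real k / real m))\<^sup>2) \<longlonglongrightarrow> (1 / (1 + 0))\<^sup>2"
      by (intro tendsto_intros) auto
    then show "(\<lambda>m. (1 / (1 + real k / real m))\<^sup>2) \<longlonglongrightarrow> 1" by simp
    have "(1 / (1 + real k / real m))\<^sup>2 \<le> ?p" if "1 \<le> m" for m
    proof -
      have "1 + real k / real m = (real m + real k) / real m" using that by (simp add: field_simps)
      then have "(1 / (1 + real k / real m))\<^sup>2 = (real m)\<^sup>2 / (real m + real k)\<^sup>2"
        by (simp add: power_divide)
      then show ?thesis using 1[of m] that by simp
    qed
    then show "\<exists>N. \<forall>m\<ge>N. (1 / (1 + real k / real m))\<^sup>2 \<le> ?p" by blast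
  qed
  then have "?p = 1" using env.prob_le_1 antisym by blast
  then show ?thesis by (subst (asm) env.prob_Collect_eq_1) auto
qed

section \<open>The columns carry cookies\<close>

definition good :: "(int ^ 'd) measure \<times> real \<Rightarrow> bool" where
  "good v \<longleftrightarrow> a \<le> drift (fst v) \<bullet> diagonal"

lemma b_le_1: "b \<le> 1"
  using drift_ge \<mu>.prob_le_1 by metis

lemma a_le_1: "a \<le> 1"
proof -
  have "{p \<in> space \<mu>. drift p \<bullet> diagonal \<ge> a} \<noteq> {}"
    using drift_ge b_pos by (metis less_irrefl measure_empty)
  then obtain p where "p \<in> space \<mu>" "a \<le> drift p \<bullet> diagonal" by blast
  then show ?thesis using drift_le_1[of p] by (simp add: space_\<mu>)
qed

lemma measurable_good [measurable]: "Measurable.pred cell good"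
proof -
  have "(\<lambda>v. drift (fst v) \<bullet> diagonal) \<in> borel_measurable cell"
    by (rule measurable_compose[OF measurable_fst_cell measurable_drift])
  then show ?thesis unfolding good_def by measurable
qed

lemma prob_cell:
  assumes A: "A \<in> sets \<mu>" and t: "0 \<le> t" "t \<le> 1"
  shows "measure cell {v \<in> space cell. fst v \<in> A \<and> snd v \<le> t} = measure \<mu> A * t"
proof -
  have "{v \<in> space cell. fst v \<in> A \<and> snd v \<le> t} = A \<times> {u. u \<le> t}"
    using sets.sets_into_space[OF A] by (auto simp: cell_def space_pair_measure)
  moreover have "emeasure cell (A \<times> {u. u \<le> t}) = emeasure \<mu> A * emeasure seeds {u. u \<le> t}"
    unfolding cell_def using A by (intro seeds.emeasure_pair_measure_Times) auto
  moreover have "emeasure seeds {u. u \<le> t} = ennreal t"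
    using t by (simp add: seeds.emeasure_eq_measure measure_seeds_le)
  ultimately have "ennreal (measure cell {v \<in> space cell. fst v \<in> A \<and> snd v \<le> t}) = ennreal (measure \<mu> A * t)"
    using t by (simp add: cell.emeasure_eq_measure[symmetric] \<mu>.emeasure_eq_measure ennreal_mult)
  then show ?thesis using t by (subst (asm) ennreal_inj) auto
qed

sublocale cookies: cookie_columns cell good snd a b
proof
  let ?A = "{p \<in> space \<mu>. drift p \<bullet> diagonal \<ge> a}" and ?B = "{p \<in> space \<mu>. \<not> drift p \<bullet> diagonal \<ge> a}"
  have sp: "v \<in> space cell \<Longrightarrow> fst v \<in> space \<mu>" for v by (rule measurable_space[OF measurable_fst_cell])
  have A: "?A \<in> sets \<mu>" and B: "?B \<in> sets \<mu>" by measurable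
  have "?B = space \<mu> - ?A" by auto
  then have mB: "measure \<mu> ?B = 1 - b" using \<mu>.prob_compl[OF A] drift_ge by simp
  show "snd \<in> borel_measurable cell"
    using measurable_snd_cell by (simp add: measurable_cong_sets[OF refl sets_seeds])
  show "measure cell {v \<in> space cell. good v \<and> snd v \<le> (1 + a) / 2} = b * ((1 + a) / 2)"
  proof -
    have "{v \<in> space cell. good v \<and> snd v \<le> (1 + a) / 2} = {v \<in> space cell. fst v \<in> ?A \<and> snd v \<le> (1 + a) / 2}"
      using sp by (auto simp: good_def)
    then show ?thesis using prob_cell[OF A, of "(1 + a) / 2"] a_pos a_le_1 drift_ge by simp
  qed
  show "measure cell {v \<in> space cell. \<not> good v \<and> snd v \<le> 1 / 2} = (1 - b) / 2"
  proof -
    have "{v \<in> space cell. \<not> good v \<and> snd v \<le> 1 / 2} = {v \<in> space cell. fst v \<in> ?B \<and> snd v \<le> 1 / 2}"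
      using sp by (auto simp: good_def)
    then show ?thesis using prob_cell[OF B, of "1 / 2"] mB by simp
  qed
  show "measure cell {v \<in> space cell. snd v \<le> 1 / 2} = 1 / 2"
  proof -
    have "{v \<in> space cell. snd v \<le> 1 / 2} = {v \<in> space cell. fst v \<in> space \<mu> \<and> snd v \<le> 1 / 2}"
      using sp by auto
    then show ?thesis using prob_cell[of "space \<mu>" "1 / 2"] by (simp add: \<mu>.prob_space)
  qed
  show "measure cell {v \<in> space cell. good v} = b"
  proof -
    have "{v \<in> space cell. good v} = ?A \<times> space seeds"
      by (auto simp: good_def cell_def space_pair_measure)
    moreover have "emeasure cell (?A \<times> space seeds) = emeasure \<mu> ?A * emeasure seeds (space seeds)"
      unfolding cell_def using A by (intro seeds.emeasure_pair_measure_Times) auto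
    ultimately show ?thesis
      using drift_ge by (simp add: measure_def seeds.emeasure_space_1[simplified])
  qed
qed (use a_pos a_le_1 b_pos b_le_1 in auto)

lemma T_eq: "cookies.T = PiM UNIV (\<lambda>_. column_law)"
  by (simp add: column_law_def)

text \<open>\<open>\<beta> K\<close> tends to \<open>b / (1 - b)\<close>, or equals \<open>K\<close>
  if \<open>b = 1\<close>; so a strict inequality for the limit already holds at some finite
  \<open>K\<close>.\<close>

lemma exists_cookie_bound:
  assumes "b = 1 \<or> a * b / (1 - b) > t"
  shows "\<exists>K. t < a * cookies.\<beta> K"
proof (cases "b = 1")
  case True
  obtain K :: nat where "t / a < real K" using reals_Archimedean2 by blast
  moreover have "cookies.\<beta> K = real K" by (subst cookies.\<beta>_def) (simp add: True)
  ultimately show ?thesis using a_pos by (intro exI[of _ K]) (simp add: divide_less_eq mult.commute)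
next
  case False
  then have b: "b < 1" using b_le_1 by simp
  have "cookies.\<beta> K * (1 - b) = b * (1 - b ^ K)" for K
  proof (induction K)
    case (Suc K)
    have "cookies.\<beta> (Suc K) * (1 - b) = b * (1 - b) + b * (cookies.\<beta> K * (1 - b))"
      unfolding cookies.\<beta>_Suc by (simp add: algebra_simps)
    then show ?case unfolding Suc by (simp add: algebra_simps)
  qed simp
  then have closed: "cookies.\<beta> K = b * (1 - b ^ K) / (1 - b)" for K
    using b by (simp add: eq_divide_eq)
  have "(\<lambda>K. a * (b * (1 - b ^ K) / (1 - b))) \<longlonglongrightarrow> a * (b * (1 - 0) / (1 - b))"
    using b b_pos by (intro tendsto_intros LIMSEQ_power_zero) auto
  moreover have "t < a * (b * (1 - 0) / (1 - b))" using assms False by simp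
  ultimately have "\<forall>\<^sub>F K in sequentially. t < a * (b * (1 - b ^ K) / (1 - b))"
    by (rule order_tendstoD)
  then show ?thesis unfolding closed using eventually_happens by force
qed

section \<open>Two-sided and one-sided families of columns\<close>

definition nonneg_columns :: "((int ^ 'd) measure, real) columns \<Rightarrow> nat \<Rightarrow> nat \<Rightarrow> (int ^ 'd) measure \<times> real" where
  "nonneg_columns w = (\<lambda>k. w (int k))"

text \<open>A right inverse of \<open>nonneg_columns\<close>. Negative indices receive column 0, an
  arbitrary filling that is harmless for functions of the nonnegative columns.\<close>

definition extend :: "(nat \<Rightarrow> nat \<Rightarrow> (int ^ 'd) measure \<times> real) \<Rightarrow> ((int ^ 'd) measure, real) columns" where
  "extend c = (\<lambda>j. c (nat j))"

lemma measurable_nonneg_columns [measurable]: "nonneg_columns \<in> env \<rightarrow>\<^sub>M cookies.T"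
  unfolding nonneg_columns_def T_eq env_def
  by (rule measurable_PiM_single') (rule measurable_component_singleton, auto simp: space_PiM)

lemma measurable_extend [measurable]: "extend \<in> cookies.T \<rightarrow>\<^sub>M env"
  unfolding extend_def T_eq env_def
  by (rule measurable_PiM_single') (rule measurable_component_singleton, auto simp: space_PiM)

lemma measurable_above [measurable]: "above k \<in> env \<rightarrow>\<^sub>M env"
  unfolding above_def env_def
  by (rule measurable_PiM_single') (rule measurable_component_singleton, auto simp: space_PiM)

lemma distr_nonneg_columns: "distr env cookies.T nonneg_columns = cookies.T"
  using distr_PiM_reindex[of UNIV "\<lambda>_. column_law" int UNIV] column_law.prob_space_axioms
  by (simp add: T_eq env_def nonneg_columns_def[abs_def] restrict_UNIV)

lemma distr_above: "distr env env (above k) = env"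
  using distr_PiM_reindex[of UNIV "\<lambda>_. column_law" "\<lambda>j. j + int k" UNIV] column_law.prob_space_axioms
  by (simp add: env_def above_def[abs_def] restrict_UNIV)

lemma AE_nonneg_columns: "AE c in cookies.T. P c \<Longrightarrow> AE w in env. P (nonneg_columns w)"
  by (rule AE_distrD[of nonneg_columns env cookies.T])
    (simp_all only: distr_nonneg_columns measurable_nonneg_columns)

lemma AE_above: "AE w in env. P w \<Longrightarrow> AE w in env. P (above k w)"
  by (rule AE_distrD[of "above k" env env]) (simp_all only: distr_above measurable_above)

lemma above_eq_extend: "0 \<le> j \<Longrightarrow> above k w j = extend (lshift k (nonneg_columns w)) j"
  by (simp add: above_def extend_def lshift_def nonneg_columns_def)

lemma AE_climbing: "AE w in env. climbing_walk sample w"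
proof -
  have "AE w in env. climbs w"
    unfolding climbs_def AE_all_countable using AE_hit by (rule allI)
  then have "AE w in env. \<forall>k. climbs (above k w)"
    unfolding AE_all_countable by (intro allI AE_above)
  then show ?thesis
    by eventually_elim (unfold_locales, blast)
qed

text \<open>The threshold in \<open>arrows\<close> is a lower bound for the upward mass
  \<open>(1 + drift) / 2\<close> of the current site, in the good case through
  \<open>rank_le_visit\<close>.\<close>

lemma arrows_up:
  assumes w: "w \<in> space env" "\<forall>j i. 0 \<le> drift (fst (w j i)) \<bullet> diagonal"
    and Y: "Y w n = int j" and arrow: "cookies.arrows K (nonneg_columns w j) (visits (Y w) n)"
  shows "Y w (Suc n) = int j + 1"
proof -
  let ?v = "visit (history w n)" and ?r = "rank (history w n)"
  let ?d = "drift (fst (w (Y w n) ?r)) \<bullet> diagonal"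
  have seed: "seed_at w (history w n) = snd (w (Y w n) ?v)" by (simp add: seed_at_def Y_def X_def)
  have rv: "?r \<le> ?v" by (rule rank_le_visit) simp
  have d: "0 \<le> ?d" using w by blast
  have arrow': "snd (w (Y w n) ?v) \<le>
      (if ?v < K \<and> (\<forall>l\<le>?v. good (w (Y w n) l)) then (1 + a) / 2 else 1 / 2)"
    using arrow by (simp only: cookies.arrows_def nonneg_columns_def visit_history[symmetric] Y)
  have "seed_at w (history w n) \<le> (1 + ?d) / 2"
  proof (cases "?v < K \<and> (\<forall>l\<le>?v. good (w (Y w n) l))")
    case True
    then have "good (w (Y w n) ?r)" using rv by blast
    then have "(1 + a) / 2 \<le> (1 + ?d) / 2" by (simp add: good_def)
    then show ?thesis using arrow' True seed by simp
  next
    case False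
    moreover have "1 / 2 \<le> (1 + ?d) / 2" using d by simp
    ultimately show ?thesis using arrow' seed by (simp only: if_False)
  qed
  then show ?thesis using step_up[OF w(1)] Y by simp
qed

lemma downs_le:
  assumes w: "w \<in> space env" "\<forall>j i. 0 \<le> drift (fst (w j i)) \<bullet> diagonal" "climbing_walk sample w"
    and N: "H w k \<le> N" and j: "j \<le> k"
  shows "downs (Y w) (int j) (H w k) \<le> cookies.branching N K (k - j) (lshift j (nonneg_columns w))"
  by (rule cookies.downs_le_branching[OF nn_path_Y climbing_walk.hit[OF w(3)] N _ j])
    (rule arrows_up[OF w(1,2)])

section \<open>Positive probability of never returning\<close>

lemma measurable_stays [measurable]: "Measurable.pred env stays"
  unfolding stays_def by measurable

text \<open>Going below 0 requires a down-step from level 0, which forces the branching process to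
  end in a nonzero state. The bound passes to all times by letting first the horizon
  \<open>N\<close> and then the time \<open>i\<close> grow.\<close>

lemma prob_stays_pos:
  assumes K: "1 < a * cookies.\<beta> K"
  shows "0 < measure env {w \<in> space env. stays w}"
proof -
  obtain \<epsilon> where *: "0 < \<epsilon> \<and>
      (\<forall>n k. \<epsilon> \<le> measure cookies.T {c \<in> space cookies.T. cookies.branching n K k c = 0})"
    using cookies.prob_branching_eq_0[OF K] by (rule exE)
  have \<epsilon>: "0 < \<epsilon>"
    "\<epsilon> \<le> measure cookies.T {c \<in> space cookies.T. cookies.branching n K k c = 0}" for n k
    using * by simp_all
  have br: "measure env {w \<in> space env. cookies.branching n K k (nonneg_columns w) \<noteq> 0} \<le> 1 - \<epsilon>" for n k
  proof -
    let ?Z = "{c \<in> space cookies.T. cookies.branching n K k c = 0}"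
    have Z: "?Z \<in> sets cookies.T" by measurable
    have "measure env {w \<in> space env. cookies.branching n K k (nonneg_columns w) = 0} =
        measure (distr env cookies.T nonneg_columns) ?Z"
      using measurable_space[OF measurable_nonneg_columns]
      by (subst measure_distr[OF measurable_nonneg_columns Z]) (auto intro!: arg_cong[of _ _ "measure env"])
    then have "\<epsilon> \<le> measure env {w \<in> space env. cookies.branching n K k (nonneg_columns w) = 0}"
      using \<epsilon>(2)[of n k] by (simp add: distr_nonneg_columns)
    moreover have "measure env {w \<in> space env. cookies.branching n K k (nonneg_columns w) \<noteq> 0} =
        1 - measure env {w \<in> space env. cookies.branching n K k (nonneg_columns w) = 0}"
      by (rule env.prob_neg) measurable
    ultimately show ?thesis by simp
  qed
  define D where "D i = {w \<in> space env. \<exists>n\<le>i. Y w n < 0}" for i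
  have [measurable]: "D i \<in> sets env" for i unfolding D_def by measurable
  have D_le: "measure env (D i) \<le> 1 - \<epsilon>" for i
  proof -
    \<comment> \<open>The event that horizon \<open>N\<close> is too short for hitting level
      \<open>Suc i\<close>; its probability tends to 0 by \<open>AE_hit\<close>.\<close>
    define L where "L N = {w \<in> space env. \<forall>n\<le>N. Y w n \<noteq> int (Suc i)}" for N
    have [measurable]: "L N \<in> sets env" for N unfolding L_def by measurable
    have "AE w in env. w \<in> (D i) \<longrightarrow> w \<in> {w \<in> space env. cookies.branching N K (Suc i) (nonneg_columns w) \<noteq> 0} \<union> L N" for N
      using AE_env AE_climbing AE_space
    proof eventually_elim
      case (elim w)
      interpret climbing_walk sample w by (rule elim)
      show ?case
      proof (intro impI)
        assume D: "w \<in> D i"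
        show "w \<in> {w \<in> space env. cookies.branching N K (Suc i) (nonneg_columns w) \<noteq> 0} \<union> L N"
        proof (cases "w \<in> L N")
          case False
          then obtain t where t: "t \<le> N" "Y w t = int (Suc i)" using elim by (auto simp: L_def)
          have HN: "H w (Suc i) \<le> N"
            using t before_hitting_time[OF hit, of t "Suc i"] by (metis less_irrefl not_le order_trans)
          obtain n where n: "n \<le> i" "Y w n < 0" using D by (auto simp: D_def)
          define n0 where "n0 = (LEAST n. Y w n < 0)"
          have n0: "Y w n0 < 0" unfolding n0_def by (rule LeastI[of _ n]) (rule n)
          have n0_le: "n0 \<le> i" using Least_le[of "\<lambda>n. Y w n < 0" n] n unfolding n0_def by simp
          obtain l where l: "n0 = Suc l" using n0 by (cases n0) auto
          have "0 \<le> Y w l" using not_less_Least[of l "\<lambda>n. Y w n < 0"] l unfolding n0_def by force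
          then have "Y w l = 0" "Y w (Suc l) = - 1" using n0 Y_step[of l] l by auto
          \<comment> \<open>Level \<open>Suc i\<close> cannot be hit by time \<open>i\<close>, so
            this down-step happens before the hitting time and is counted.\<close>
          moreover have "l < H w (Suc i)" using hitting_time_ge[OF hit, of "Suc i"] n0_le l by simp
          ultimately have "l \<in> {n. n < H w (Suc i) \<and> Y w n = 0 \<and> Y w (Suc n) = 0 - 1}" by simp
          then have "downs (Y w) 0 (H w (Suc i)) \<noteq> 0" unfolding downs_def by (auto simp: card_eq_0_iff)
          moreover have "downs (Y w) (int 0) (H w (Suc i)) \<le> cookies.branching N K (Suc i - 0) (lshift 0 (nonneg_columns w))"
            by (rule downs_le[OF elim(3,1,2) HN]) simp
          ultimately have "cookies.branching N K (Suc i) (nonneg_columns w) \<noteq> 0"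
            by (simp del: cookies.branching.simps)
          then show ?thesis using elim by blast
        qed simp
      qed
    qed
    then have "measure env (D i) \<le> measure env ({w \<in> space env. cookies.branching N K (Suc i) (nonneg_columns w) \<noteq> 0} \<union> L N)" for N
      by (rule env.finite_measure_mono_AE) measurable
    also have "\<dots> N \<le> measure env {w \<in> space env. cookies.branching N K (Suc i) (nonneg_columns w) \<noteq> 0} + measure env (L N)" for N
      by (rule measure_Un_le) measurable
    also have "\<dots> N \<le> 1 - \<epsilon> + measure env (L N)" for N
      by (rule add_right_mono) (rule br)
    finally have le: "measure env (D i) \<le> 1 - \<epsilon> + measure env (L N)" for N .
    have "(\<lambda>N. measure env (L N)) \<longlonglongrightarrow> measure env (\<Inter>N. L N)"
      by (rule env.finite_Lim_measure_decseq) (auto simp: L_def decseq_def)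
    moreover have "measure env (\<Inter>N. L N) = 0"
    proof -
      have "AE w in env. w \<notin> (\<Inter>N. L N)" using AE_hit[of "Suc i"]
        by eventually_elim (auto simp: L_def)
      then show ?thesis by (subst env.prob_eq_0) auto
    qed
    ultimately have "(\<lambda>N. 1 - \<epsilon> + measure env (L N)) \<longlonglongrightarrow> 1 - \<epsilon> + 0"
      by (intro tendsto_add tendsto_const) simp
    then show ?thesis using le by (intro LIMSEQ_le_const[of _ "1 - \<epsilon>"]) auto
  qed
  have "(\<lambda>i. measure env (D i)) \<longlonglongrightarrow> measure env (\<Union>i. D i)"
    by (rule env.finite_Lim_measure_incseq) (auto simp: D_def incseq_def intro: order_trans)
  then have "measure env (\<Union>i. D i) \<le> 1 - \<epsilon>"
    using D_le by (intro LIMSEQ_le_const2) auto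
  moreover have "stays w \<longleftrightarrow> (\<forall>i. \<not> (\<exists>n\<le>i. Y w n < 0))" for w
    unfolding stays_def by (meson not_less order_refl)
  then have "{w \<in> space env. stays w} = space env - (\<Union>i. D i)"
    unfolding D_def by blast
  then have "measure env {w \<in> space env. stays w} = 1 - measure env (\<Union>i. D i)"
    by (simp add: env.prob_compl)
  ultimately show ?thesis using \<epsilon> by simp
qed

section \<open>Integrability of the gaps\<close>

lemma measurable_H [measurable]: "(\<lambda>w. H w k) \<in> env \<rightarrow>\<^sub>M count_space UNIV"
  unfolding hitting_time_def by measurable

lemma measurable_stays_above [measurable]: "Measurable.pred env (\<lambda>w. stays (above k w))"
  by (rule measurable_compose[OF measurable_above measurable_stays])

lemma measurable_duration [measurable]: "duration L \<in> env \<rightarrow>\<^sub>M count_space UNIV"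
proof -
  have "(\<lambda>w. H w (LEAST k. 0 < k \<and> stays (above k w))) \<in> env \<rightarrow>\<^sub>M count_space UNIV"
    by (rule measurable_compose_countable[OF measurable_H]) measurable
  then show ?thesis unfolding duration_def by measurable
qed

lemma measurable_gap [measurable]: "gap \<in> env \<rightarrow>\<^sub>M count_space UNIV"
  unfolding gap_def by (rule measurable_compose_countable[OF measurable_duration]) measurable

lemma integral_branching_shift:
  "integrable env (\<lambda>w. real (cookies.branching N K t (lshift j (nonneg_columns w))))"
  "(\<integral>w. real (cookies.branching N K t (lshift j (nonneg_columns w))) \<partial>env) =
    (\<integral>c. real (cookies.branching N K t c) \<partial>cookies.T)"
proof -
  let ?f = "\<lambda>c. real (cookies.branching N K t c)"
  have int: "integrable cookies.T ?f" by (rule cookies.integrable_branching)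
  note sh = cookies.columns.integrable_lshift[OF int, of j]
  have "integrable (distr env cookies.T nonneg_columns) (\<lambda>c. ?f (lshift j c))"
    using sh(1) by (simp only: distr_nonneg_columns)
  then show "integrable env (\<lambda>w. ?f (lshift j (nonneg_columns w)))"
    by (rule integrable_distr[OF measurable_nonneg_columns])
  have "(\<integral>w. ?f (lshift j (nonneg_columns w)) \<partial>env) = (\<integral>c. ?f (lshift j c) \<partial>distr env cookies.T nonneg_columns)"
    by (rule integral_distr[symmetric, OF measurable_nonneg_columns borel_measurable_integrable[OF sh(1)]])
  also have "\<dots> = (\<integral>c. ?f (lshift j c) \<partial>cookies.T)" by (simp only: distr_nonneg_columns)
  also have "\<dots> = (\<integral>c. ?f c \<partial>cookies.T)" by (rule sh(2))
  finally show "(\<integral>w. ?f (lshift j (nonneg_columns w)) \<partial>env) = (\<integral>c. ?f c \<partial>cookies.T)" .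
qed

text \<open>The comparison needs a horizon beyond the hitting time, which has no deterministic
  bound. So the integral is first restricted to hitting times up to \<open>N\<close>; the bound by
  occupation times is uniform in \<open>N\<close>, and monotone convergence removes the
  restriction.\<close>

lemma nn_integral_duration_sum_le:
  assumes C: "0 \<le> C" "\<And>n k. (\<Sum>t<k. \<integral>c. real (cookies.branching n K t c) \<partial>cookies.T) \<le> C * real k"
  shows "(\<integral>\<^sup>+w. of_nat (\<Sum>i<M. duration L (above i w)) \<partial>env) \<le> ennreal ((2 * C + 1) * (real (M + L) + 1))"
proof -
  let ?R = "M + L"
  let ?F = "\<lambda>w. of_nat (\<Sum>i<M. duration L (above i w)) :: ennreal"
  have dm: "(\<lambda>w. duration L (above i w)) \<in> env \<rightarrow>\<^sub>M count_space UNIV" for i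
    by (rule measurable_compose[OF measurable_above measurable_duration])
  have Fm [measurable]: "?F \<in> borel_measurable env"
    unfolding of_nat_sum
    by (intro borel_measurable_sum measurable_compose[OF dm]) simp
  let ?G = "\<lambda>N w. ?F w * indicator {w \<in> space env. H w ?R \<le> N} w"
  have G_le: "(\<integral>\<^sup>+w. ?G N w \<partial>env) \<le> ennreal ((2 * C + 1) * (real ?R + 1))" for N
  proof -
    define B where "B w = real ?R + 2 * (\<Sum>j\<le>?R. real (cookies.branching N K (?R - j) (lshift j (nonneg_columns w))))" for w
    have B_int: "integrable env B"
      unfolding B_def by (intro Bochner_Integration.integrable_add integrable_mult_right Bochner_Integration.integrable_sum integral_branching_shift) simp
    have "(\<integral>w. B w \<partial>env) = real ?R + 2 * (\<Sum>j\<le>?R. \<integral>c. real (cookies.branching N K (?R - j) c) \<partial>cookies.T)"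
      unfolding B_def
      by (simp add: integral_branching_shift env.prob_space)
    also have "(\<Sum>j\<le>?R. \<integral>c. real (cookies.branching N K (?R - j) c) \<partial>cookies.T) =
        (\<Sum>t<Suc ?R. \<integral>c. real (cookies.branching N K t c) \<partial>cookies.T)"
      using sum.nat_diff_reindex[of "\<lambda>t. \<integral>c. real (cookies.branching N K t c) \<partial>cookies.T" "Suc ?R"]
      by (simp only: diff_Suc_Suc lessThan_Suc_atMost)
    also have "real ?R + 2 * \<dots> \<le> real ?R + 2 * (C * real (Suc ?R))"
      using C(2)[of N "Suc ?R"] by simp
    also have "\<dots> \<le> (2 * C + 1) * (real ?R + 1)"
      by (simp add: algebra_simps)
    finally have B_le: "(\<integral>w. B w \<partial>env) \<le> (2 * C + 1) * (real ?R + 1)" .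
    have B_nonneg: "0 \<le> B w" for w unfolding B_def by (intro add_nonneg_nonneg mult_nonneg_nonneg sum_nonneg) auto
    have "(\<integral>\<^sup>+w. ?G N w \<partial>env) \<le> (\<integral>\<^sup>+w. ennreal (B w) \<partial>env)"
    proof (rule nn_integral_mono_AE)
      show "AE w in env. ?G N w \<le> ennreal (B w)"
        using AE_env AE_climbing AE_space
      proof eventually_elim
        case (elim w)
        interpret climbing_walk sample w by (rule elim)
        show ?case
        proof (cases "H w ?R \<le> N")
          case True
          have "(\<Sum>i<M. duration L (above i w)) \<le> occupation ?R" by (rule sum_duration_le)
          also have "\<dots> \<le> ?R + 2 * (\<Sum>j\<le>?R. downs (Y w) (int j) (H w ?R))"
            by (rule occupation_le) (rule hit)
          also have "\<dots> \<le> ?R + 2 * (\<Sum>j\<le>?R. cookies.branching N K (?R - j) (lshift j (nonneg_columns w)))"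
            by (intro add_left_mono mult_left_mono sum_mono downs_le elim True) auto
          finally have "real (\<Sum>i<M. duration L (above i w)) \<le>
              real (?R + 2 * (\<Sum>j\<le>?R. cookies.branching N K (?R - j) (lshift j (nonneg_columns w))))"
            by (rule of_nat_mono)
          also have "\<dots> = B w" unfolding B_def by simp
          finally have "ennreal (real (\<Sum>i<M. duration L (above i w))) \<le> ennreal (B w)"
            by (rule ennreal_leI)
          then have "?F w \<le> ennreal (B w)" by (simp only: ennreal_of_nat_eq_real_of_nat)
          then show ?thesis using True elim by (simp only: indicator_simps mem_Collect_eq simp_thms mult_1_right)
        next
          case False
          then have "indicator {w \<in> space env. H w ?R \<le> N} w = (0 :: ennreal)" by simp
          then show ?thesis by (simp only: mult_zero_right zero_le)
        qed
      qed
    qed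
    also have "\<dots> = ennreal (\<integral>w. B w \<partial>env)"
      by (rule nn_integral_eq_integral[OF B_int]) (simp add: B_nonneg)
    also have "\<dots> \<le> ennreal ((2 * C + 1) * (real ?R + 1))"
      by (rule ennreal_leI) (rule B_le)
    finally show ?thesis .
  qed
  have "(\<integral>\<^sup>+w. ?F w \<partial>env) \<le> (\<integral>\<^sup>+w. (SUP N. ?G N w) \<partial>env)"
  proof (rule nn_integral_mono)
    fix w assume w: "w \<in> space env"
    have "?F w = ?G (H w ?R) w" using w by simp
    also have "\<dots> \<le> (SUP N. ?G N w)" by (rule SUP_upper) simp
    finally show "?F w \<le> (SUP N. ?G N w)" .
  qed
  also have "\<dots> = (SUP N. \<integral>\<^sup>+w. ?G N w \<partial>env)"
  proof (rule nn_integral_monotone_convergence_SUP)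
    show "incseq ?G" by (auto simp: incseq_def le_fun_def indicator_def)
    have [measurable]: "{w \<in> space env. H w ?R \<le> N} \<in> sets env" for N by measurable
    show "?G N \<in> borel_measurable env" for N
      by (intro borel_measurable_times_ennreal Fm borel_measurable_indicator) measurable
  qed
  also have "\<dots> \<le> ennreal ((2 * C + 1) * (real ?R + 1))"
    by (rule SUP_least) (rule G_le)
  finally show ?thesis .
qed

text \<open>By stationarity \<open>M\<close> times the mean of \<open>duration L\<close> is at most
  \<open>(2 * C + 1) * (M + L + 1)\<close>. Dividing by \<open>M\<close> and letting it grow removes
  the dependence on \<open>L\<close>.\<close>

lemma nn_integral_duration_le:
  assumes C: "0 \<le> C" "\<And>n k. (\<Sum>t<k. \<integral>c. real (cookies.branching n K t c) \<partial>cookies.T) \<le> C * real k"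
  shows "(\<integral>\<^sup>+w. of_nat (duration L w) \<partial>env) \<le> ennreal (2 * C + 1)"
proof -
  let ?D = "\<integral>\<^sup>+w. of_nat (duration L w) \<partial>env :: ennreal"
  have meas: "(\<lambda>w. of_nat (duration L w) :: ennreal) \<in> borel_measurable env"
    by (rule measurable_compose[OF measurable_duration]) simp
  have ab: "(\<integral>\<^sup>+w. of_nat (duration L (above i w)) \<partial>env) = ?D" for i
  proof -
    have "(\<integral>\<^sup>+w. of_nat (duration L w) \<partial>distr env env (above i)) =
        (\<integral>\<^sup>+w. of_nat (duration L (above i w)) \<partial>env :: ennreal)"
      by (rule nn_integral_distr[OF measurable_above]) (simp only: measurable_distr_eq1 meas)
    then show ?thesis by (simp only: distr_above)
  qed
  have sum: "of_nat M * ?D \<le> ennreal ((2 * C + 1) * (real (M + L) + 1))" for M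
  proof -
    have "of_nat M * ?D = (\<Sum>i<M. \<integral>\<^sup>+w. of_nat (duration L (above i w)) \<partial>env)"
      by (simp only: ab sum_constant card_lessThan)
    also have "\<dots> = (\<integral>\<^sup>+w. (\<Sum>i<M. of_nat (duration L (above i w))) \<partial>env)"
      by (rule nn_integral_sum[symmetric]) (rule measurable_compose[OF measurable_above meas])
    also have "\<dots> \<le> ennreal ((2 * C + 1) * (real (M + L) + 1))"
      using nn_integral_duration_sum_le[OF C, of L M] by (simp only: of_nat_sum)
    finally show ?thesis .
  qed
  have fin: "?D \<noteq> \<top>" using sum[of 1] by (auto simp: top_unique)
  define d where "d = enn2real ?D"
  have d: "?D = ennreal d" using fin by (simp add: d_def less_top)
  have d0: "0 \<le> d" by (simp add: d_def)
  have "d \<le> (2 * C + 1) + (2 * C + 1) * (real L + 1) / real M" if M: "1 \<le> M" for M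
  proof -
    have "ennreal (real M * d) \<le> ennreal ((2 * C + 1) * (real (M + L) + 1))"
      using sum[of M, unfolded d] d0
      by (simp only: ennreal_of_nat_eq_real_of_nat ennreal_mult of_nat_0_le_iff)
    then have "real M * d \<le> (2 * C + 1) * (real (M + L) + 1)"
      using C(1) by (subst (asm) ennreal_le_iff) auto
    then show ?thesis using M by (simp add: field_simps)
  qed
  then have "\<exists>N. \<forall>M\<ge>N. d \<le> (2 * C + 1) + (2 * C + 1) * (real L + 1) / real M" by blast
  moreover have "(\<lambda>M. (2 * C + 1) + (2 * C + 1) * (real L + 1) / real M) \<longlonglongrightarrow> (2 * C + 1) + 0"
    by (intro tendsto_add tendsto_const lim_const_over_n)
  ultimately have "d \<le> (2 * C + 1) + 0" by (intro LIMSEQ_le_const) auto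
  then show ?thesis unfolding d by (intro ennreal_leI) simp
qed

text \<open>Monotone convergence in the cut-off \<open>L\<close>, as each gap is one of the
  durations.\<close>

lemma integrable_gap:
  assumes K: "2 < a * cookies.\<beta> K"
  shows "integrable env (\<lambda>w. real (gap w))"
proof -
  obtain C where C: "0 \<le> C \<and>
      (\<forall>n k. (\<Sum>t<k. \<integral>c. real (cookies.branching n K t c) \<partial>cookies.T) \<le> C * real k)"
    using cookies.sum_branching_le[OF K] by (rule exE)
  have meas: "(\<lambda>w. of_nat (duration L w) :: ennreal) \<in> borel_measurable env" for L
    by (rule measurable_compose[OF measurable_duration]) simp
  have "(\<integral>\<^sup>+w. ennreal (real (gap w)) \<partial>env) \<le> (\<integral>\<^sup>+w. (SUP L. of_nat (duration L w)) \<partial>env)"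
  proof (rule nn_integral_mono)
    fix w
    obtain L where "gap w = duration L w" using gap_eq_duration by (rule exE)
    then have "ennreal (real (gap w)) = of_nat (duration L w)" by (simp only: ennreal_of_nat_eq_real_of_nat)
    also have "\<dots> \<le> (SUP L. of_nat (duration L w))" by (rule SUP_upper) simp
    finally show "ennreal (real (gap w)) \<le> (SUP L. of_nat (duration L w))" .
  qed
  also have "\<dots> = (SUP L. \<integral>\<^sup>+w. of_nat (duration L w) \<partial>env)"
  proof (rule nn_integral_monotone_convergence_SUP)
    show "incseq (\<lambda>L w. of_nat (duration L w) :: ennreal)"
    proof (intro incseq_SucI le_funI)
      show "(of_nat (duration n w) :: ennreal) \<le> of_nat (duration (Suc n) w)" for n w
        using duration_mono[of n w 1] by simp
    qed
  qed (rule meas)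
  also have "\<dots> \<le> ennreal (2 * C + 1)"
    by (rule SUP_least) (rule nn_integral_duration_le[of C K], use C in simp_all)
  finally have "(\<integral>\<^sup>+w. ennreal (real (gap w)) \<partial>env) < \<infinity>"
    by (rule le_less_trans) simp
  moreover have "(\<lambda>w. real (gap w)) \<in> borel_measurable env"
    by (rule measurable_compose[OF measurable_gap]) simp
  ultimately show ?thesis by (intro integrableI_nonneg) auto
qed

section \<open>Transience and positive speed\<close>

text \<open>A function of the nonnegative columns factors through a one-sided i.i.d. sequence of
  columns, where \<open>above k\<close> becomes \<open>lshift k\<close> and the ergodic theorem
  applies.\<close>

lemma AE_regeneration_averages:
  fixes f :: "((int ^ 'd) measure, real) columns \<Rightarrow> real"
  assumes f: "integrable env f" and cong: "\<And>w w'. (\<And>j. 0 \<le> j \<Longrightarrow> w j = w' j) \<Longrightarrow> f w = f w'"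
  shows "AE w in env. (\<lambda>K. (\<Sum>k<K. f (above k w)) / real K) \<longlonglongrightarrow> (\<integral>w. f w \<partial>env)"
proof -
  have eq: "f (extend (lshift k (nonneg_columns w))) = f (above k w)" for k w
    by (rule cong) (rule above_eq_extend[symmetric])
  have eq0: "f (extend (nonneg_columns w)) = f w" for w
    using eq[of 0 w] by simp
  have fe: "(\<lambda>c. f (extend c)) \<in> borel_measurable cookies.T"
    by (rule measurable_compose[OF measurable_extend]) (use f in blast)
  have "integrable (distr env cookies.T nonneg_columns) (\<lambda>c. f (extend c))"
    by (subst integrable_distr_eq[OF measurable_nonneg_columns fe]) (simp only: eq0 f)
  then have int: "integrable cookies.T (\<lambda>c. f (extend c))" by (simp only: distr_nonneg_columns)
  have "(\<integral>c. f (extend c) \<partial>cookies.T) = (\<integral>c. f (extend c) \<partial>distr env cookies.T nonneg_columns)"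
    by (simp only: distr_nonneg_columns)
  also have "\<dots> = (\<integral>w. f w \<partial>env)"
    by (subst integral_distr[OF measurable_nonneg_columns fe]) (simp only: eq0)
  finally have I: "(\<integral>c. f (extend c) \<partial>cookies.T) = (\<integral>w. f w \<partial>env)" .
  have "AE w in env. (\<lambda>n. (\<Sum>k<n. f (extend (lshift k (nonneg_columns w)))) / real n) \<longlonglongrightarrow>
      (\<integral>c. f (extend c) \<partial>cookies.T)"
    by (rule AE_nonneg_columns) (rule cookies.columns.ergodic_theorem[OF int])
  then show ?thesis by (simp only: eq I)
qed

lemma AE_regenerations:
  assumes K: "1 < a * cookies.\<beta> K"
  shows "\<exists>p>0. AE w in env. (\<lambda>K. (\<Sum>k<K. of_bool (stays (above k w))) / real K) \<longlonglongrightarrow> p \<and>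
    infinite {k. stays (above k w)}"
proof -
  define p where "p = (\<integral>w. of_bool (stays w) \<partial>env :: real)"
  have "p = (\<integral>w. indicator {w \<in> space env. stays w} w \<partial>env)"
    unfolding p_def by (intro Bochner_Integration.integral_cong) (auto simp: indicator_def)
  then have p: "0 < p" using prob_stays_pos[OF K] by simp
  have int: "integrable env (\<lambda>w. of_bool (stays w) :: real)"
    by (rule env.integrable_const_bound[of _ 1]) auto
  have "AE w in env. (\<lambda>K. (\<Sum>k<K. of_bool (stays (above k w))) / real K) \<longlonglongrightarrow> p"
    unfolding p_def
    by (rule AE_regeneration_averages[OF int]) (rule arg_cong[of _ _ of_bool], rule stays_cong)
  then have "AE w in env. (\<lambda>K. (\<Sum>k<K. of_bool (stays (above k w))) / real K) \<longlonglongrightarrow> p \<and>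
    infinite {k. stays (above k w)}"
  proof eventually_elim
    case (elim w)
    have "infinite {k. stays (above k w)}"
    proof
      assume fin: "finite {k. stays (above k w)}"
      let ?m = "real (card {k. stays (above k w)})"
      have "(\<Sum>k<K. of_bool (stays (above k w)) :: real) \<le> ?m" for K
      proof -
        have "(\<Sum>k<K. of_bool (stays (above k w)) :: real) = real (card {k \<in> {..<K}. stays (above k w)})"
          by (simp add: of_bool_def sum.If_cases Int_def)
        also have "\<dots> \<le> ?m" using fin by (intro of_nat_mono card_mono) auto
        finally show ?thesis .
      qed
      then have "(\<Sum>k<K. of_bool (stays (above k w))) / real K \<le> ?m / real K" for K
        by (intro divide_right_mono) auto
      then have "p \<le> 0"
        using elim by (intro LIMSEQ_le[OF elim lim_const_over_n[of ?m]]) auto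
      then show False using p by simp
    qed
    then show ?case using elim by simp
  qed
  then show ?thesis using p by (intro exI[of _ p]) simp
qed

lemma AE_transient:
  assumes K: "1 < a * cookies.\<beta> K"
  shows "AE w in env. filterlim (\<lambda>n. real_of_int (Y w n)) at_top sequentially"
proof -
  obtain p where "0 < p \<and> (AE w in env. (\<lambda>K. (\<Sum>k<K. of_bool (stays (above k w))) / real K) \<longlonglongrightarrow> p \<and>
    infinite {k. stays (above k w)})"
    using AE_regenerations[OF K] by (rule exE)
  then have "AE w in env. (\<lambda>K. (\<Sum>k<K. of_bool (stays (above k w))) / real K) \<longlonglongrightarrow> p \<and>
    infinite {k. stays (above k w)}" ..
  then show ?thesis
    using AE_climbing
  proof eventually_elim
    case (elim w)
    interpret climbing_walk sample w by (rule elim)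
    show ?case by (rule transient) (use elim in \<open>simp add: G_def\<close>)
  qed
qed

lemma AE_speed:
  assumes K: "2 < a * cookies.\<beta> K"
  shows "\<exists>v>0. AE w in env. (\<lambda>n. real_of_int (Y w n) / real n) \<longlonglongrightarrow> v"
proof -
  have K1: "1 < a * cookies.\<beta> K" using K by simp
  obtain p where p: "0 < p \<and> (AE w in env. (\<lambda>K. (\<Sum>k<K. of_bool (stays (above k w))) / real K) \<longlonglongrightarrow> p \<and>
    infinite {k. stays (above k w)})"
    using AE_regenerations[OF K1] by (rule exE)
  define c where "c = (\<integral>w. real (gap w) \<partial>env)"
  have "AE w in env. (\<lambda>K. (\<Sum>k<K. real (gap (above k w))) / real K) \<longlonglongrightarrow> c"
    unfolding c_def
    by (rule AE_regeneration_averages[OF integrable_gap[OF K]]) (rule arg_cong[of _ _ real], rule gap_cong)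
  with conjunct2[OF p] have AE: "AE w in env. 0 < c \<and> (\<lambda>n. real_of_int (Y w n) / real n) \<longlonglongrightarrow> 1 / c"
    using AE_climbing
  proof eventually_elim
    case (elim w)
    interpret climbing_walk sample w by (rule elim)
    have inf: "infinite G" using elim by (simp add: G_def)
    show ?case
      using speed[OF elim(2) conjunct1[OF elim(1)] conjunct1[OF p] inf] by (rule conjI)
  qed
  \<comment> \<open>\<open>speed\<close> yields this only for almost every \<open>w\<close>, but the
    statement does not involve \<open>w\<close> and \<open>env\<close> is a probability
    measure.\<close>
  have "0 < c"
  proof (rule ccontr)
    assume "\<not> 0 < c"
    with AE have "AE w in env. False" by simp
    then show False by simp
  qed
  then show ?thesis using AE by (intro exI[of _ "1 / c"]) auto
qed

end

lemma inner_diagonal: "real_vec x \<bullet> diagonal = real_of_int (level x)"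
proof -
  have "diagonal $ i = 1" for i :: 'a
    by (simp add: diagonal_def axis_def)
  then show ?thesis by (simp add: inner_vec_def real_vec_def level_def)
qed

text \<open>Division by zero gives 0 in HOL, so the case \<open>b = 1\<close>, where the quotient
  counts as infinite, enters as a separate disjunct.\<close>

theorem theorem4p10:
  fixes \<mu> :: "(int ^ 'd) measure measure" and a b :: real
  assumes "CARD('d) \<ge> 2"
    and "prob_space \<mu>" and "sets \<mu> = sets transition_laws"
    and "measure \<mu> {p \<in> space \<mu>. drift p \<bullet> diagonal \<ge> 0} = 1"
    and "measure \<mu> {p \<in> space \<mu>. drift p \<bullet> diagonal \<ge> a} = b"
    and "a > 0" and "b > 0"
  shows "(b = 1 \<or> a * b / (1 - b) > 1 \<longrightarrow>
      (AE X in annealed_law \<mu>.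
        filterlim (\<lambda>n. real_vec (X n) \<bullet> diagonal) at_top sequentially)) \<and>
    (b = 1 \<or> a * b / (1 - b) > 2 \<longrightarrow>
      (AE X in annealed_law \<mu>.
        \<exists>v>0. (\<lambda>n. real_vec (X n) \<bullet> diagonal / real n) \<longlonglongrightarrow> v))"
proof (intro conjI impI)
  interpret rwre \<mu> a b by (rule rwre.intro) fact+
  have coord [measurable]: "(\<lambda>x. real_vec (x n) \<bullet> diagonal) \<in> borel_measurable trajectories" for n
    by (rule measurable_compose[OF measurable_component_singleton]) auto
  have Y: "real_vec (X w n) \<bullet> diagonal = real_of_int (Y w n)" for w n
    by (simp add: inner_diagonal Y_def)
  {
    assume "b = 1 \<or> a * b / (1 - b) > 1"
    then obtain K where K: "1 < a * cookies.\<beta> K" using exists_cookie_bound by blast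
    let ?P = "\<lambda>x :: nat \<Rightarrow> int ^ 'd. filterlim (\<lambda>n. real_vec (x n) \<bullet> diagonal) at_top sequentially"
    \<comment> \<open>Integer thresholds in place of real ones leave countable quantifiers only,
      which makes the event measurable.\<close>
    have "?P x \<longleftrightarrow> (\<forall>Z::nat. \<exists>N. \<forall>n\<ge>N. real Z \<le> real_vec (x n) \<bullet> diagonal)" for x
    proof
      assume "?P x"
      then show "\<forall>Z::nat. \<exists>N. \<forall>n\<ge>N. real Z \<le> real_vec (x n) \<bullet> diagonal"
        by (simp add: filterlim_at_top eventually_sequentially)
    next
      assume *: "\<forall>Z::nat. \<exists>N. \<forall>n\<ge>N. real Z \<le> real_vec (x n) \<bullet> diagonal"
      show "?P x"
        unfolding filterlim_at_top
      proof
        fix z :: real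
        obtain Z :: nat where "z \<le> real Z" using real_arch_simple by blast
        moreover obtain N where "\<forall>n\<ge>N. real Z \<le> real_vec (x n) \<bullet> diagonal" using * by blast
        ultimately show "\<forall>\<^sub>F n in sequentially. z \<le> real_vec (x n) \<bullet> diagonal"
          unfolding eventually_sequentially by (meson order_trans)
      qed
    qed
    moreover have "Measurable.pred trajectories
        (\<lambda>x :: nat \<Rightarrow> int ^ 'd. \<forall>Z::nat. \<exists>N. \<forall>n\<ge>N. real Z \<le> real_vec (x n) \<bullet> diagonal)"
      by measurable
    ultimately have "Measurable.pred trajectories ?P" by simp
    moreover have "AE w in env. ?P (X w)" unfolding Y by (rule AE_transient[OF K])
    ultimately show "AE X in annealed_law \<mu>. ?P X" by (rule AE_annealed_law)
  }
  {
    assume "b = 1 \<or> a * b / (1 - b) > 2"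
    then obtain K where K: "2 < a * cookies.\<beta> K" using exists_cookie_bound by blast
    obtain v where v: "0 < v \<and> (AE w in env. (\<lambda>n. real_of_int (Y w n) / real n) \<longlonglongrightarrow> v)"
      using AE_speed[OF K] by (rule exE)
    have "AE x in annealed_law \<mu>. (\<lambda>n. real_vec (x n) \<bullet> diagonal / real n) \<longlonglongrightarrow> v"
    proof (rule AE_annealed_law)
      show "Measurable.pred trajectories (\<lambda>x :: nat \<Rightarrow> int ^ 'd. (\<lambda>n. real_vec (x n) \<bullet> diagonal / real n) \<longlonglongrightarrow> v)"
        by measurable
      show "AE w in env. (\<lambda>n. real_vec (X w n) \<bullet> diagonal / real n) \<longlonglongrightarrow> v"
        unfolding Y using v by (rule conjunct2)
    qed
    then show "AE x in annealed_law \<mu>. \<exists>v>0. (\<lambda>n. real_vec (x n) \<bullet> diagonal / real n) \<longlonglongrightarrow> v"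
      by eventually_elim (use v in blast)
  }
qed

end
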